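(* Let $M$ be a contractible smooth manifold. Then every smooth vector bundle $E\to M$ is (smoothly) trivial, i.e. isomorphic, as a smooth vector bundle over the identity on $M$, to a product bundle $M\times V\to M$ for a finite-dimensional real vector space $V$.
   Context: All manifolds and vector bundles are smooth and real. *)

theory Defs
  imports "HOL-Analysis.Analysis"
begin

section \<open>Smooth maps between subsets of Euclidean spaces\<close>

text \<open>\<open>higher_differentiable_on T k f\<close> expresses that \<open>f\<close> is of class \<open>C\<^sup>k\<close> on \<open>T\<close>;
  it is only meant for open sets \<open>T\<close>.\<close>

primrec higher_differentiable_on ::
  "'a::real_normed_vector set \<Rightarrow> nat \<Rightarrow> ('a \<Rightarrow> 'b::real_normed_vector) \<Rightarrow> bool" where
  "higher_differentiable_on T 0 f \<longleftrightarrow> continuous_on T f"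
| "higher_differentiable_on T (Suc k) f \<longleftrightarrow>
     (\<forall>x\<in>T. f differentiable (at x)) \<and>
     (\<forall>v. higher_differentiable_on T k (\<lambda>x. frechet_derivative f (at x) v))"

text \<open>For arbitrary \<open>A\<close>, smoothness means local extendability to smooth maps on open subsets of
  the ambient space. If \<open>A\<close> is relatively open in a linear subspace \<open>S\<close>, this is ordinary
  smoothness with respect to any linear isomorphism of \<open>S\<close> with a coordinate space.\<close>

definition smooth_on ::
  "'a::real_normed_vector set \<Rightarrow> ('a \<Rightarrow> 'b::real_normed_vector) \<Rightarrow> bool" where
  "smooth_on A f \<longleftrightarrow>
     (\<forall>x\<in>A. \<exists>T g. open T \<and> x \<in> T \<and> (\<forall>k. higher_differentiable_on T k g) \<and>
                 (\<forall>y\<in>A \<inter> T. g y = f y))"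

section \<open>Smooth manifolds\<close>

text \<open>A chart is a pair of its domain and its coordinate map. Charts take values in a linear
  subspace \<open>model\<close> of a Euclidean space rather than in a whole type of class
  \<open>euclidean_space\<close>, because the latter always has dimension at least one; the dimension of the
  manifold is \<open>dim model\<close>, which may be any natural number. The smooth structure is
  the one generated by \<open>atlas\<close>, which need not be maximal.\<close>

record ('a, 'e) charted_space =
  space_of :: "'a topology"
  model :: "'e set"
  atlas :: "('a set \<times> ('a \<Rightarrow> 'e)) set"

definition smooth_manifold :: "('a, 'e::euclidean_space) charted_space \<Rightarrow> bool" where
  "smooth_manifold M \<longleftrightarrow>
     Hausdorff_space (space_of M) \<and> second_countable (space_of M) \<and> subspace (model M) \<and>
     (\<Union>(U, \<phi>)\<in>atlas M. U) = topspace (space_of M) \<and>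
     (\<forall>(U, \<phi>)\<in>atlas M.
        openin (space_of M) U \<and> openin (top_of_set (model M)) (\<phi> ` U) \<and>
        homeomorphic_map (subtopology (space_of M) U) (top_of_set (\<phi> ` U)) \<phi>) \<and>
     (\<forall>(U, \<phi>)\<in>atlas M. \<forall>(W, \<psi>)\<in>atlas M.
        smooth_on (\<phi> ` (U \<inter> W)) (\<psi> \<circ> inv_into U \<phi>))"

definition smooth_map ::
  "('a, 'e::euclidean_space) charted_space \<Rightarrow> ('b, 'g::euclidean_space) charted_space \<Rightarrow>
   ('a \<Rightarrow> 'b) \<Rightarrow> bool" where
  "smooth_map M N f \<longleftrightarrow>
     continuous_map (space_of M) (space_of N) f \<and>
     (\<forall>(U, \<phi>)\<in>atlas M. \<forall>(W, \<psi>)\<in>atlas N.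
        smooth_on (\<phi> ` (U \<inter> f -` W)) (\<psi> \<circ> f \<circ> inv_into U \<phi>))"

definition diffeomorphism ::
  "('a, 'e::euclidean_space) charted_space \<Rightarrow> ('b, 'g::euclidean_space) charted_space \<Rightarrow>
   ('a \<Rightarrow> 'b) \<Rightarrow> bool" where
  "diffeomorphism M N f \<longleftrightarrow>
     (\<exists>g. homeomorphic_maps (space_of M) (space_of N) f g \<and> smooth_map M N f \<and> smooth_map N M g)"

definition open_submanifold ::
  "('a, 'e) charted_space \<Rightarrow> 'a set \<Rightarrow> ('a, 'e) charted_space" where
  "open_submanifold M W =
     \<lparr>space_of = subtopology (space_of M) W, model = model M,
      atlas = {(U \<inter> W, \<phi>) |U \<phi>. (U, \<phi>) \<in> atlas M}\<rparr>"

definition product_manifold ::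
  "('a, 'e) charted_space \<Rightarrow> ('b, 'g) charted_space \<Rightarrow> ('a \<times> 'b, 'e \<times> 'g) charted_space" where
  "product_manifold M N =
     \<lparr>space_of = prod_topology (space_of M) (space_of N), model = model M \<times> model N,
      atlas = {(U \<times> W, map_prod \<phi> \<psi>) |U \<phi> W \<psi>. (U, \<phi>) \<in> atlas M \<and> (W, \<psi>) \<in> atlas N}\<rparr>"

definition linear_manifold :: "'f::euclidean_space set \<Rightarrow> ('f, 'f) charted_space" where
  "linear_manifold V = \<lparr>space_of = top_of_set V, model = V, atlas = {(V, id)}\<rparr>"

section \<open>Smooth real vector bundles\<close>

definition real_vector_space_on ::
  "'v set \<Rightarrow> ('v \<Rightarrow> 'v \<Rightarrow> 'v) \<Rightarrow> 'v \<Rightarrow> (real \<Rightarrow> 'v \<Rightarrow> 'v) \<Rightarrow> bool" where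
  "real_vector_space_on C add zero smul \<longleftrightarrow>
     zero \<in> C \<and>
     (\<forall>x\<in>C. \<forall>y\<in>C. add x y \<in> C) \<and>
     (\<forall>a. \<forall>x\<in>C. smul a x \<in> C) \<and>
     (\<forall>x\<in>C. \<forall>y\<in>C. \<forall>z\<in>C. add (add x y) z = add x (add y z)) \<and>
     (\<forall>x\<in>C. \<forall>y\<in>C. add x y = add y x) \<and>
     (\<forall>x\<in>C. add zero x = x) \<and>
     (\<forall>x\<in>C. \<exists>y\<in>C. add x y = zero) \<and>
     (\<forall>a. \<forall>x\<in>C. \<forall>y\<in>C. smul a (add x y) = add (smul a x) (smul a y)) \<and>
     (\<forall>a b. \<forall>x\<in>C. smul (a + b) x = add (smul a x) (smul b x)) \<and>
     (\<forall>a b. \<forall>x\<in>C. smul a (smul b x) = smul (a * b) x) \<and>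
     (\<forall>x\<in>C. smul 1 x = x)"

text \<open>The fibrewise operations are recorded on the total space: \<open>vadd\<close> is only relevant for two
  points of the same fibre, and \<open>vzero\<close> is the zero section.\<close>

record ('b, 'g, 'a) bundle_data =
  total :: "('b, 'g) charted_space"
  proj :: "'b \<Rightarrow> 'a"
  vadd :: "'b \<Rightarrow> 'b \<Rightarrow> 'b"
  vzero :: "'a \<Rightarrow> 'b"
  vscale :: "real \<Rightarrow> 'b \<Rightarrow> 'b"

definition fibre :: "('b, 'g, 'a) bundle_data \<Rightarrow> 'a \<Rightarrow> 'b set" where
  "fibre E p = {e \<in> topspace (space_of (total E)). proj E e = p}"

definition restrict_bundle ::
  "('b, 'g, 'a) bundle_data \<Rightarrow> 'a set \<Rightarrow> ('b, 'g, 'a) bundle_data" where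
  "restrict_bundle E U = E\<lparr>total := open_submanifold (total E) (proj E -` U)\<rparr>"

definition product_bundle ::
  "('a, 'e) charted_space \<Rightarrow> 'f::euclidean_space set \<Rightarrow> ('a \<times> 'f, 'e \<times> 'f, 'a) bundle_data" where
  "product_bundle M V =
     \<lparr>total = product_manifold M (linear_manifold V),
      proj = fst,
      vadd = (\<lambda>(x, v) (y, w). (x, v + w)),
      vzero = (\<lambda>x. (x, 0)),
      vscale = (\<lambda>c (x, v). (x, c *\<^sub>R v))\<rparr>"

text \<open>Isomorphisms over the identity of the base \<open>M\<close>.\<close>

definition bundle_isomorphism ::
  "('a, 'e) charted_space \<Rightarrow> ('b, 'g::euclidean_space, 'a) bundle_data \<Rightarrow>
   ('c, 'h::euclidean_space, 'a) bundle_data \<Rightarrow> ('b \<Rightarrow> 'c) \<Rightarrow> bool" where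
  "bundle_isomorphism M E E' \<Psi> \<longleftrightarrow>
     diffeomorphism (total E) (total E') \<Psi> \<and>
     (\<forall>e\<in>topspace (space_of (total E)). proj E' (\<Psi> e) = proj E e) \<and>
     (\<forall>p\<in>topspace (space_of M).
        (\<forall>e\<in>fibre E p. \<forall>e'\<in>fibre E p. \<Psi> (vadd E e e') = vadd E' (\<Psi> e) (\<Psi> e')) \<and>
        (\<forall>c. \<forall>e\<in>fibre E p. \<Psi> (vscale E c e) = vscale E' c (\<Psi> e)))"

text \<open>The typical fibre is a linear subspace \<open>F\<close> of a Euclidean space, so that the rank
  \<open>dim F\<close> may be any natural number, including zero.\<close>

definition smooth_vector_bundle ::
  "('a, 'e::euclidean_space) charted_space \<Rightarrow> 'f::euclidean_space set \<Rightarrow>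
   ('b, 'g::euclidean_space, 'a) bundle_data \<Rightarrow> bool" where
  "smooth_vector_bundle M F E \<longleftrightarrow>
     smooth_manifold M \<and> smooth_manifold (total E) \<and> subspace F \<and>
     smooth_map (total E) M (proj E) \<and>
     (\<forall>p\<in>topspace (space_of M).
        real_vector_space_on (fibre E p) (vadd E) (vzero E p) (vscale E)) \<and>
     (\<forall>p\<in>topspace (space_of M). \<exists>U. openin (space_of M) U \<and> p \<in> U \<and>
        (\<exists>\<Phi>. bundle_isomorphism (open_submanifold M U)
               (restrict_bundle E U) (product_bundle (open_submanifold M U) F) \<Phi>))"

end

theory Submission
  imports Defs
begin

text \<open>Fix local trivialisations of \<open>E\<close>; their transition functions form a smooth cocycle \<open>g\<close> with
  values in a general linear group, and a trivialisation of \<open>E\<close> is a family \<open>\<Omega> i\<close> of smooth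
  invertible maps with \<open>\<Omega> j * g j i = \<Omega> i\<close>. All conditions on \<open>\<Omega>\<close> except invertibility are
  preserved under convex combinations, and invertibility survives if the members combined are close
  to each other. This is used twice, with partitions of unity.

  First, let \<open>H\<close> contract \<open>M\<close> to a point and choose a continuous step size \<open>\<delta> > 0\<close> so small that
  \<open>H\<close> moves a point \<open>x\<close> only slightly during a time interval of length \<open>\<delta> x\<close>. The maps
  \<open>G\<^sub>n x = H (1 - min 1 (n * \<delta> x)) x\<close> start with a constant map, and the sequence is locally
  eventually equal to the identity. A trivialisation of the pullback of \<open>E\<close> along \<open>G\<^sub>n\<close> yields one
  along \<open>G\<^sub>n\<^sub>+\<^sub>1\<close>, by averaging the transports through the local trivialisations, and it does not
  change where the two maps agree. Hence the limit is a continuous trivialisation of \<open>E\<close> itself.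
  Second, this continuous trivialisation is replaced by a weighted sum of its values at the centres
  of a sufficiently fine cover, transported by \<open>g\<close>, which is smooth and still invertible.\<close>

subsection \<open>Calculus of iterated derivatives\<close>

text \<open>The contraction is only continuous, so whatever is built from it is at best continuous.
  Smoothness can come only from the cocycle \<open>g\<close> and from partitions of unity, which is
  why the averaging is done twice. Since \<open>M\<close> need not be compact, no fixed number of
  steps leads from the constant map to the identity, and the number of steps has to vary with the
  point.

  The transition maps act on a linear subspace \<open>F\<close> of a Euclidean space. They are
  extended to automorphisms of the ambient space, so that they lie in a normed space of operators,
  where weighted sums, limits and derivatives make sense; every construction must then also preserve
  \<open>F\<close>. Invertibility is tracked as injectivity, which is equivalent in finite
  dimension. Both averagings keep it by the same estimate: an operator that deviates from a known
  injective one by at most half of the norm of the latter's value, at every vector, has trivial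
  kernel.\<close>

lemma higher_differentiable_on_cong:
  assumes "open T" "\<And>x. x \<in> T \<Longrightarrow> f x = g x" "higher_differentiable_on T k f"
  shows "higher_differentiable_on T k g"
  using assms(2,3)
proof (induction k arbitrary: f g)
  case 0
  then show ?case by (simp cong: continuous_on_cong)
next
  case (Suc k)
  have d: "(g has_derivative frechet_derivative f (at x)) (at x)" if x: "x \<in> T" for x
    using Suc.prems x assms(1)
    by (auto intro: has_derivative_transform_within_open simp: frechet_derivative_works)
  have "frechet_derivative f (at x) = frechet_derivative g (at x)" if "x \<in> T" for x
    using d[OF that] frechet_derivative_at by blast
  then have "higher_differentiable_on T k (\<lambda>x. frechet_derivative g (at x) v)" for v
    using Suc.IH[of "\<lambda>x. frechet_derivative f (at x) v" "\<lambda>x. frechet_derivative g (at x) v"] Suc.prems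
    by simp
  moreover have "g differentiable at x" if "x \<in> T" for x
    using d[OF that] by (auto simp: differentiable_def)
  ultimately show ?case by simp
qed

lemma higher_differentiable_on_subset:
  "higher_differentiable_on T k f \<Longrightarrow> S \<subseteq> T \<Longrightarrow> higher_differentiable_on S k f"
  by (induction k arbitrary: f) (auto intro: continuous_on_subset)

lemma higher_differentiable_on_SucD:
  "higher_differentiable_on T (Suc k) f \<Longrightarrow> higher_differentiable_on T k f"
proof (induction k arbitrary: f)
  case 0
  then show ?case
    by (auto intro!: continuous_at_imp_continuous_on differentiable_imp_continuous_within)
next
  case (Suc k)
  then show ?case by simp
qed

text \<open>Allows each closure property below to be proved by exhibiting a derivative formula;
  uniqueness of the derivative identifies it with \<open>frechet_derivative\<close>.\<close>

lemma higher_differentiable_on_SucI: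
  assumes "open T" "\<And>x. x \<in> T \<Longrightarrow> (f has_derivative f' x) (at x)"
    "\<And>v. higher_differentiable_on T k (\<lambda>x. f' x v)"
  shows "higher_differentiable_on T (Suc k) f"
proof -
  have "f' x = frechet_derivative f (at x)" if "x \<in> T" for x
    using assms(2)[OF that] frechet_derivative_at by blast
  then have "higher_differentiable_on T k (\<lambda>x. frechet_derivative f (at x) v)" for v
    using higher_differentiable_on_cong[OF assms(1) _ assms(3)[of v]] by simp
  then show ?thesis using assms(2) by (auto simp: differentiable_def)
qed

lemma higher_differentiable_on_const: "higher_differentiable_on T k (\<lambda>x. c)"
  by (induction k arbitrary: c) auto

lemma higher_differentiable_on_bounded_linear:
  assumes "bounded_linear f"
  shows "higher_differentiable_on T k f"
proof (cases k)
  case 0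
  then show ?thesis using assms by (simp add: linear_continuous_on)
next
  case (Suc n)
  have "(f has_derivative f) (at x)" for x
    using assms by (simp add: bounded_linear_imp_has_derivative)
  then have "frechet_derivative f (at x) = f" "f differentiable at x" for x
    using frechet_derivative_at differentiable_def by (metis, metis)
  then show ?thesis using Suc by (simp add: higher_differentiable_on_const)
qed

lemma higher_differentiable_on_add:
  assumes "open T" "higher_differentiable_on T k f" "higher_differentiable_on T k g"
  shows "higher_differentiable_on T k (\<lambda>x. f x + g x)"
  using assms(2,3)
proof (induction k arbitrary: f g)
  case 0
  then show ?case by (simp add: continuous_on_add)
next
  case (Suc k)
  show ?case
  proof (rule higher_differentiable_on_SucI[OF assms(1)])
    fix x assume "x \<in> T"
    then show "((\<lambda>x. f x + g x) has_derivative
      (\<lambda>v. frechet_derivative f (at x) v + frechet_derivative g (at x) v)) (at x)"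
      using Suc.prems by (auto intro!: has_derivative_add simp: frechet_derivative_works)
  qed (use Suc in auto)
qed

text \<open>One induction serves real products, scaling, inner products and composition of
  operators. The product rule mixes a derivative of one factor with the other factor itself, so the
  hypotheses also have to be lowered by one order.\<close>

lemma higher_differentiable_on_bilinear:
  assumes "open T" "bounded_bilinear mul"
    "higher_differentiable_on T k f" "higher_differentiable_on T k g"
  shows "higher_differentiable_on T k (\<lambda>x. mul (f x) (g x))"
  using assms(3,4)
proof (induction k arbitrary: f g)
  case 0
  then show ?case using bounded_bilinear.continuous_on[OF assms(2)] by auto
next
  case (Suc k)
  show ?case
  proof (rule higher_differentiable_on_SucI[OF assms(1)])
    fix x assume "x \<in> T"
    then show "((\<lambda>x. mul (f x) (g x)) has_derivative
      (\<lambda>v. mul (f x) (frechet_derivative g (at x) v) + mul (frechet_derivative f (at x) v) (g x))) (at x)"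
      using Suc.prems by (auto intro!: bounded_bilinear.FDERIV[OF assms(2)] simp: frechet_derivative_works)
  next
    show "higher_differentiable_on T k
      (\<lambda>x. mul (f x) (frechet_derivative g (at x) v) + mul (frechet_derivative f (at x) v) (g x))" for v
      using Suc.prems Suc.prems[THEN higher_differentiable_on_SucD]
      by (intro higher_differentiable_on_add assms Suc.IH) simp_all
  qed
qed

lemma higher_differentiable_on_linear_comp:
  assumes "open T" "bounded_linear L" "higher_differentiable_on T k f"
  shows "higher_differentiable_on T k (\<lambda>x. L (f x))"
  using assms(3)
proof (induction k arbitrary: f)
  case 0
  then show ?case using assms(2) by (simp add: bounded_linear.continuous_on)
next
  case (Suc k)
  show ?case
  proof (rule higher_differentiable_on_SucI[OF assms(1)])
    fix x assume "x \<in> T"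
    then show "((\<lambda>x. L (f x)) has_derivative (\<lambda>v. L (frechet_derivative f (at x) v))) (at x)"
      using Suc.prems by (auto intro!: bounded_linear.has_derivative[OF assms(2)] simp: frechet_derivative_works)
  qed (use Suc in auto)
qed

lemma higher_differentiable_on_sum:
  assumes "open T" "\<And>i. i \<in> I \<Longrightarrow> higher_differentiable_on T k (f i)"
  shows "higher_differentiable_on T k (\<lambda>x. \<Sum>i\<in>I. f i x)"
  using assms(2)
  by (induction I rule: infinite_finite_induct)
     (auto intro: higher_differentiable_on_const higher_differentiable_on_add[OF assms(1)])

text \<open>The induction hypothesis controls the derivative of \<open>g\<close> only in a fixed
  direction, whereas the chain rule evaluates it in the moving direction \<open>?f' x v\<close>.
  Expanding that direction in a basis turns the derivative into a finite sum of products of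
  functions already under control; this is where the middle space has to be Euclidean.\<close>

lemma higher_differentiable_on_compose:
  fixes f :: "'a::real_normed_vector \<Rightarrow> 'b::euclidean_space" and g :: "'b \<Rightarrow> 'c::real_normed_vector"
  assumes "open T" "open S" "f ` T \<subseteq> S" "higher_differentiable_on T k f" "higher_differentiable_on S k g"
  shows "higher_differentiable_on T k (\<lambda>x. g (f x))"
  using assms(4,5)
proof (induction k arbitrary: g)
  case 0
  then have "continuous_on S g" "continuous_on T f" by simp_all
  from continuous_on_compose[OF this(2) continuous_on_subset[OF this(1) assms(3)]]
  show ?case by (simp add: comp_def)
next
  case (Suc k)
  let ?g' = "\<lambda>y. frechet_derivative g (at y)" and ?f' = "\<lambda>x. frechet_derivative f (at x)"
  have lin: "bounded_linear (?g' y)" if "y \<in> S" for y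
    using Suc.prems that by (auto simp: frechet_derivative_works has_derivative_def)
  show ?case
  proof (rule higher_differentiable_on_SucI[OF assms(1)])
    fix x assume x: "x \<in> T"
    then have fx: "f x \<in> S" using assms(3) by auto
    have "(f has_derivative ?f' x) (at x)" "(g has_derivative ?g' (f x)) (at (f x))"
      using Suc.prems x fx by (simp_all add: frechet_derivative_works)
    then have D: "((\<lambda>x. g (f x)) has_derivative (\<lambda>v. ?g' (f x) (?f' x v))) (at x)"
      by (rule has_derivative_compose[where f = f and g = g and f' = "?f' x" and g' = "?g' (f x)" and x = x])
    have "?g' (f x) w = (\<Sum>i\<in>Basis. (w \<bullet> i) *\<^sub>R ?g' (f x) i)" for w
    proof -
      interpret bounded_linear "?g' (f x)" by (rule lin[OF fx])
      have "?g' (f x) w = ?g' (f x) (\<Sum>i\<in>Basis. (w \<bullet> i) *\<^sub>R i)"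
        by (simp add: euclidean_representation)
      then show ?thesis by (simp add: sum scaleR)
    qed
    then show "((\<lambda>x. g (f x)) has_derivative
        (\<lambda>v. \<Sum>i\<in>Basis. (?f' x v \<bullet> i) *\<^sub>R ?g' (f x) i)) (at x)"
      by (intro has_derivative_eq_rhs[OF D] ext)
  next
    fix v
    have "higher_differentiable_on T k f"
      by (rule higher_differentiable_on_SucD[OF Suc.prems(1)])
    then have "higher_differentiable_on T k (\<lambda>x. ?g' (f x) i)" for i
      using Suc.IH[of "\<lambda>y. ?g' y i"] Suc.prems by simp
    moreover have "higher_differentiable_on T k (\<lambda>x. ?f' x v \<bullet> i)" for i
      using Suc.prems
      by (intro higher_differentiable_on_linear_comp[OF assms(1) bounded_linear_inner_left[of i]]) simp
    ultimately show "higher_differentiable_on T k (\<lambda>x. \<Sum>i\<in>Basis. (?f' x v \<bullet> i) *\<^sub>R ?g' (f x) i)"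
      by (intro higher_differentiable_on_sum[OF assms(1)]
          higher_differentiable_on_bilinear[OF assms(1) bounded_bilinear_scaleR])
  qed
qed

text \<open>The derivative is a product of the derivative of \<open>f\<close> and the reciprocal
  itself, so regularity of the reciprocal at order \<open>k\<close> gives order
  \<open>Suc k\<close>. The sign is written as a factor \<open>- 1\<close> so that the rule for
  products applies throughout.\<close>

lemma higher_differentiable_on_inverse_real:
  fixes f :: "'a::real_normed_vector \<Rightarrow> real"
  assumes "open T" "\<And>x. x \<in> T \<Longrightarrow> f x \<noteq> 0" "higher_differentiable_on T k f"
  shows "higher_differentiable_on T k (\<lambda>x. inverse (f x))"
  using assms(3)
proof (induction k)
  case 0
  then show ?case using assms(2) by (simp add: continuous_on_inverse)
next
  case (Suc k)
  let ?f' = "\<lambda>x. frechet_derivative f (at x)"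
  have IH: "higher_differentiable_on T k (\<lambda>x. inverse (f x))"
    by (rule Suc.IH[OF higher_differentiable_on_SucD[OF Suc.prems]])
  show ?case
  proof (rule higher_differentiable_on_SucI[OF assms(1)])
    fix x assume "x \<in> T"
    then show "((\<lambda>x. inverse (f x)) has_derivative (\<lambda>v. (- 1) * (inverse (f x) * ?f' x v * inverse (f x)))) (at x)"
      using Suc.prems assms(2)[of x] has_derivative_inverse[where f = f and x = x and f' = "?f' x" and S = UNIV]
      by (auto simp: frechet_derivative_works)
  next
    show "higher_differentiable_on T k (\<lambda>x. (- 1) * (inverse (f x) * ?f' x v * inverse (f x)))" for v
      using Suc.prems IH by (intro higher_differentiable_on_bilinear[OF assms(1) bounded_bilinear_mult]
         higher_differentiable_on_const) auto
  qed
qed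

lemma norm_blinfun_compose3: "norm (A o\<^sub>L B o\<^sub>L C) \<le> norm A * norm B * norm C"
proof -
  have "norm (A o\<^sub>L B o\<^sub>L C) \<le> norm (A o\<^sub>L B) * norm C" by (rule norm_blinfun_compose)
  also have "\<dots> \<le> norm A * norm B * norm C" by (intro mult_right_mono norm_blinfun_compose norm_ge_zero)
  finally show ?thesis .
qed

text \<open>Differentiating \<open>A B = 1\<close> gives \<open>B' = - B A' B\<close>, whence \<open>B\<close> gains one order of
  differentiability per step. Here \<open>B y - B x = - B y (A y - A x) B x\<close>.\<close>

lemma blinfun_inverse_continuous:
  fixes A B :: "'a \<Rightarrow> ('f::real_normed_vector \<Rightarrow>\<^sub>L 'f)"
  assumes A: "(A \<longlongrightarrow> A0) F" and inv: "\<forall>\<^sub>F x in F. B x o\<^sub>L A x = id_blinfun" "A0 o\<^sub>L B0 = id_blinfun"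
  shows "(B \<longlongrightarrow> B0) F"
proof -
  define c where "c = norm B0 + 1"
  have c: "c > 0" "norm B0 \<le> c" by (simp_all add: c_def add_nonneg_pos)
  have diff: "\<forall>\<^sub>F x in F. B x - B0 = B x o\<^sub>L (A0 - A x) o\<^sub>L B0"
    using inv(1)
  proof eventually_elim
    case (elim x)
    have "B x o\<^sub>L (A0 - A x) o\<^sub>L B0 = (B x o\<^sub>L (A0 o\<^sub>L B0)) - ((B x o\<^sub>L A x) o\<^sub>L B0)"
      by (rule blinfun_eqI) (simp add: blinfun.bilinear_simps)
    also have "\<dots> = B x - B0" unfolding elim inv by (rule blinfun_eqI) (simp add: blinfun.bilinear_simps)
    finally show ?case by simp
  qed
  have small: "((\<lambda>x. norm (A0 - A x)) \<longlongrightarrow> 0) F"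
    using tendsto_norm[OF tendsto_diff[OF tendsto_const[of A0] A]] by simp
  \<comment> \<open>The bound \<open>1 / (2 * c)\<close> makes the identity \<open>diff\<close>
    yield \<open>norm (B x) \<le> norm (B x) / 2 + c\<close>, an a priori bound on \<open>B\<close>
    before its convergence is known.\<close>
  then have "\<forall>\<^sub>F x in F. norm (A0 - A x) < 1 / (2 * c)"
    using c by (intro order_tendstoD) auto
  with diff have bd: "\<forall>\<^sub>F x in F. norm (B x) \<le> 2 * c"
  proof eventually_elim
    case (elim x)
    have "norm (B x) \<le> norm (B x - B0) + norm B0"
      by (metis diff_add_cancel norm_triangle_ineq)
    also have "norm (B x - B0) \<le> norm (B x) * norm (A0 - A x) * norm B0"
      unfolding elim(1) by (rule norm_blinfun_compose3)
    also have "\<dots> \<le> norm (B x) * (1 / (2 * c)) * c"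
      using elim(2) c by (intro mult_mono) auto
    also have "\<dots> = norm (B x) / 2" using c by simp
    finally show ?case using c(2) by linarith
  qed
  have "\<forall>\<^sub>F x in F. norm (B x - B0) \<le> 2 * c * norm (A0 - A x) * c"
    using diff bd
  proof eventually_elim
    case (elim x)
    have "norm (B x - B0) \<le> norm (B x) * norm (A0 - A x) * norm B0"
      unfolding elim(1) by (rule norm_blinfun_compose3)
    also have "\<dots> \<le> 2 * c * norm (A0 - A x) * c"
      using elim(2) c by (intro mult_mono) auto
    finally show ?case .
  qed
  moreover have "((\<lambda>x. 2 * c * norm (A0 - A x) * c) \<longlongrightarrow> 2 * c * 0 * c) F"
    by (intro tendsto_intros small)
  then have "((\<lambda>x. 2 * c * norm (A0 - A x) * c) \<longlongrightarrow> 0) F" by simp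
  ultimately have "((\<lambda>x. B x - B0) \<longlongrightarrow> 0) F"
    by (rule Lim_null_comparison)
  then show ?thesis by (rule LIM_zero_cancel)
qed

text \<open>In \<open>B y - B x = - B y (A y - A x) B x\<close>, replacing the outer
  \<open>B y\<close> by \<open>B x\<close> and the increment of \<open>A\<close> by its linear part
  leaves two errors. One contains \<open>B x - B y\<close> next to a bounded difference quotient and
  vanishes because \<open>B\<close> is already known to be continuous; the other contains the
  remainder \<open>r\<close> of \<open>A\<close>.\<close>

lemma has_derivative_blinfun_inverse:
  fixes A B :: "'a::real_normed_vector \<Rightarrow> ('f::real_normed_vector \<Rightarrow>\<^sub>L 'f)"
  assumes T: "open T" "x \<in> T" and inv: "\<And>x. x \<in> T \<Longrightarrow> A x o\<^sub>L B x = id_blinfun"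
    "\<And>x. x \<in> T \<Longrightarrow> B x o\<^sub>L A x = id_blinfun"
    and A: "(A has_derivative A') (at x)"
  shows "(B has_derivative (\<lambda>v. - (B x o\<^sub>L A' v o\<^sub>L B x))) (at x)"
proof -
  have ev: "\<forall>\<^sub>F y in at x. y \<in> T" using T by (rule eventually_at_in_open')
  have evs: "\<forall>\<^sub>F y in at x. B y o\<^sub>L A y = id_blinfun"
    by (rule eventually_mono[OF ev], erule inv)
  have tB: "(B \<longlongrightarrow> B x) (at x)"
    by (rule blinfun_inverse_continuous[where A=A and ?A0.0="A x"])
       (use has_derivative_continuous[OF A] T inv evs in \<open>simp_all add: continuous_within\<close>)
  interpret A': bounded_linear A' using A by (rule has_derivative_bounded_linear)
  have lin: "bounded_linear (\<lambda>v. - (B x o\<^sub>L A' v o\<^sub>L B x))"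
  proof -
    have "bounded_linear (\<lambda>C. C o\<^sub>L B x)" "bounded_linear (\<lambda>C. - (B x o\<^sub>L C))"
      by (simp_all add: bounded_bilinear.bounded_linear_left bounded_bilinear.bounded_linear_right
          bounded_bilinear_blinfun_compose bounded_linear_minus)
    from bounded_linear_compose[OF this(1) bounded_linear_compose[OF this(2) A'.bounded_linear_axioms]]
    show ?thesis by (simp add: bounded_bilinear.minus_left[OF bounded_bilinear_blinfun_compose])
  qed
  define r where "r y = inverse (norm (y - x)) *\<^sub>R (A y - A x - A' (y - x))" for y
  have r: "(r \<longlongrightarrow> 0) (at x)"
    using A unfolding has_derivative_at2 r_def
    by (simp add: divide_inverse_commute diff_diff_eq)
  obtain K where K: "norm (A' v) \<le> norm v * K" for v using A'.bounded by blast
  have Abd: "\<forall>\<^sub>F y in at x. norm (inverse (norm (y - x)) *\<^sub>R A' (y - x)) \<le> K"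
    unfolding eventually_at_topological
  proof (intro exI[of _ UNIV] conjI ballI impI)
    fix y assume "y \<noteq> x"
    then show "norm (inverse (norm (y - x)) *\<^sub>R A' (y - x)) \<le> K"
      using K[of "y - x"] by (simp add: field_simps)
  qed auto
  have z: "((\<lambda>y. (B x - B y) o\<^sub>L (inverse (norm (y - x)) *\<^sub>R A' (y - x))) \<longlongrightarrow> 0) (at x)"
  proof (rule Lim_null_comparison)
    show "\<forall>\<^sub>F y in at x. norm ((B x - B y) o\<^sub>L (inverse (norm (y - x)) *\<^sub>R A' (y - x))) \<le> norm (B x - B y) * K"
      using Abd by eventually_elim (rule order_trans[OF norm_blinfun_compose mult_left_mono[OF _ norm_ge_zero]])
    show "((\<lambda>y. norm (B x - B y) * K) \<longlongrightarrow> 0) (at x)"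
      using tB by (auto intro!: tendsto_eq_intros)
  qed
  have main: "((\<lambda>y. (((B x - B y) o\<^sub>L (inverse (norm (y - x)) *\<^sub>R A' (y - x))) o\<^sub>L B x)
      - (B y o\<^sub>L r y o\<^sub>L B x)) \<longlongrightarrow> (0 o\<^sub>L B x) - (B x o\<^sub>L 0 o\<^sub>L B x)) (at x)"
    by (rule tendsto_diff[OF bounded_bilinear.tendsto[OF bounded_bilinear_blinfun_compose z tendsto_const]
          bounded_bilinear.tendsto[OF bounded_bilinear_blinfun_compose
            bounded_bilinear.tendsto[OF bounded_bilinear_blinfun_compose tB r] tendsto_const]])
  show ?thesis unfolding has_derivative_at2
  proof (intro conjI lin)
    have "\<forall>\<^sub>F y in at x. (((B x - B y) o\<^sub>L (inverse (norm (y - x)) *\<^sub>R A' (y - x))) o\<^sub>L B x) - (B y o\<^sub>L r y o\<^sub>L B x)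
       = (1 / norm (y - x)) *\<^sub>R (B y - (B x + - (B x o\<^sub>L A' (y - x) o\<^sub>L B x)))"
      using ev
    proof eventually_elim
      case (elim y)
      show ?case
      proof (rule blinfun_eqI)
        fix v
        let ?c = "inverse (norm (y - x))"
        let ?D = "A' (y - x)"
        have "B y o\<^sub>L A y = id_blinfun" "A x o\<^sub>L B x = id_blinfun" using elim T inv by auto
        then have "blinfun_apply (B y) (A y w) = w" "blinfun_apply (A x) (B x w) = w" for w
          by (metis blinfun_apply_blinfun_compose blinfun_apply_id_blinfun)+
        then have "?c *\<^sub>R (B x (?D (B x v)) - (B y (A y (B x v)) - B y (A x (B x v))))
          = ?c *\<^sub>R (B x (?D (B x v)) - (B x v - B y v))" by simp
        then show "((((B x - B y) o\<^sub>L (?c *\<^sub>R ?D)) o\<^sub>L B x) - (B y o\<^sub>L r y o\<^sub>L B x)) v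
          = ((1 / norm (y - x)) *\<^sub>R (B y - (B x + - (B x o\<^sub>L ?D o\<^sub>L B x)))) v"
          by (simp add: r_def blinfun.bilinear_simps divide_inverse algebra_simps)
      qed
    qed
    from Lim_transform_eventually[OF main this] show "((\<lambda>y. (1 / norm (y - x)) *\<^sub>R (B y - (B x + - (B x o\<^sub>L A' (y - x) o\<^sub>L B x)))) \<longlongrightarrow> 0) (at x)"
      by (simp add: bounded_bilinear.zero_left[OF bounded_bilinear_blinfun_compose]
          bounded_bilinear.zero_right[OF bounded_bilinear_blinfun_compose])
  qed
qed

lemma higher_differentiable_on_blinfun_inverse:
  fixes A B :: "'a::real_normed_vector \<Rightarrow> ('f::real_normed_vector \<Rightarrow>\<^sub>L 'f)"
  assumes "open T" and inv: "\<And>x. x \<in> T \<Longrightarrow> A x o\<^sub>L B x = id_blinfun"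
    "\<And>x. x \<in> T \<Longrightarrow> B x o\<^sub>L A x = id_blinfun"
    and "higher_differentiable_on T k A"
  shows "higher_differentiable_on T k B"
  using assms(4)
proof (induction k)
  case 0
  show ?case unfolding higher_differentiable_on.simps continuous_on_def
  proof
    fix x assume x: "x \<in> T"
    have ev: "\<forall>\<^sub>F y in at x within T. y \<in> T" by (simp add: eventually_at_filter)
    have "\<forall>\<^sub>F y in at x within T. B y o\<^sub>L A y = id_blinfun"
      by (rule eventually_mono[OF ev], erule inv)
    then show "(B \<longlongrightarrow> B x) (at x within T)"
      by (intro blinfun_inverse_continuous[where A = A and ?A0.0 = "A x" and B = B and ?B0.0 = "B x"])
         (use 0 x inv in \<open>simp_all add: continuous_on_def\<close>)
  qed
next
  case (Suc k)
  let ?A' = "\<lambda>x. frechet_derivative A (at x)"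
  have IH: "higher_differentiable_on T k B"
    by (rule Suc.IH[OF higher_differentiable_on_SucD[OF Suc.prems]])
  show ?case
  proof (rule higher_differentiable_on_SucI[OF assms(1)])
    fix x assume "x \<in> T"
    then show "(B has_derivative (\<lambda>v. - (B x o\<^sub>L ?A' x v o\<^sub>L B x))) (at x)"
      by (rule has_derivative_blinfun_inverse[OF assms(1)])
         (use Suc.prems \<open>x \<in> T\<close> in \<open>auto simp: inv frechet_derivative_works\<close>)
  next
    show "higher_differentiable_on T k (\<lambda>x. - (B x o\<^sub>L ?A' x v o\<^sub>L B x))" for v
      using Suc.prems IH
      by (intro higher_differentiable_on_linear_comp[OF assms(1) bounded_linear_minus[OF bounded_linear_ident]]
          higher_differentiable_on_bilinear[OF assms(1) bounded_bilinear_blinfun_compose]) auto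
  qed
qed

subsection \<open>Smooth maps on arbitrary subsets\<close>

lemma smooth_onE:
  assumes "smooth_on A f" "x \<in> A"
  obtains T g where "open T" "x \<in> T" "\<forall>k. higher_differentiable_on T k g" "\<forall>y\<in>A \<inter> T. g y = f y"
  using bspec[OF assms(1)[unfolded smooth_on_def] assms(2)] by (elim exE conjE)

lemma smooth_onI:
  assumes "\<And>x. x \<in> A \<Longrightarrow> \<exists>T g. open T \<and> x \<in> T \<and> (\<forall>k. higher_differentiable_on T k g) \<and> (\<forall>y\<in>A \<inter> T. g y = f y)"
  shows "smooth_on A f"
  unfolding smooth_on_def by (rule ballI) (rule assms)

lemma smooth_on_openI:
  assumes "open T" "\<And>k. higher_differentiable_on T k f" "A \<subseteq> T"
  shows "smooth_on A f"
proof (rule smooth_onI)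
  fix x assume "x \<in> A"
  with assms show "\<exists>T g. open T \<and> x \<in> T \<and> (\<forall>k. higher_differentiable_on T k g) \<and> (\<forall>y\<in>A \<inter> T. g y = f y)"
    by (intro exI[of _ T] exI[of _ f]) auto
qed

lemma smooth_on_subset:
  assumes "smooth_on A f" "B \<subseteq> A"
  shows "smooth_on B f"
proof (rule smooth_onI)
  fix x assume "x \<in> B"
  then have x: "x \<in> A" using assms(2) by blast
  obtain T g where T': "open T" "x \<in> T" "\<forall>k. higher_differentiable_on T k g" "\<forall>y\<in>A \<inter> T. g y = f y"
    by (rule smooth_onE[OF assms(1) x])
  note T = T'(1,2) T'(3)[rule_format] T'(4)[rule_format, OF IntI]
  then show "\<exists>T g. open T \<and> x \<in> T \<and> (\<forall>k. higher_differentiable_on T k g) \<and> (\<forall>y\<in>B \<inter> T. g y = f y)"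
    using assms(2) by (intro exI[of _ T] exI[of _ g]) auto
qed

lemma smooth_on_cong: "smooth_on A f \<Longrightarrow> (\<And>x. x \<in> A \<Longrightarrow> f x = g x) \<Longrightarrow> smooth_on A g"
  unfolding smooth_on_def by simp

lemma smooth_on_local:
  assumes "\<And>x. x \<in> A \<Longrightarrow> \<exists>T. open T \<and> x \<in> T \<and> smooth_on (A \<inter> T) f"
  shows "smooth_on A f"
proof (rule smooth_onI)
  fix x assume x: "x \<in> A"
  then obtain T where T: "open T" "x \<in> T" "smooth_on (A \<inter> T) f" using assms by blast
  obtain S g where S': "open S" "x \<in> S" "\<forall>k. higher_differentiable_on S k g" "\<forall>y\<in>(A \<inter> T) \<inter> S. g y = f y"
    by (rule smooth_onE[OF T(3)]) (use T x in auto)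
  note S = S'(1,2) S'(3)[rule_format] S'(4)[rule_format, OF IntI]
  show "\<exists>T g. open T \<and> x \<in> T \<and> (\<forall>k. higher_differentiable_on T k g) \<and> (\<forall>y\<in>A \<inter> T. g y = f y)"
  proof (intro exI[of _ "S \<inter> T"] exI[of _ g] conjI allI)
    show "higher_differentiable_on (S \<inter> T) k g" for k
      by (rule higher_differentiable_on_subset[OF S(3)]) simp
  qed (use S T in auto)
qed

lemma smooth_on_imp_continuous_on:
  assumes "smooth_on A f"
  shows "continuous_on A f"
  unfolding continuous_on_def
proof
  fix x assume x: "x \<in> A"
  obtain S g where S': "open S" "x \<in> S" "\<forall>k. higher_differentiable_on S k g" "\<forall>y\<in>A \<inter> S. g y = f y"
    by (rule smooth_onE[OF assms x])
  note S = S'(1,2) S'(3)[rule_format] S'(4)[rule_format, OF IntI]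
  have "continuous_on S g" using S(3)[of 0] by simp
  then have "isCont g x" using S continuous_on_eq_continuous_at by blast
  then have "(g \<longlongrightarrow> g x) (at x within A)"
    using continuous_at_imp_continuous_at_within continuous_within by blast
  moreover have "\<forall>\<^sub>F y in at x within A. g y = f y"
    unfolding eventually_at_topological using S by (intro exI[of _ S]) auto
  ultimately show "(f \<longlongrightarrow> f x) (at x within A)"
    using S x by (metis Lim_transform_eventually)
qed

lemma smooth_on_compose:
  fixes f :: "'a::real_normed_vector \<Rightarrow> 'b::euclidean_space" and g :: "'b \<Rightarrow> 'c::real_normed_vector"
  assumes "smooth_on A f" "smooth_on B g" "f ` A \<subseteq> B"
  shows "smooth_on A (\<lambda>x. g (f x))"
proof (rule smooth_onI)
  fix x assume x: "x \<in> A"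
  obtain S f' where S': "open S" "x \<in> S" "\<forall>k. higher_differentiable_on S k f'" "\<forall>y\<in>A \<inter> S. f' y = f y"
    by (rule smooth_onE[OF assms(1) x])
  note S = S'(1,2) S'(3)[rule_format] S'(4)[rule_format, OF IntI]
  have fx: "f x \<in> B" using x assms(3) by auto
  obtain T g' where T': "open T" "f x \<in> T" "\<forall>k. higher_differentiable_on T k g'" "\<forall>y\<in>B \<inter> T. g' y = g y"
    by (rule smooth_onE[OF assms(2) fx])
  note T = T'(1,2) T'(3)[rule_format] T'(4)[rule_format, OF IntI]
  have o: "open (S \<inter> f' -` T)"
    using S(3)[of 0] S(1) T(1) by (auto intro: continuous_open_preimage)
  have "higher_differentiable_on (S \<inter> f' -` T) k (\<lambda>x. g' (f' x))" for k
    by (rule higher_differentiable_on_compose[OF o T(1) _ higher_differentiable_on_subset[OF S(3)] T(3)]) auto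
  then show "\<exists>T h. open T \<and> x \<in> T \<and> (\<forall>k. higher_differentiable_on T k h) \<and> (\<forall>y\<in>A \<inter> T. h y = g (f y))"
    using o S T x assms(3)
    by (intro exI[of _ "S \<inter> f' -` T"] exI[of _ "\<lambda>x. g' (f' x)"]) auto
qed

lemma smooth_on_const: "smooth_on A (\<lambda>x. c)"
  by (rule smooth_on_openI[of UNIV]) (auto simp: higher_differentiable_on_const)

lemma smooth_on_bounded_linear: "bounded_linear f \<Longrightarrow> smooth_on A f"
  by (rule smooth_on_openI[of UNIV]) (auto simp: higher_differentiable_on_bounded_linear)

lemma smooth_on_bilinear:
  assumes "bounded_bilinear mul" "smooth_on A f" "smooth_on A g"
  shows "smooth_on A (\<lambda>x. mul (f x) (g x))"
proof (rule smooth_onI)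
  fix x assume x: "x \<in> A"
  obtain S f' where S': "open S" "x \<in> S" "\<forall>k. higher_differentiable_on S k f'" "\<forall>y\<in>A \<inter> S. f' y = f y"
    by (rule smooth_onE[OF assms(2) x])
  note S = S'(1,2) S'(3)[rule_format] S'(4)[rule_format, OF IntI]
  obtain T g' where T': "open T" "x \<in> T" "\<forall>k. higher_differentiable_on T k g'" "\<forall>y\<in>A \<inter> T. g' y = g y"
    by (rule smooth_onE[OF assms(3) x])
  note T = T'(1,2) T'(3)[rule_format] T'(4)[rule_format, OF IntI]
  have "higher_differentiable_on (S \<inter> T) k (\<lambda>x. mul (f' x) (g' x))" for k
    by (rule higher_differentiable_on_bilinear[OF _ assms(1) higher_differentiable_on_subset[OF S(3)]
          higher_differentiable_on_subset[OF T(3)]]) (use S T in auto)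
  then show "\<exists>T h. open T \<and> x \<in> T \<and> (\<forall>k. higher_differentiable_on T k h) \<and> (\<forall>y\<in>A \<inter> T. h y = mul (f y) (g y))"
    using S T by (intro exI[of _ "S \<inter> T"] exI[of _ "\<lambda>x. mul (f' x) (g' x)"]) auto
qed

lemma smooth_on_linear_comp:
  assumes "bounded_linear L" "smooth_on A f"
  shows "smooth_on A (\<lambda>x. L (f x))"
proof -
  \<comment> \<open>A linear map is a bilinear one with its scalar slot filled by the constant 1, so
    no separate extension argument is required.\<close>
  have "bounded_bilinear (\<lambda>(a::real) b. a *\<^sub>R L b)"
    by (rule bounded_bilinear.comp[OF bounded_bilinear_scaleR bounded_linear_ident assms(1)])
  from smooth_on_bilinear[OF this smooth_on_const[where c = 1] assms(2)] show ?thesis by simp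
qed

lemma smooth_on_add:
  assumes "smooth_on A f" "smooth_on A g"
  shows "smooth_on A (\<lambda>x. f x + g x)"
proof (rule smooth_onI)
  fix x assume x: "x \<in> A"
  obtain S f' where S': "open S" "x \<in> S" "\<forall>k. higher_differentiable_on S k f'" "\<forall>y\<in>A \<inter> S. f' y = f y"
    by (rule smooth_onE[OF assms(1) x])
  note S = S'(1,2) S'(3)[rule_format] S'(4)[rule_format, OF IntI]
  obtain T g' where T': "open T" "x \<in> T" "\<forall>k. higher_differentiable_on T k g'" "\<forall>y\<in>A \<inter> T. g' y = g y"
    by (rule smooth_onE[OF assms(2) x])
  note T = T'(1,2) T'(3)[rule_format] T'(4)[rule_format, OF IntI]
  have "higher_differentiable_on (S \<inter> T) k (\<lambda>x. f' x + g' x)" for k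
    by (rule higher_differentiable_on_add[OF _ higher_differentiable_on_subset[OF S(3)]
          higher_differentiable_on_subset[OF T(3)]]) (use S T in auto)
  then show "\<exists>T h. open T \<and> x \<in> T \<and> (\<forall>k. higher_differentiable_on T k h) \<and> (\<forall>y\<in>A \<inter> T. h y = f y + g y)"
    using S T by (intro exI[of _ "S \<inter> T"] exI[of _ "\<lambda>x. f' x + g' x"]) auto
qed

lemma smooth_on_Pair:
  assumes "smooth_on A f" "smooth_on A g"
  shows "smooth_on A (\<lambda>x. (f x, g x))"
proof -
  have "bounded_linear (\<lambda>a::'b. (a, 0::'c))" "bounded_linear (\<lambda>b::'c. (0::'b, b))"
    by (auto intro!: bounded_linear_Pair bounded_linear_ident bounded_linear_zero)
  from smooth_on_add[OF smooth_on_linear_comp[OF this(1) assms(1)] smooth_on_linear_comp[OF this(2) assms(2)]]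
  show ?thesis by simp
qed

text \<open>In finite dimension an injective endomorphism is bijective and its inverse is
  automatically bounded. This is what permits the rest of the proof to speak of injectivity
  only.\<close>

lemma blinfun_inj_inverse:
  fixes A :: "'f::euclidean_space \<Rightarrow>\<^sub>L 'f"
  assumes "inj (blinfun_apply A)"
  obtains B where "A o\<^sub>L B = id_blinfun" "B o\<^sub>L A = id_blinfun"
proof -
  have "linear (blinfun_apply A)" by (simp add: blinfun.bounded_linear_right bounded_linear.linear)
  then obtain f where f: "linear f" "\<And>x. f (A x) = x" "\<And>x. A (f x) = x"
    using linear_injective_isomorphism[of "blinfun_apply A"] assms by blast
  have "blinfun_apply (Blinfun f) = f"
    using f(1) by (simp add: bounded_linear_Blinfun_apply linear_conv_bounded_linear)
  then show ?thesis
    by (intro that[of "Blinfun f"]; intro blinfun_eqI) (simp_all add: f)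
qed

lemma blinfun_inj_bounded_below:
  fixes A :: "'f::euclidean_space \<Rightarrow>\<^sub>L 'f"
  assumes "inj (blinfun_apply A)"
  obtains c where "c > 0" "\<And>v. c * norm v \<le> norm (A v)"
  using linear_inj_bounded_below_pos[of "blinfun_apply A"] assms
  by (metis blinfun.bounded_linear_right bounded_linear.linear)

lemma blinfun_injI: "(\<And>v. blinfun_apply A v = 0 \<Longrightarrow> v = 0) \<Longrightarrow> inj (blinfun_apply A)"
  using linear_injective_0[of "blinfun_apply A"]
  by (metis blinfun.bounded_linear_right bounded_linear.linear)

lemma blinfun_injD: "inj (blinfun_apply A) \<Longrightarrow> blinfun_apply A v = 0 \<Longrightarrow> v = 0"
  by (metis blinfun.zero_right injD)

text \<open>Openness of the invertible operators with an explicit radius: a perturbation smaller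
  than the lower bound \<open>c\<close> cannot cancel \<open>A v\<close>.\<close>

lemma blinfun_inj_near:
  fixes A :: "'f::euclidean_space \<Rightarrow>\<^sub>L 'f"
  assumes "\<And>v. c * norm v \<le> norm (A v)" "norm (A' - A) < c"
  shows "inj (blinfun_apply A')"
proof (rule blinfun_injI)
  fix v assume v: "A' v = 0"
  have "c * norm v \<le> norm ((A' - A) v)" using assms(1)[of v] v by (simp add: blinfun.diff_left)
  also have "\<dots> \<le> norm (A' - A) * norm v" by (rule norm_blinfun)
  finally show "v = 0" using assms(2)
    by (metis mult_le_cancel_right1 mult_right_le_imp_le norm_eq_zero not_less order_le_less norm_ge_zero)
qed

text \<open>The local extension \<open>A'\<close> of \<open>A\<close> off the set \<open>S\<close>
  may fail to be invertible. Cutting its domain down to the points where it stays within the lower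
  bound of \<open>A x\<close> restores invertibility, and the inverse of \<open>A'\<close> is then
  an extension of \<open>B\<close>.\<close>

lemma smooth_on_blinfun_inverse:
  fixes A B :: "'a::real_normed_vector \<Rightarrow> ('f::euclidean_space \<Rightarrow>\<^sub>L 'f)"
  assumes "smooth_on S A" and inv: "\<And>x. x \<in> S \<Longrightarrow> A x o\<^sub>L B x = id_blinfun"
    "\<And>x. x \<in> S \<Longrightarrow> B x o\<^sub>L A x = id_blinfun"
  shows "smooth_on S B"
proof (rule smooth_onI)
  fix x assume x: "x \<in> S"
  obtain T A' where T': "open T" "x \<in> T" "\<forall>k. higher_differentiable_on T k A'" "\<forall>y\<in>S \<inter> T. A' y = A y"
    by (rule smooth_onE[OF assms(1) x])
  note T = T'(1,2) T'(3)[rule_format] T'(4)[rule_format, OF IntI]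
  have "inj (blinfun_apply (A x))"
  proof (rule blinfun_injI)
    fix v assume "A x v = 0"
    then have "(B x o\<^sub>L A x) v = 0" by (simp add: blinfun.zero_right)
    then show "v = 0" by (simp add: inv(2)[OF x])
  qed
  then obtain c where c: "c > 0" "\<And>v. c * norm v \<le> norm (A x v)" using blinfun_inj_bounded_below by blast
  define T' where "T' = T \<inter> A' -` ball (A x) c"
  have T': "open T'" "x \<in> T'" "T' \<subseteq> T"
    using T(3)[of 0] T c x by (auto simp: T'_def intro: continuous_open_preimage)
  have "\<exists>C. A' y o\<^sub>L C = id_blinfun \<and> C o\<^sub>L A' y = id_blinfun" if "y \<in> T'" for y
  proof -
    have "norm (A' y - A x) < c" using that by (simp add: T'_def dist_norm norm_minus_commute)
    from blinfun_inj_inverse[OF blinfun_inj_near[OF c(2) this]] show ?thesis by metis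
  qed
  then obtain B' where B': "\<And>y. y \<in> T' \<Longrightarrow> A' y o\<^sub>L B' y = id_blinfun" "\<And>y. y \<in> T' \<Longrightarrow> B' y o\<^sub>L A' y = id_blinfun"
    by metis
  have "higher_differentiable_on T' k B'" for k
    by (rule higher_differentiable_on_blinfun_inverse[OF T'(1) B' higher_differentiable_on_subset[OF T(3) T'(3)]])
  moreover have "B' y = B y" if "y \<in> S" "y \<in> T'" for y
  proof (rule blinfun_eqI)
    fix v
    have "B' y (A y (B y v)) = B' y v" "B' y (A y (B y v)) = B y v"
      using that T' T(4)[of y] B'[of y] inv[of y] by (metis blinfun_apply_blinfun_compose blinfun_apply_id_blinfun subsetD)+
    then show "B' y v = B y v" by simp
  qed
  ultimately show "\<exists>T h. open T \<and> x \<in> T \<and> (\<forall>k. higher_differentiable_on T k h) \<and> (\<forall>y\<in>S \<inter> T. h y = B y)"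
    using T' by (intro exI[of _ T'] exI[of _ B']) auto
qed

subsection \<open>Bump functions\<close>

text \<open>The factor \<open>inverse x ^ n\<close> makes the family, together with its linear
  combinations, closed under differentiation, so that smoothness follows by one induction over the
  order for all \<open>n\<close> simultaneously. The classical function that is flat at 0 is
  \<open>flat 0\<close>.\<close>

definition flat :: "nat \<Rightarrow> real \<Rightarrow> real" where
  "flat n x = (if x > 0 then inverse x ^ n * exp (- inverse x) else 0)"

lemma flat_tendsto_0: "(flat n \<longlongrightarrow> 0) (at 0)"
proof -
  have "((\<lambda>x. inverse x ^ n / exp (inverse x)) \<longlongrightarrow> 0) (at_right (0::real))"
    by (rule filterlim_compose[OF tendsto_power_div_exp_0 filterlim_inverse_at_top_right])
  moreover have "\<forall>\<^sub>F x in at_right 0. inverse x ^ n / exp (inverse x) = flat n x"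
    unfolding eventually_at_filter by (simp add: flat_def exp_minus divide_inverse)
  ultimately have r: "(flat n \<longlongrightarrow> 0) (at_right 0)"
    by (rule Lim_transform_eventually)
  have "\<forall>\<^sub>F x in at_left 0. 0 = flat n x"
    unfolding eventually_at_filter by (simp add: flat_def)
  with tendsto_const have "(flat n \<longlongrightarrow> 0) (at_left 0)" by (rule Lim_transform_eventually)
  with r show ?thesis using filterlim_split_at by blast
qed

lemma flat_deriv: "(flat n has_field_derivative flat (n + 2) x - real n * flat (n + 1) x) (at x)"
proof -
  consider "x > 0" | "x < 0" | "x = 0" by linarith
  then show ?thesis
  proof cases
    case 1
    have "((\<lambda>x. inverse x ^ n * exp (- inverse x)) has_field_derivative
      flat (n + 2) x - real n * flat (n + 1) x) (at x)"
      using 1 by (auto intro!: derivative_eq_intros simp: flat_def field_simps power2_eq_square)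
        (cases n; simp add: field_simps)
    then show ?thesis
      by (rule has_field_derivative_transform_within_open[of _ _ _ "{0<..}"]) (use 1 in \<open>auto simp: flat_def\<close>)
  next
    case 2
    have "((\<lambda>x. 0) has_field_derivative flat (n + 2) x - real n * flat (n + 1) x) (at x)"
      using 2 by (simp add: flat_def)
    then show ?thesis
      by (rule has_field_derivative_transform_within_open[of _ _ _ "{..<0}"]) (use 2 in \<open>auto simp: flat_def\<close>)
  next
    case 3
    \<comment> \<open>At 0 the difference quotient of \<open>flat n\<close> is exactly
      \<open>flat (n + 1)\<close>, whose limit is known; the claimed derivative is 0 there.\<close>
    have "\<forall>\<^sub>F y in at 0. flat (n + 1) y = (flat n y - flat n 0) / (y - 0)"
      unfolding eventually_at_filter by (auto simp: flat_def divide_inverse)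
    from Lim_transform_eventually[OF flat_tendsto_0 this] 3
    show ?thesis unfolding has_field_derivative_iff by (simp add: flat_def)
  qed
qed

lemma flat_smooth: "higher_differentiable_on UNIV k (flat n)"
proof (induction k arbitrary: n)
  case 0
  show ?case
    using DERIV_isCont[OF flat_deriv] by (simp add: continuous_at_imp_continuous_on)
next
  case (Suc k)
  show ?case
  proof (rule higher_differentiable_on_SucI)
    show "(flat n has_derivative (*) (flat (n + 2) x + (- real n) * flat (n + 1) x)) (at x)" for x
      using flat_deriv[of n x] by (simp add: has_field_derivative_def)
    show "higher_differentiable_on UNIV k (\<lambda>x. (flat (n + 2) x + (- real n) * flat (n + 1) x) * v)" for v
      using Suc
      by (intro higher_differentiable_on_bilinear[OF open_UNIV bounded_bilinear_mult]
          higher_differentiable_on_add[OF open_UNIV] higher_differentiable_on_const) simp_all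
  qed simp
qed

text \<open>The quotient \<open>u / (u + w)\<close>, with \<open>u\<close> vanishing from 2 onwards
  and \<open>w\<close> vanishing up to 1, so that the denominator is never 0. It is evaluated at the
  squared distance from \<open>a\<close> in units of \<open>e\<close>, because the distance itself
  is not smooth at the centre; at distance \<open>2 * e\<close> the argument is 4, beyond the zero
  threshold 2.\<close>

lemma bump_function:
  fixes a :: "'e::euclidean_space"
  assumes "e > 0"
  obtains \<beta> :: "'e \<Rightarrow> real" where "\<forall>k. higher_differentiable_on UNIV k \<beta>"
    "\<forall>x. 0 \<le> \<beta> x \<and> \<beta> x \<le> 1" "\<forall>x. norm (x - a) \<le> e \<longrightarrow> \<beta> x = 1" "\<forall>x. 2 * e \<le> norm (x - a) \<longrightarrow> \<beta> x = 0"
proof -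
  define r where "r x = ((x - a) \<bullet> (x - a)) * (1 / e\<^sup>2)" for x
  define u where "u t = flat 0 (2 + (- 1) * t)" for t
  define w where "w t = flat 0 (t + (- 1))" for t
  define \<beta> where "\<beta> x = u (r x) * inverse (u (r x) + w (r x))" for x
  note ident = higher_differentiable_on_bounded_linear[OF bounded_linear_ident]
  note add = higher_differentiable_on_add[OF open_UNIV]
  note mult = higher_differentiable_on_bilinear[OF open_UNIV bounded_bilinear_mult]
  have d: "higher_differentiable_on UNIV k (\<lambda>x. x - a)" for k
  proof -
    have "higher_differentiable_on UNIV k (\<lambda>x. x + (- a))"
      by (rule add[OF ident higher_differentiable_on_const])
    then show ?thesis by simp
  qed
  have r: "higher_differentiable_on UNIV k r" for k
    unfolding r_def
    by (rule mult[OF higher_differentiable_on_bilinear[OF open_UNIV bounded_bilinear_inner d d] higher_differentiable_on_const])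
  have aff: "higher_differentiable_on UNIV k (\<lambda>t::real. 2 + (- 1) * t)"
    "higher_differentiable_on UNIV k (\<lambda>t::real. t + (- 1))" for k
    by (rule add[OF higher_differentiable_on_const mult[OF higher_differentiable_on_const ident]],
        rule add[OF ident higher_differentiable_on_const])
  have u: "higher_differentiable_on UNIV k u" and w: "higher_differentiable_on UNIV k w" for k
    unfolding u_def w_def
    by (rule higher_differentiable_on_compose[OF open_UNIV open_UNIV _ aff(1) flat_smooth], simp)
       (rule higher_differentiable_on_compose[OF open_UNIV open_UNIV _ aff(2) flat_smooth], simp)
  have ur: "higher_differentiable_on UNIV k (\<lambda>x. u (r x))" "higher_differentiable_on UNIV k (\<lambda>x. w (r x))" for k
    by (rule higher_differentiable_on_compose[OF open_UNIV open_UNIV _ r u], simp)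
       (rule higher_differentiable_on_compose[OF open_UNIV open_UNIV _ r w], simp)
  have nn: "0 \<le> u t" "0 \<le> w t" "0 < u t + w t" for t
    by (auto simp: u_def w_def flat_def add_pos_nonneg add_nonneg_pos)
  have b1: "higher_differentiable_on UNIV k \<beta>" for k
    unfolding \<beta>_def
    using nn(3) by (intro mult[OF ur(1)] higher_differentiable_on_inverse_real[OF open_UNIV _ add[OF ur]])
      (simp add: less_imp_neq[symmetric])
  have b2: "0 \<le> \<beta> x" "\<beta> x \<le> 1" for x
    using nn[of "r x"] by (auto simp: \<beta>_def divide_simps simp flip: divide_inverse)
  have rn: "r x = (norm (x - a) / e)\<^sup>2" for x
    by (simp add: r_def power2_norm_eq_inner power_divide)
  have b3: "\<beta> x = 1" if "norm (x - a) \<le> e" for x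
  proof -
    have "r x \<le> 1" unfolding rn using that assms by (simp add: power_le_one)
    then show ?thesis using nn[of "r x"] by (simp add: \<beta>_def w_def flat_def)
  qed
  have b4: "\<beta> x = 0" if "2 * e \<le> norm (x - a)" for x
  proof -
    have "2 \<le> norm (x - a) / e" using that assms by (simp add: field_simps)
    then have "2\<^sup>2 \<le> r x" unfolding rn by (intro power_mono) auto
    then show ?thesis by (simp add: \<beta>_def u_def flat_def)
  qed
  show thesis by (rule that[of \<beta>]) (simp_all add: b1 b2 b3 b4)
qed

subsection \<open>Pointwise smoothness on charted spaces\<close>

text \<open>Isolates the conditions that local arguments consult and that pass directly to open
  submanifolds, products and \<open>linear_manifold\<close>.\<close>

definition smooth_atlas :: "('a, 'e::euclidean_space) charted_space \<Rightarrow> bool" where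
  "smooth_atlas M \<longleftrightarrow>
     (\<Union>(U, \<phi>)\<in>atlas M. U) = topspace (space_of M) \<and>
     (\<forall>(U, \<phi>)\<in>atlas M.
        openin (space_of M) U \<and>
        homeomorphic_map (subtopology (space_of M) U) (top_of_set (\<phi> ` U)) \<phi>) \<and>
     (\<forall>(U, \<phi>)\<in>atlas M. \<forall>(W, \<psi>)\<in>atlas M.
        smooth_on (\<phi> ` (U \<inter> W)) (\<psi> \<circ> inv_into U \<phi>))"

lemma smooth_manifold_imp_smooth_atlas: "smooth_manifold M \<Longrightarrow> smooth_atlas M"
  unfolding smooth_manifold_def smooth_atlas_def by fast

text \<open>Smoothness at one point, tested in a single chart near it, avoids the quantification
  over all pairs of charts in \<open>smooth_map\<close> and turns gluing into a pointwise statement.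
  The values may lie in any normed space, since operator-valued functions occur.\<close>

definition fsmooth ::
  "('a, 'e::euclidean_space) charted_space \<Rightarrow> ('a \<Rightarrow> 'v::real_normed_vector) \<Rightarrow> 'a \<Rightarrow> bool" where
  "fsmooth M f x \<longleftrightarrow> (\<exists>U \<phi> V. (U, \<phi>) \<in> atlas M \<and> openin (space_of M) V \<and> x \<in> V \<and> V \<subseteq> U \<and>
     smooth_on (\<phi> ` V) (f \<circ> inv_into U \<phi>))"

text \<open>Requiring a whole neighbourhood to be mapped into one chart domain of the target builds
  continuity into the notion; \<open>smooth_at_nbhd\<close> extracts it.\<close>

definition smooth_at ::
  "('a, 'e::euclidean_space) charted_space \<Rightarrow> ('b, 'g::euclidean_space) charted_space \<Rightarrow>
   ('a \<Rightarrow> 'b) \<Rightarrow> 'a \<Rightarrow> bool" where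
  "smooth_at M N f x \<longleftrightarrow> (\<exists>W \<psi> V. (W, \<psi>) \<in> atlas N \<and> openin (space_of M) V \<and> x \<in> V \<and> f ` V \<subseteq> W \<and>
     fsmooth M (\<psi> \<circ> f) x)"

context
  fixes M :: "('a, 'e::euclidean_space) charted_space"
  assumes M: "smooth_atlas M"
begin

lemma chart_cover:
  assumes "x \<in> topspace (space_of M)"
  obtains U \<phi> where "(U, \<phi>) \<in> atlas M" "x \<in> U"
  using assms M unfolding smooth_atlas_def by blast

context
  fixes U :: "'a set" and \<phi> :: "'a \<Rightarrow> 'e"
  assumes ch: "(U, \<phi>) \<in> atlas M"
begin

lemma chart_open: "openin (space_of M) U"
  using M ch unfolding smooth_atlas_def by auto

lemma chart_subset: "U \<subseteq> topspace (space_of M)"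
  using chart_open openin_subset by blast

lemma chart_homeo: "homeomorphic_map (subtopology (space_of M) U) (top_of_set (\<phi> ` U)) \<phi>"
  using M ch unfolding smooth_atlas_def by auto

lemma chart_inj: "inj_on \<phi> U"
  using homeomorphic_imp_injective_map[OF chart_homeo] chart_subset
  by (simp add: Int_absorb1)

lemma chart_inv [simp]: "x \<in> U \<Longrightarrow> inv_into U \<phi> (\<phi> x) = x"
  using chart_inj by simp

lemma chart_image_open:
  assumes "openin (space_of M) V" "V \<subseteq> U"
  obtains T where "open T" "\<phi> ` V = \<phi> ` U \<inter> T"
proof -
  have "openin (subtopology (space_of M) U) V"
    using assms openin_open_subtopology[OF chart_open] by auto
  then have "openin (top_of_set (\<phi> ` U)) (\<phi> ` V)"
    using homeomorphic_map_openness_eq[OF chart_homeo] by blast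
  then show ?thesis using that unfolding openin_open by blast
qed

lemma chart_preimage_open:
  assumes "open T"
  shows "openin (space_of M) (U \<inter> \<phi> -` T)"
proof -
  have "continuous_map (subtopology (space_of M) U) (top_of_set (\<phi> ` U)) \<phi>"
    using chart_homeo homeomorphic_imp_continuous_map by blast
  moreover have "openin (top_of_set (\<phi> ` U)) (\<phi> ` U \<inter> T)"
    using assms by (auto simp: openin_open)
  ultimately have "openin (subtopology (space_of M) U)
      {x \<in> topspace (subtopology (space_of M) U). \<phi> x \<in> \<phi> ` U \<inter> T}"
    unfolding continuous_map by blast
  moreover have "{x \<in> topspace (subtopology (space_of M) U). \<phi> x \<in> \<phi> ` U \<inter> T} = U \<inter> \<phi> -` T"
    using chart_subset by auto
  ultimately show ?thesis using openin_trans_full chart_open by fastforce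
qed

text \<open>Independence of the chart: composing with the smooth change of coordinates moves the
  local expression from the chart that happens to witness smoothness to the prescribed one.\<close>

lemma fsmooth_in_chart:
  assumes "fsmooth M f x" "x \<in> U"
  obtains V where "openin (space_of M) V" "x \<in> V" "V \<subseteq> U" "smooth_on (\<phi> ` V) (f \<circ> inv_into U \<phi>)"
proof -
  obtain U' \<phi>' V where V: "(U', \<phi>') \<in> atlas M" "openin (space_of M) V" "x \<in> V" "V \<subseteq> U'"
    "smooth_on (\<phi>' ` V) (f \<circ> inv_into U' \<phi>')"
    using assms unfolding fsmooth_def by blast
  have inj': "inj_on \<phi>' U'"
    using V(1) M homeomorphic_imp_injective_map[of "subtopology (space_of M) U'"]
    unfolding smooth_atlas_def by (force simp: Int_absorb1 dest: openin_subset)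
  have "smooth_on (\<phi> ` (U \<inter> U')) (\<phi>' \<circ> inv_into U \<phi>)"
    using M ch V(1) unfolding smooth_atlas_def by fast
  then have t: "smooth_on (\<phi> ` (U \<inter> V)) (\<phi>' \<circ> inv_into U \<phi>)"
    by (rule smooth_on_subset) (use V in auto)
  have "smooth_on (\<phi> ` (U \<inter> V)) (\<lambda>z. (f \<circ> inv_into U' \<phi>') ((\<phi>' \<circ> inv_into U \<phi>) z))"
    by (rule smooth_on_compose[OF t V(5)]) auto
  then have "smooth_on (\<phi> ` (U \<inter> V)) (f \<circ> inv_into U \<phi>)"
    by (rule smooth_on_cong) (use V inj' in auto)
  then show ?thesis
    by (intro that[of "U \<inter> V"]) (use V assms chart_open in auto)
qed

lemma fsmooth_chart: "x \<in> U \<Longrightarrow> fsmooth M \<phi> x"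
  unfolding fsmooth_def
  by (intro exI[of _ U] exI[of _ \<phi>])
     (auto intro!: ch chart_open smooth_on_cong[OF smooth_on_bounded_linear[OF bounded_linear_ident]])

end

lemma fsmoothE:
  assumes "fsmooth M f x"
  obtains U \<phi> V where "(U, \<phi>) \<in> atlas M" "openin (space_of M) V" "x \<in> V" "V \<subseteq> U"
     "smooth_on (\<phi> ` V) (f \<circ> inv_into U \<phi>)"
  using assms unfolding fsmooth_def by blast

lemma fsmooth_topspace: "fsmooth M f x \<Longrightarrow> x \<in> topspace (space_of M)"
  unfolding fsmooth_def using openin_subset by blast

lemma fsmooth_cong:
  assumes "fsmooth M f x" "openin (space_of M) A" "x \<in> A" "\<And>y. y \<in> A \<Longrightarrow> f y = g y"
  shows "fsmooth M g x"
proof -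
  obtain U \<phi> V where V: "(U, \<phi>) \<in> atlas M" "openin (space_of M) V" "x \<in> V" "V \<subseteq> U"
     "smooth_on (\<phi> ` V) (f \<circ> inv_into U \<phi>)"
    by (rule fsmoothE[OF assms(1)]) blast
  have "smooth_on (\<phi> ` (V \<inter> A)) (f \<circ> inv_into U \<phi>)"
    by (rule smooth_on_subset[OF V(5)]) auto
  then have "smooth_on (\<phi> ` (V \<inter> A)) (g \<circ> inv_into U \<phi>)"
    by (rule smooth_on_cong) (use V assms chart_inv[OF V(1)] in auto)
  then show ?thesis unfolding fsmooth_def using V assms by blast
qed

text \<open>Moves two functions into one chart and one neighbourhood, after which every closure rule
  for \<open>smooth_on\<close> lifts to \<open>fsmooth\<close> without further topology.\<close>

lemma fsmooth_common:
  assumes "fsmooth M f x" "fsmooth M g x" "openin (space_of M) A" "x \<in> A"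
    and h: "\<And>U \<phi> V. (U, \<phi>) \<in> atlas M \<Longrightarrow> V \<subseteq> U \<Longrightarrow> V \<subseteq> A \<Longrightarrow> smooth_on (\<phi> ` V) (f \<circ> inv_into U \<phi>) \<Longrightarrow>
      smooth_on (\<phi> ` V) (g \<circ> inv_into U \<phi>) \<Longrightarrow> smooth_on (\<phi> ` V) (h \<circ> inv_into U \<phi>)"
  shows "fsmooth M h x"
proof -
  obtain U \<phi> V where V: "(U, \<phi>) \<in> atlas M" "openin (space_of M) V" "x \<in> V" "V \<subseteq> U"
     "smooth_on (\<phi> ` V) (f \<circ> inv_into U \<phi>)"
    by (rule fsmoothE[OF assms(1)]) blast
  obtain V' where V': "openin (space_of M) V'" "x \<in> V'" "V' \<subseteq> U" "smooth_on (\<phi> ` V') (g \<circ> inv_into U \<phi>)"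
    by (rule fsmooth_in_chart[OF V(1) assms(2)]) (use V in auto)
  have "smooth_on (\<phi> ` (V \<inter> V' \<inter> A)) (h \<circ> inv_into U \<phi>)"
    by (intro h V smooth_on_subset[OF V(5)] smooth_on_subset[OF V'(4)]) (use V in auto)
  moreover have "openin (space_of M) (V \<inter> V' \<inter> A)" using V V' assms by blast
  ultimately show ?thesis unfolding fsmooth_def using V V' assms by blast
qed

lemma fsmooth_smooth_on:
  fixes f :: "'a \<Rightarrow> 'v::euclidean_space"
  assumes "fsmooth M f x" "openin (space_of M) A" "x \<in> A" "f ` A \<subseteq> B" "smooth_on B h"
  shows "fsmooth M (\<lambda>y. h (f y)) x"
proof (rule fsmooth_common[OF assms(1,1,2,3)])
  fix U \<phi> V assume ch: "(U, \<phi>) \<in> atlas M" and V: "V \<subseteq> U" "V \<subseteq> A"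
    and s: "smooth_on (\<phi> ` V) (f \<circ> inv_into U \<phi>)"
  have "inv_into U \<phi> (\<phi> y) = y" "f y \<in> B" if "y \<in> V" for y
    using that V assms(4) chart_inv[OF ch, of y] by auto
  then have "(f \<circ> inv_into U \<phi>) ` \<phi> ` V \<subseteq> B" by auto
  from smooth_on_compose[OF s assms(5) this] show "smooth_on (\<phi> ` V) ((\<lambda>y. h (f y)) \<circ> inv_into U \<phi>)"
    by (simp add: comp_def)
qed

lemma fsmooth_const: "x \<in> topspace (space_of M) \<Longrightarrow> fsmooth M (\<lambda>y. c) x"
proof -
  assume "x \<in> topspace (space_of M)"
  then obtain U \<phi> where U: "(U, \<phi>) \<in> atlas M" "x \<in> U" by (rule chart_cover)
  have "smooth_on (\<phi> ` U) ((\<lambda>y. c) \<circ> inv_into U \<phi>)" unfolding comp_def by (rule smooth_on_const)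
  then show ?thesis unfolding fsmooth_def using U chart_open by blast
qed

lemma fsmooth_bilinear:
  assumes "bounded_bilinear mul" "fsmooth M f x" "fsmooth M g x"
  shows "fsmooth M (\<lambda>y. mul (f y) (g y)) x"
  by (rule fsmooth_common[OF assms(2,3) openin_topspace fsmooth_topspace[OF assms(2)]])
     (use smooth_on_bilinear[OF assms(1)] in \<open>auto simp: comp_def\<close>)

lemma fsmooth_linear_comp:
  assumes "bounded_linear L" "fsmooth M f x"
  shows "fsmooth M (\<lambda>y. L (f y)) x"
  by (rule fsmooth_common[OF assms(2,2) openin_topspace fsmooth_topspace[OF assms(2)]])
     (use smooth_on_linear_comp[OF assms(1)] in \<open>auto simp: comp_def\<close>)

lemma fsmooth_add:
  assumes "fsmooth M f x" "fsmooth M g x"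
  shows "fsmooth M (\<lambda>y. f y + g y) x"
  by (rule fsmooth_common[OF assms openin_topspace fsmooth_topspace[OF assms(1)]])
     (use smooth_on_add in \<open>auto simp: comp_def\<close>)

lemma fsmooth_Pair:
  assumes "fsmooth M f x" "fsmooth M g x"
  shows "fsmooth M (\<lambda>y. (f y, g y)) x"
  by (rule fsmooth_common[OF assms openin_topspace fsmooth_topspace[OF assms(1)]])
     (use smooth_on_Pair in \<open>auto simp: comp_def\<close>)

lemma fsmooth_sum:
  assumes "x \<in> topspace (space_of M)" "\<And>i. i \<in> I \<Longrightarrow> fsmooth M (f i) x"
  shows "fsmooth M (\<lambda>y. \<Sum>i\<in>I. f i y) x"
  using assms(2)
  by (induction I rule: infinite_finite_induct)
     (simp_all add: fsmooth_const[OF assms(1)] fsmooth_add)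

lemma fsmooth_blinfun_inverse:
  fixes A B :: "'a \<Rightarrow> ('f::euclidean_space \<Rightarrow>\<^sub>L 'f)"
  assumes "fsmooth M A x" "openin (space_of M) V" "x \<in> V"
    and inv: "\<And>y. y \<in> V \<Longrightarrow> A y o\<^sub>L B y = id_blinfun" "\<And>y. y \<in> V \<Longrightarrow> B y o\<^sub>L A y = id_blinfun"
  shows "fsmooth M B x"
proof (rule fsmooth_common[OF assms(1,1,2,3)])
  fix U \<phi> S assume ch: "(U, \<phi>) \<in> atlas M" and S: "S \<subseteq> U" "S \<subseteq> V"
    and s: "smooth_on (\<phi> ` S) (A \<circ> inv_into U \<phi>)"
  have "inv_into U \<phi> (\<phi> y) = y" "y \<in> V" if "y \<in> S" for y
    using that S chart_inv[OF ch, of y] by auto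
  then show "smooth_on (\<phi> ` S) (B \<circ> inv_into U \<phi>)"
    by (intro smooth_on_blinfun_inverse[OF s]) (auto simp: inv)
qed

lemma fsmooth_tendsto:
  assumes "fsmooth M f x"
  shows "(f \<longlongrightarrow> f x) (nhdsin (space_of M) x)"
proof (rule topological_tendstoI)
  fix S assume S: "open S" "f x \<in> S"
  obtain U \<phi> V where V: "(U, \<phi>) \<in> atlas M" "openin (space_of M) V" "x \<in> V" "V \<subseteq> U"
     "smooth_on (\<phi> ` V) (f \<circ> inv_into U \<phi>)"
    by (rule fsmoothE[OF assms]) blast
  note inv = chart_inv[OF V(1)]
  obtain T where T: "open T" "(f \<circ> inv_into U \<phi>) -` S \<inter> \<phi> ` V = T \<inter> \<phi> ` V"
    using smooth_on_imp_continuous_on[OF V(5)] S(1) unfolding continuous_on_open_invariant by metis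
  have "f y \<in> S" if "y \<in> V \<inter> (U \<inter> \<phi> -` T)" for y
  proof -
    have "\<phi> y \<in> T \<inter> \<phi> ` V" using that by auto
    then have "f (inv_into U \<phi> (\<phi> y)) \<in> S" using T(2) by auto
    then show ?thesis using inv that by auto
  qed
  moreover have "x \<in> V \<inter> (U \<inter> \<phi> -` T)"
  proof -
    have "\<phi> x \<in> (f \<circ> inv_into U \<phi>) -` S \<inter> \<phi> ` V" using V S inv by auto
    then show ?thesis using T(2) V by auto
  qed
  ultimately show "\<forall>\<^sub>F y in nhdsin (space_of M) x. f y \<in> S"
    unfolding eventually_nhdsin
    using V(2) chart_preimage_open[OF V(1) T(1)] by (metis openin_Int)
qed

end

text \<open>The target chart is injective and carries the open set to a relatively open one, so
  continuity of the coordinate expression of \<open>f\<close> becomes continuity of \<open>f\<close>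
  at the point.\<close>

lemma smooth_at_nbhd:
  assumes "smooth_atlas M" "smooth_atlas N" "smooth_at M N f x" "openin (space_of N) B" "f x \<in> B"
  obtains V where "openin (space_of M) V" "x \<in> V" "f ` V \<subseteq> B"
proof -
  obtain W \<psi> V where W: "(W, \<psi>) \<in> atlas N" "openin (space_of M) V" "x \<in> V" "f ` V \<subseteq> W" "fsmooth M (\<psi> \<circ> f) x"
    using assms(3) unfolding smooth_at_def by blast
  have "openin (space_of N) (B \<inter> W)" using assms(4) chart_open[OF assms(2) W(1)] by blast
  then obtain T where T: "open T" "\<psi> ` (B \<inter> W) = \<psi> ` W \<inter> T"
    by (rule chart_image_open[OF assms(2) W(1)]) auto
  have mem: "y \<in> B \<longleftrightarrow> \<psi> y \<in> T" if "y \<in> W" for y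
    using T(2) that chart_inj[OF assms(2) W(1)] by (auto simp: inj_on_def)
  have "\<psi> (f x) \<in> T" using mem[of "f x"] W assms(5) by auto
  then have "\<forall>\<^sub>F y in nhdsin (space_of M) x. (\<psi> \<circ> f) y \<in> T"
    using topological_tendstoD[OF fsmooth_tendsto[OF assms(1) W(5)] T(1)] by simp
  then obtain S where S: "openin (space_of M) S" "x \<in> S" "\<And>y. y \<in> S \<Longrightarrow> \<psi> (f y) \<in> T"
    unfolding eventually_nhdsin using fsmooth_topspace[OF assms(1) W(5)] by auto
  show ?thesis
    by (rule that[of "S \<inter> V"]) (use S W mem in auto)
qed

lemma fsmooth_compose:
  assumes "smooth_atlas L" "smooth_atlas M" "smooth_at L M f x" "fsmooth M u (f x)"
  shows "fsmooth L (\<lambda>y. u (f y)) x"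
proof -
  obtain W \<psi> V where W: "(W, \<psi>) \<in> atlas M" "openin (space_of L) V" "x \<in> V" "f ` V \<subseteq> W" "fsmooth L (\<psi> \<circ> f) x"
    using assms(3) unfolding smooth_at_def by blast
  obtain B where B: "openin (space_of M) B" "f x \<in> B" "B \<subseteq> W" "smooth_on (\<psi> ` B) (u \<circ> inv_into W \<psi>)"
    by (rule fsmooth_in_chart[OF assms(2) W(1) assms(4)]) (use W in auto)
  obtain A where A: "openin (space_of L) A" "x \<in> A" "f ` A \<subseteq> B"
    by (rule smooth_at_nbhd[OF assms(1-3) B(1,2)])
  have "fsmooth L (\<lambda>y. (u \<circ> inv_into W \<psi>) ((\<psi> \<circ> f) y)) x"
    by (rule fsmooth_smooth_on[OF assms(1) W(5) A(1,2) _ B(4)]) (use A in auto)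
  then show ?thesis
  proof (rule fsmooth_cong[OF assms(1) _ A(1,2)])
    fix y assume "y \<in> A"
    then have "f y \<in> W" using A B by auto
    then show "(u \<circ> inv_into W \<psi>) ((\<psi> \<circ> f) y) = u (f y)"
      using chart_inv[OF assms(2) W(1)] by simp
  qed
qed

lemma smooth_at_compose:
  assumes "smooth_atlas L" "smooth_atlas M" "smooth_at L M f x" "smooth_at M N g (f x)"
  shows "smooth_at L N (\<lambda>y. g (f y)) x"
proof -
  obtain W \<psi> V where W: "(W, \<psi>) \<in> atlas N" "openin (space_of M) V" "f x \<in> V" "g ` V \<subseteq> W" "fsmooth M (\<psi> \<circ> g) (f x)"
    using assms(4) unfolding smooth_at_def by blast
  obtain A where A: "openin (space_of L) A" "x \<in> A" "f ` A \<subseteq> V"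
    by (rule smooth_at_nbhd[OF assms(1-3) W(2,3)])
  show ?thesis unfolding smooth_at_def
    using A W(1,4) fsmooth_compose[OF assms(1-3) W(5)] by (fastforce simp: comp_def)
qed

lemma smooth_at_cong:
  assumes "smooth_atlas M" "smooth_at M N f x" "openin (space_of M) A" "x \<in> A" "\<And>y. y \<in> A \<Longrightarrow> f y = g y"
  shows "smooth_at M N g x"
proof -
  obtain W \<psi> V where W: "(W, \<psi>) \<in> atlas N" "openin (space_of M) V" "x \<in> V" "f ` V \<subseteq> W" "fsmooth M (\<psi> \<circ> f) x"
    using assms(2) unfolding smooth_at_def by blast
  have "fsmooth M (\<psi> \<circ> g) x"
    by (rule fsmooth_cong[OF assms(1) W(5) assms(3,4)]) (use assms(5) in auto)
  then show ?thesis unfolding smooth_at_def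
    using W assms by (intro exI[of _ W] exI[of _ \<psi>] exI[of _ "V \<inter> A"]) auto
qed

lemma smooth_map_imp_smooth_at:
  assumes "smooth_atlas M" "smooth_atlas N" "smooth_map M N f" "x \<in> topspace (space_of M)"
  shows "smooth_at M N f x"
proof -
  have c: "continuous_map (space_of M) (space_of N) f" using assms(3) unfolding smooth_map_def by blast
  then have "f x \<in> topspace (space_of N)" using assms(4) continuous_map_image_subset_topspace by blast
  then obtain W \<psi> where W: "(W, \<psi>) \<in> atlas N" "f x \<in> W" using chart_cover[OF assms(2)] by blast
  obtain U \<phi> where U: "(U, \<phi>) \<in> atlas M" "x \<in> U" using chart_cover[OF assms(1,4)] by blast
  define V where "V = U \<inter> {y \<in> topspace (space_of M). f y \<in> W}"
  have V: "openin (space_of M) V" "x \<in> V" "f ` V \<subseteq> W" "V \<subseteq> U"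
    using openin_continuous_map_preimage[OF c chart_open[OF assms(2) W(1)]] chart_open[OF assms(1) U(1)]
      U W assms(4) by (auto simp: V_def)
  have "smooth_on (\<phi> ` (U \<inter> f -` W)) (\<psi> \<circ> f \<circ> inv_into U \<phi>)"
    using assms(3) U(1) W(1) unfolding smooth_map_def by fast
  then have "smooth_on (\<phi> ` V) (\<psi> \<circ> f \<circ> inv_into U \<phi>)"
    by (rule smooth_on_subset) (auto simp: V_def)
  then have "fsmooth M (\<psi> \<circ> f) x" unfolding fsmooth_def using U V by blast
  then show ?thesis unfolding smooth_at_def using W V by blast
qed

lemma smooth_at_imp_smooth_map:
  assumes M: "smooth_atlas M" and N: "smooth_atlas N"
    and s: "\<And>x. x \<in> topspace (space_of M) \<Longrightarrow> smooth_at M N f x"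
  shows "smooth_map M N f"
proof -
  have into: "f x \<in> topspace (space_of N)" if x: "x \<in> topspace (space_of M)" for x
    using s[OF x] chart_subset[OF N] unfolding smooth_at_def by blast
  have "continuous_map (space_of M) (space_of N) f"
    unfolding continuous_map_def
  proof (intro conjI allI impI)
    fix B assume B: "openin (space_of N) B"
    show "openin (space_of M) {x \<in> topspace (space_of M). f x \<in> B}"
    proof (subst openin_subopen, intro ballI)
      fix x assume "x \<in> {x \<in> topspace (space_of M). f x \<in> B}"
      then obtain V where "openin (space_of M) V" "x \<in> V" "f ` V \<subseteq> B"
        using smooth_at_nbhd[OF M N s B] by blast
      then show "\<exists>T. openin (space_of M) T \<and> x \<in> T \<and> T \<subseteq> {x \<in> topspace (space_of M). f x \<in> B}"
        using openin_subset by blast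
    qed
  qed (use into in auto)
  moreover have "smooth_on (\<phi> ` (U \<inter> f -` W)) (\<psi> \<circ> f \<circ> inv_into U \<phi>)"
    if U: "(U, \<phi>) \<in> atlas M" and W: "(W, \<psi>) \<in> atlas N" for U \<phi> W \<psi>
  proof (rule smooth_on_local)
    fix z assume "z \<in> \<phi> ` (U \<inter> f -` W)"
    then obtain x where x: "z = \<phi> x" "x \<in> U" "f x \<in> W" by auto
    have "x \<in> topspace (space_of M)" using x chart_subset[OF M U] by auto
    from fsmooth_compose[OF M N s[OF this] fsmooth_chart[OF N W x(3)]]
    obtain V where V: "openin (space_of M) V" "x \<in> V" "V \<subseteq> U" "smooth_on (\<phi> ` V) ((\<lambda>y. \<psi> (f y)) \<circ> inv_into U \<phi>)"
      by (rule fsmooth_in_chart[OF M U]) (use x in auto)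
    \<comment> \<open>Smoothness near \<open>x\<close> becomes smoothness on a relatively open piece
      of the chart image, cut out by an ambient open \<open>T\<close>, which is the form in which
      \<open>smooth_on_local\<close> glues.\<close>
    obtain T where T: "open T" "\<phi> ` V = \<phi> ` U \<inter> T"
      by (rule chart_image_open[OF M U V(1,3)])
    have "smooth_on (\<phi> ` (U \<inter> f -` W) \<inter> T) (\<psi> \<circ> f \<circ> inv_into U \<phi>)"
      using smooth_on_subset[OF V(4)[unfolded T(2)], of "\<phi> ` (U \<inter> f -` W) \<inter> T"]
      by (auto simp: comp_def)
    then show "\<exists>T. open T \<and> z \<in> T \<and> smooth_on (\<phi> ` (U \<inter> f -` W) \<inter> T) (\<psi> \<circ> f \<circ> inv_into U \<phi>)"
      using T V(2) x by (intro exI[of _ T]) auto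
  qed
  ultimately show ?thesis unfolding smooth_map_def by blast
qed

section \<open>Open submanifolds, products and linear manifolds\<close>

lemma space_of_open_submanifold [simp]: "space_of (open_submanifold M A) = subtopology (space_of M) A"
  by (simp add: open_submanifold_def)

lemma atlas_open_submanifold: "atlas (open_submanifold M A) = {(U \<inter> A, \<phi>) |U \<phi>. (U, \<phi>) \<in> atlas M}"
  by (simp add: open_submanifold_def)

lemma inv_into_restrict:
  "inj_on \<phi> U \<Longrightarrow> x \<in> U \<inter> A \<Longrightarrow> inv_into (U \<inter> A) \<phi> (\<phi> x) = x"
  by (rule inv_into_f_f) (auto intro: inj_on_subset)

lemma smooth_atlas_open_submanifold:
  assumes M: "smooth_atlas M" and A: "openin (space_of M) A"
  shows "smooth_atlas (open_submanifold M A)"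
proof -
  have "(\<Union>(U, \<phi>)\<in>atlas (open_submanifold M A). U) = topspace (space_of M) \<inter> A"
  proof (intro set_eqI iffI)
    fix x assume "x \<in> topspace (space_of M) \<inter> A"
    moreover obtain U \<phi> where "(U, \<phi>) \<in> atlas M" "x \<in> U"
      using chart_cover[OF M, of x] \<open>x \<in> topspace (space_of M) \<inter> A\<close> by auto
    ultimately show "x \<in> (\<Union>(U, \<phi>)\<in>atlas (open_submanifold M A). U)"
      unfolding atlas_open_submanifold by blast
  next
    fix x assume "x \<in> (\<Union>(U, \<phi>)\<in>atlas (open_submanifold M A). U)"
    then show "x \<in> topspace (space_of M) \<inter> A"
      unfolding atlas_open_submanifold using chart_subset[OF M] by blast
  qed
  moreover have "openin (subtopology (space_of M) A) (U \<inter> A)"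
    "homeomorphic_map (subtopology (subtopology (space_of M) A) (U \<inter> A)) (top_of_set (\<phi> ` (U \<inter> A))) \<phi>"
    if ch: "(U, \<phi>) \<in> atlas M" for U \<phi>
  proof -
    show "openin (subtopology (space_of M) A) (U \<inter> A)"
      using chart_open[OF M ch] by (auto simp: openin_subtopology)
    have "homeomorphic_map (subtopology (subtopology (space_of M) U) (U \<inter> A))
        (subtopology (top_of_set (\<phi> ` U)) (\<phi> ` (U \<inter> A))) \<phi>"
      by (rule homeomorphic_map_subtopologies_alt[OF chart_homeo[OF M ch]])
         (use chart_subset[OF M ch] chart_inj[OF M ch] in \<open>auto simp: inj_on_def\<close>)
    then show "homeomorphic_map (subtopology (subtopology (space_of M) A) (U \<inter> A)) (top_of_set (\<phi> ` (U \<inter> A))) \<phi>"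
      by (simp add: subtopology_subtopology image_mono inf_absorb2 Int_commute Int_left_commute)
  qed
  moreover have "smooth_on (\<phi> ` ((U \<inter> A) \<inter> (W \<inter> A))) (\<psi> \<circ> inv_into (U \<inter> A) \<phi>)"
    if U: "(U, \<phi>) \<in> atlas M" and W: "(W, \<psi>) \<in> atlas M" for U \<phi> W \<psi>
  proof -
    have "smooth_on (\<phi> ` (U \<inter> W)) (\<psi> \<circ> inv_into U \<phi>)"
      using M U W unfolding smooth_atlas_def by fast
    then have "smooth_on (\<phi> ` ((U \<inter> A) \<inter> (W \<inter> A))) (\<psi> \<circ> inv_into U \<phi>)"
      by (rule smooth_on_subset) auto
    then show ?thesis
      by (rule smooth_on_cong)
         (auto simp: inv_into_restrict[OF chart_inj[OF M U]] chart_inv[OF M U])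
  qed
  ultimately show ?thesis
    unfolding smooth_atlas_def by (auto simp: atlas_open_submanifold)
qed

lemma fsmooth_open_submanifold:
  assumes M: "smooth_atlas M" and A: "openin (space_of M) A"
  shows "fsmooth (open_submanifold M A) f x \<longleftrightarrow> fsmooth M f x \<and> x \<in> A"
proof
  assume "fsmooth (open_submanifold M A) f x"
  then obtain U \<phi> V where V: "(U, \<phi>) \<in> atlas M" "openin (subtopology (space_of M) A) V" "x \<in> V" "V \<subseteq> U \<inter> A"
    and s: "smooth_on (\<phi> ` V) (f \<circ> inv_into (U \<inter> A) \<phi>)"
    unfolding fsmooth_def atlas_open_submanifold by auto
  have "openin (space_of M) V" using V(2) A openin_trans_full by blast
  moreover have "smooth_on (\<phi> ` V) (f \<circ> inv_into U \<phi>)"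
    by (rule smooth_on_cong[OF s])
       (use V in \<open>auto simp: subset_eq inv_into_restrict[OF chart_inj[OF M V(1)]] chart_inv[OF M V(1)]\<close>)
  ultimately show "fsmooth M f x \<and> x \<in> A"
    unfolding fsmooth_def using V by blast
next
  assume "fsmooth M f x \<and> x \<in> A"
  then obtain U \<phi> V where V: "(U, \<phi>) \<in> atlas M" "openin (space_of M) V" "x \<in> V" "V \<subseteq> U"
    and s: "smooth_on (\<phi> ` V) (f \<circ> inv_into U \<phi>)" and "x \<in> A"
    unfolding fsmooth_def by blast
  have "smooth_on (\<phi> ` (V \<inter> A)) (f \<circ> inv_into U \<phi>)"
    by (rule smooth_on_subset[OF s]) auto
  then have "smooth_on (\<phi> ` (V \<inter> A)) (f \<circ> inv_into (U \<inter> A) \<phi>)"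
    by (rule smooth_on_cong)
       (use V in \<open>auto simp: subset_eq inv_into_restrict[OF chart_inj[OF M V(1)]] chart_inv[OF M V(1)]\<close>)
  moreover have "openin (subtopology (space_of M) A) (V \<inter> A)"
    using V(2) by (auto simp: openin_subtopology)
  ultimately show "fsmooth (open_submanifold M A) f x"
    unfolding fsmooth_def atlas_open_submanifold using V \<open>x \<in> A\<close>
    by (intro exI[of _ "U \<inter> A"] exI[of _ \<phi>] exI[of _ "V \<inter> A"]) auto
qed

lemma smooth_at_open_submanifold_source:
  assumes "smooth_atlas M" "openin (space_of M) A"
  shows "smooth_at (open_submanifold M A) N f x \<longleftrightarrow> smooth_at M N f x \<and> x \<in> A"
proof
  assume "smooth_at (open_submanifold M A) N f x"
  then obtain W \<psi> V where W: "(W, \<psi>) \<in> atlas N" "openin (subtopology (space_of M) A) V" "x \<in> V" "f ` V \<subseteq> W"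
    "fsmooth M (\<psi> \<circ> f) x" "x \<in> A"
    unfolding smooth_at_def fsmooth_open_submanifold[OF assms] by auto
  have "openin (space_of M) V" using W(2) assms(2) openin_trans_full by blast
  then show "smooth_at M N f x \<and> x \<in> A" unfolding smooth_at_def using W by blast
next
  assume "smooth_at M N f x \<and> x \<in> A"
  then obtain W \<psi> V where W: "(W, \<psi>) \<in> atlas N" "openin (space_of M) V" "x \<in> V" "f ` V \<subseteq> W"
    "fsmooth M (\<psi> \<circ> f) x" "x \<in> A"
    unfolding smooth_at_def by blast
  have "openin (subtopology (space_of M) A) (V \<inter> A)"
    using W(2) by (auto simp: openin_subtopology)
  then show "smooth_at (open_submanifold M A) N f x"
    unfolding smooth_at_def fsmooth_open_submanifold[OF assms] using W
    by (intro exI[of _ W] exI[of _ \<psi>] exI[of _ "V \<inter> A"]) auto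
qed

lemma smooth_at_open_submanifold_target:
  "smooth_at M (open_submanifold N B) f x \<Longrightarrow> smooth_at M N f x"
  unfolding smooth_at_def atlas_open_submanifold by blast

lemma space_of_product_manifold [simp]:
  "space_of (product_manifold M N) = prod_topology (space_of M) (space_of N)"
  by (simp add: product_manifold_def)

lemma atlas_product_manifold:
  "atlas (product_manifold M N) =
    {(U \<times> W, map_prod \<phi> \<psi>) |U \<phi> W \<psi>. (U, \<phi>) \<in> atlas M \<and> (W, \<psi>) \<in> atlas N}"
  by (simp add: product_manifold_def)

lemma inv_into_map_prod:
  assumes "inj_on \<phi> U" "inj_on \<psi> W" "x \<in> U" "y \<in> W"
  shows "inv_into (U \<times> W) (map_prod \<phi> \<psi>) (\<phi> x, \<psi> y) = (x, y)"
proof -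
  have "inj_on (map_prod \<phi> \<psi>) (U \<times> W)" using assms by (auto simp: inj_on_def)
  from inv_into_f_f[OF this, of "(x, y)"] assms show ?thesis by simp
qed

lemma smooth_atlas_product_manifold:
  assumes M: "smooth_atlas M" and N: "smooth_atlas N"
  shows "smooth_atlas (product_manifold M N)"
proof -
  have cover: "(\<Union>(U, \<phi>)\<in>atlas (product_manifold M N). U) = topspace (space_of M) \<times> topspace (space_of N)"
  proof (intro set_eqI iffI)
    fix p assume p: "p \<in> topspace (space_of M) \<times> topspace (space_of N)"
    have fs: "fst p \<in> topspace (space_of M)" "snd p \<in> topspace (space_of N)" using p by auto
    obtain U \<phi> where "(U, \<phi>) \<in> atlas M" "fst p \<in> U"
      by (rule chart_cover[OF M fs(1)])
    moreover obtain W \<psi> where "(W, \<psi>) \<in> atlas N" "snd p \<in> W"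
      by (rule chart_cover[OF N fs(2)])
    ultimately have "(U \<times> W, map_prod \<phi> \<psi>) \<in> atlas (product_manifold M N)" "p \<in> U \<times> W"
      unfolding atlas_product_manifold by (auto simp: mem_Times_iff)
    then show "p \<in> (\<Union>(U, \<phi>)\<in>atlas (product_manifold M N). U)" by blast
  next
    fix p assume "p \<in> (\<Union>(U, \<phi>)\<in>atlas (product_manifold M N). U)"
    then show "p \<in> topspace (space_of M) \<times> topspace (space_of N)"
      unfolding atlas_product_manifold using chart_subset[OF M] chart_subset[OF N] by blast
  qed
  have chart: "openin (prod_topology (space_of M) (space_of N)) (U \<times> W)"
    "homeomorphic_map (subtopology (prod_topology (space_of M) (space_of N)) (U \<times> W))
       (top_of_set (map_prod \<phi> \<psi> ` (U \<times> W))) (map_prod \<phi> \<psi>)"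
    if U: "(U, \<phi>) \<in> atlas M" and W: "(W, \<psi>) \<in> atlas N" for U \<phi> W \<psi>
  proof -
    show "openin (prod_topology (space_of M) (space_of N)) (U \<times> W)"
      using chart_open[OF M U] chart_open[OF N W] by (simp add: openin_prod_Times_iff)
    obtain \<phi>' where "homeomorphic_maps (subtopology (space_of M) U) (top_of_set (\<phi> ` U)) \<phi> \<phi>'"
      using chart_homeo[OF M U] homeomorphic_map_maps by blast
    moreover obtain \<psi>' where "homeomorphic_maps (subtopology (space_of N) W) (top_of_set (\<psi> ` W)) \<psi> \<psi>'"
      using chart_homeo[OF N W] homeomorphic_map_maps by blast
    ultimately have "homeomorphic_maps
        (prod_topology (subtopology (space_of M) U) (subtopology (space_of N) W))
        (prod_topology (top_of_set (\<phi> ` U)) (top_of_set (\<psi> ` W)))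
        (\<lambda>(x, y). (\<phi> x, \<psi> y)) (\<lambda>(x, y). (\<phi>' x, \<psi>' y))"
      by (intro homeomorphic_maps_prod[THEN iffD2] disjI2 conjI)
    moreover have "(\<lambda>(x, y). (\<phi> x, \<psi> y)) = map_prod \<phi> \<psi>"
      by (rule map_prod_def[symmetric])
    moreover have "prod_topology (top_of_set (\<phi> ` U)) (top_of_set (\<psi> ` W)) = top_of_set (map_prod \<phi> \<psi> ` (U \<times> W))"
      by (simp add: map_prod_surj_on[OF refl refl])
    ultimately show "homeomorphic_map (subtopology (prod_topology (space_of M) (space_of N)) (U \<times> W))
       (top_of_set (map_prod \<phi> \<psi> ` (U \<times> W))) (map_prod \<phi> \<psi>)"
      unfolding homeomorphic_map_maps subtopology_Times by (intro exI) simp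
  qed
  have trans: "smooth_on (map_prod \<phi> \<psi> ` ((U \<times> W) \<inter> (U' \<times> W')))
      (map_prod \<phi>' \<psi>' \<circ> inv_into (U \<times> W) (map_prod \<phi> \<psi>))"
    if U: "(U, \<phi>) \<in> atlas M" and W: "(W, \<psi>) \<in> atlas N"
      and U': "(U', \<phi>') \<in> atlas M" and W': "(W', \<psi>') \<in> atlas N" for U \<phi> W \<psi> U' \<phi>' W' \<psi>'
  proof -
    let ?A = "map_prod \<phi> \<psi> ` ((U \<times> W) \<inter> (U' \<times> W'))"
    have s1: "smooth_on (\<phi> ` (U \<inter> U')) (\<phi>' \<circ> inv_into U \<phi>)"
      using M U U' unfolding smooth_atlas_def by fast
    have s2: "smooth_on (\<psi> ` (W \<inter> W')) (\<psi>' \<circ> inv_into W \<psi>)"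
      using N W W' unfolding smooth_atlas_def by fast
    have "smooth_on ?A (\<lambda>p. ((\<phi>' \<circ> inv_into U \<phi>) (fst p), (\<psi>' \<circ> inv_into W \<psi>) (snd p)))"
      by (rule smooth_on_Pair[OF smooth_on_compose[OF smooth_on_bounded_linear[OF bounded_linear_fst] s1]
            smooth_on_compose[OF smooth_on_bounded_linear[OF bounded_linear_snd] s2]]) auto
    then show ?thesis
      by (rule smooth_on_cong)
         (auto simp: inv_into_map_prod[OF chart_inj[OF M U] chart_inj[OF N W]]
           chart_inv[OF M U] chart_inv[OF N W])
  qed
  show ?thesis
    unfolding smooth_atlas_def
  proof (intro conjI)
    show "(\<Union>(U, \<phi>)\<in>atlas (product_manifold M N). U) = topspace (space_of (product_manifold M N))"
      using cover by simp
    show "\<forall>(U, \<phi>)\<in>atlas (product_manifold M N). openin (space_of (product_manifold M N)) U \<and>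
        homeomorphic_map (subtopology (space_of (product_manifold M N)) U) (top_of_set (\<phi> ` U)) \<phi>"
      unfolding atlas_product_manifold space_of_product_manifold using chart by fast
    show "\<forall>(U, \<phi>)\<in>atlas (product_manifold M N). \<forall>(W, \<psi>)\<in>atlas (product_manifold M N).
        smooth_on (\<phi> ` (U \<inter> W)) (\<psi> \<circ> inv_into U \<phi>)"
      unfolding atlas_product_manifold using trans by fast
  qed
qed

lemma fsmooth_fst_snd:
  assumes M: "smooth_atlas M" and N: "smooth_atlas N" and x: "x \<in> topspace (space_of M)" and y: "y \<in> topspace (space_of N)"
  shows "fsmooth M f x \<Longrightarrow> fsmooth (product_manifold M N) (\<lambda>p. f (fst p)) (x, y)"
    and "fsmooth N g y \<Longrightarrow> fsmooth (product_manifold M N) (\<lambda>p. g (snd p)) (x, y)"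
proof -
  assume "fsmooth M f x"
  then obtain U \<phi> V where V: "(U, \<phi>) \<in> atlas M" "openin (space_of M) V" "x \<in> V" "V \<subseteq> U"
    and s: "smooth_on (\<phi> ` V) (f \<circ> inv_into U \<phi>)" unfolding fsmooth_def by blast
  obtain W \<psi> where W: "(W, \<psi>) \<in> atlas N" "y \<in> W" using chart_cover[OF N y] by blast
  have "smooth_on (map_prod \<phi> \<psi> ` (V \<times> W)) (\<lambda>p. (f \<circ> inv_into U \<phi>) (fst p))"
    by (rule smooth_on_compose[OF smooth_on_bounded_linear[OF bounded_linear_fst] s]) auto
  then have "smooth_on (map_prod \<phi> \<psi> ` (V \<times> W)) ((\<lambda>p. f (fst p)) \<circ> inv_into (U \<times> W) (map_prod \<phi> \<psi>))"
    by (rule smooth_on_cong)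
       (use V in \<open>auto simp: subset_eq inv_into_map_prod[OF chart_inj[OF M V(1)] chart_inj[OF N W(1)]]
          chart_inv[OF M V(1)]\<close>)
  then show "fsmooth (product_manifold M N) (\<lambda>p. f (fst p)) (x, y)"
    unfolding fsmooth_def atlas_product_manifold using V W chart_open[OF N W(1)]
    by (intro exI[of _ "U \<times> W"] exI[of _ "map_prod \<phi> \<psi>"] exI[of _ "V \<times> W"])
       (auto simp: openin_prod_Times_iff)
next
  assume "fsmooth N g y"
  then obtain W \<psi> V where V: "(W, \<psi>) \<in> atlas N" "openin (space_of N) V" "y \<in> V" "V \<subseteq> W"
    and s: "smooth_on (\<psi> ` V) (g \<circ> inv_into W \<psi>)" unfolding fsmooth_def by blast
  obtain U \<phi> where U: "(U, \<phi>) \<in> atlas M" "x \<in> U" using chart_cover[OF M x] by blast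
  have "smooth_on (map_prod \<phi> \<psi> ` (U \<times> V)) (\<lambda>p. (g \<circ> inv_into W \<psi>) (snd p))"
    by (rule smooth_on_compose[OF smooth_on_bounded_linear[OF bounded_linear_snd] s]) auto
  then have "smooth_on (map_prod \<phi> \<psi> ` (U \<times> V)) ((\<lambda>p. g (snd p)) \<circ> inv_into (U \<times> W) (map_prod \<phi> \<psi>))"
    by (rule smooth_on_cong)
       (use V in \<open>auto simp: subset_eq inv_into_map_prod[OF chart_inj[OF M U(1)] chart_inj[OF N V(1)]]
          chart_inv[OF N V(1)]\<close>)
  then show "fsmooth (product_manifold M N) (\<lambda>p. g (snd p)) (x, y)"
    unfolding fsmooth_def atlas_product_manifold using V U chart_open[OF M U(1)]
    by (intro exI[of _ "U \<times> W"] exI[of _ "map_prod \<phi> \<psi>"] exI[of _ "U \<times> V"])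
       (auto simp: openin_prod_Times_iff)
qed

lemma smooth_at_fst:
  assumes M: "smooth_atlas M" and N: "smooth_atlas N" and x: "x \<in> topspace (space_of M)" and y: "y \<in> topspace (space_of N)"
  shows "smooth_at (product_manifold M N) M fst (x, y)"
proof -
  obtain U \<phi> where U: "(U, \<phi>) \<in> atlas M" "x \<in> U" using chart_cover[OF M x] by blast
  have "fsmooth (product_manifold M N) (\<phi> \<circ> fst) (x, y)"
    using fsmooth_fst_snd(1)[OF assms fsmooth_chart[OF M U]] by (simp add: comp_def)
  then show ?thesis unfolding smooth_at_def
    using U y chart_open[OF M U(1)]
    by (intro exI[of _ U] exI[of _ \<phi>] exI[of _ "U \<times> topspace (space_of N)"]) (auto simp: openin_prod_Times_iff)
qed

lemma smooth_at_Pair: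
  assumes L: "smooth_atlas L" and f: "smooth_at L M f x" and g: "smooth_at L N g x"
  shows "smooth_at L (product_manifold M N) (\<lambda>y. (f y, g y)) x"
proof -
  obtain W \<psi> V where W: "(W, \<psi>) \<in> atlas M" "openin (space_of L) V" "x \<in> V" "f ` V \<subseteq> W" "fsmooth L (\<psi> \<circ> f) x"
    using f unfolding smooth_at_def by blast
  obtain W' \<psi>' V' where W': "(W', \<psi>') \<in> atlas N" "openin (space_of L) V'" "x \<in> V'" "g ` V' \<subseteq> W'" "fsmooth L (\<psi>' \<circ> g) x"
    using g unfolding smooth_at_def by blast
  have "fsmooth L (map_prod \<psi> \<psi>' \<circ> (\<lambda>y. (f y, g y))) x"
    using fsmooth_Pair[OF L W(5) W'(5)] by (simp add: comp_def)
  then show ?thesis unfolding smooth_at_def atlas_product_manifold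
    using W W' by (intro exI[of _ "W \<times> W'"] exI[of _ "map_prod \<psi> \<psi>'"] exI[of _ "V \<inter> V'"]) auto
qed

lemma space_of_linear_manifold [simp]: "space_of (linear_manifold V) = top_of_set V"
  by (simp add: linear_manifold_def)

lemma atlas_linear_manifold: "atlas (linear_manifold V) = {(V, id)}"
  by (simp add: linear_manifold_def)

lemma smooth_atlas_linear_manifold: "smooth_atlas (linear_manifold V)"
  unfolding smooth_atlas_def atlas_linear_manifold
  by (auto intro!: smooth_on_cong[OF smooth_on_bounded_linear[OF bounded_linear_ident]] simp: subtopology_subtopology)

lemma smooth_at_linear_manifoldD: "smooth_at M (linear_manifold V) f x \<Longrightarrow> fsmooth M f x"
  unfolding smooth_at_def atlas_linear_manifold by (elim exE conjE) simp

lemma smooth_at_linear_manifoldI: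
  "fsmooth M f x \<Longrightarrow> openin (space_of M) A \<Longrightarrow> x \<in> A \<Longrightarrow> f ` A \<subseteq> V \<Longrightarrow> smooth_at M (linear_manifold V) f x"
  unfolding smooth_at_def atlas_linear_manifold by auto

lemma smooth_at_id:
  assumes "smooth_atlas M" "x \<in> topspace (space_of M)"
  shows "smooth_at M M (\<lambda>y. y) x"
proof -
  obtain U \<phi> where U: "(U, \<phi>) \<in> atlas M" "x \<in> U" using chart_cover[OF assms] by blast
  then show ?thesis unfolding smooth_at_def
    using fsmooth_chart[OF assms(1) U] chart_open[OF assms(1) U(1)] by (auto simp: comp_def)
qed

subsection \<open>Partitions of unity\<close>

text \<open>A Euclidean bump function is pulled back by a chart and extended by 0. The extension is
  smooth across the edge of the chart domain because its support lies in \<open>C\<close>, which is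
  compact as the chart preimage of \<open>K\<close> and hence closed in a Hausdorff space. That the
  chart image is open in \<open>model M\<close> ensures that the whole of \<open>K\<close> lies
  inside it.\<close>

lemma manifold_bump_function:
  fixes M :: "('a, 'e::euclidean_space) charted_space"
  assumes mf: "smooth_manifold M" and U: "openin (space_of M) U" "p \<in> U"
  shows "\<exists>(f :: 'a \<Rightarrow> real) C V. (\<forall>x. 0 \<le> f x \<and> f x \<le> 1) \<and> (\<forall>x\<in>topspace (space_of M). fsmooth M f x) \<and>
      closedin (space_of M) C \<and> C \<subseteq> U \<and> (\<forall>x. x \<notin> C \<longrightarrow> f x = 0) \<and> openin (space_of M) V \<and> p \<in> V \<and> (\<forall>x\<in>V. f x = 1)"
proof -
  have M: "smooth_atlas M" by (rule smooth_manifold_imp_smooth_atlas[OF mf])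
  have "p \<in> topspace (space_of M)" using U openin_subset by blast
  then obtain W \<phi> where W: "(W, \<phi>) \<in> atlas M" "p \<in> W" by (rule chart_cover[OF M])
  have sub: "subspace (model M)" and om: "openin (top_of_set (model M)) (\<phi> ` W)"
    and H: "Hausdorff_space (space_of M)"
    using mf W(1) unfolding smooth_manifold_def by auto
  obtain T where T: "open T" "\<phi> ` (U \<inter> W) = \<phi> ` W \<inter> T"
    by (rule chart_image_open[OF M W(1), of "U \<inter> W"]) (use U chart_open[OF M W(1)] in auto)
  obtain T' where T': "open T'" "\<phi> ` W = model M \<inter> T'" using om by (auto simp: openin_open)
  have "\<phi> p \<in> \<phi> ` (U \<inter> W)" using U W by blast
  then have "\<phi> p \<in> T \<inter> T'" unfolding T(2) T'(2) by blast
  then obtain r where r: "r > 0" "ball (\<phi> p) r \<subseteq> T \<inter> T'"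
    using open_contains_ball[of "T \<inter> T'"] open_Int[OF T(1) T'(1)] by blast
  \<comment> \<open>The bump function vanishes from radius \<open>2 * e\<close> on, and the closed
    ball of that radius must fit into the open ball of radius \<open>r\<close>.\<close>
  define e where "e = r / 4"
  have e: "e > 0" using r by (simp add: e_def)
  obtain \<beta> :: "'e \<Rightarrow> real" where \<beta>0: "\<forall>k. higher_differentiable_on UNIV k \<beta>" "\<forall>x. 0 \<le> \<beta> x \<and> \<beta> x \<le> 1"
    "\<forall>x. norm (x - \<phi> p) \<le> e \<longrightarrow> \<beta> x = 1" "\<forall>x. 2 * e \<le> norm (x - \<phi> p) \<longrightarrow> \<beta> x = 0"
    by (rule bump_function[OF e])
  note \<beta> = \<beta>0[rule_format]
  define K where "K = cball (\<phi> p) (2 * e) \<inter> model M"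
  define C where "C = W \<inter> \<phi> -` cball (\<phi> p) (2 * e)"
  define f where "f x = (if x \<in> W then \<beta> (\<phi> x) else 0)" for x
  have "K \<subseteq> ball (\<phi> p) r \<inter> model M" using r by (auto simp: K_def e_def)
  also have "\<dots> \<subseteq> model M \<inter> T' \<inter> T" using r(2) by blast
  finally have K: "K \<subseteq> \<phi> ` (U \<inter> W)" unfolding T(2) T'(2) .
  have \<phi>C: "\<phi> ` C = K"
  proof
    show "\<phi> ` C \<subseteq> K" using T'(2) by (auto simp: C_def K_def)
    show "K \<subseteq> \<phi> ` C"
    proof
      fix z assume z: "z \<in> K"
      then obtain x where "z = \<phi> x" "x \<in> W" using K by blast
      then show "z \<in> \<phi> ` C" using z by (auto simp: C_def K_def)
    qed
  qed
  have CU: "C \<subseteq> U"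
  proof
    fix x assume x: "x \<in> C"
    then have "\<phi> x \<in> \<phi> ` (U \<inter> W)" using K \<phi>C by blast
    then show "x \<in> U" using x chart_inj[OF M W(1)] by (auto simp: C_def inj_on_def)
  qed
  have "compact K" unfolding K_def by (intro compact_Int_closed compact_cball closed_subspace sub)
  then have "compactin (top_of_set (\<phi> ` W)) (\<phi> ` C)"
    using K \<phi>C by (auto simp: compactin_subtopology)
  then have "compactin (subtopology (space_of M) W) C"
    using homeomorphic_map_compactness[OF chart_homeo[OF M W(1)], of C] chart_subset[OF M W(1)]
    by (auto simp: C_def)
  then have C: "closedin (space_of M) C"
    using compactin_imp_closedin[OF H] by (simp add: compactin_subtopology)
  have f0: "f x = 0" if "x \<notin> C" for x
    using that \<beta>(4)[of "\<phi> x"] by (auto simp: f_def C_def dist_norm norm_minus_commute)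
  have fs: "fsmooth M f x" if x: "x \<in> topspace (space_of M)" for x
  proof (cases "x \<in> W")
    case True
    have s: "smooth_on UNIV \<beta>" by (rule smooth_on_openI[OF open_UNIV \<beta>(1)]) simp
    have "fsmooth M (\<lambda>y. \<beta> (\<phi> y)) x"
      by (rule fsmooth_smooth_on[OF M fsmooth_chart[OF M W(1) True] chart_open[OF M W(1)] True subset_UNIV s])
    then show ?thesis
      by (rule fsmooth_cong[OF M _ chart_open[OF M W(1)] True]) (simp add: f_def)
  next
    case False
    show ?thesis
      by (rule fsmooth_cong[OF M fsmooth_const[OF M x], of "topspace (space_of M) - C"])
         (use C x False f0 in \<open>auto simp: C_def\<close>)
  qed
  define V where "V = W \<inter> \<phi> -` ball (\<phi> p) e"
  have V: "openin (space_of M) V" "p \<in> V"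
    using chart_preimage_open[OF M W(1) open_ball] W e by (auto simp: V_def)
  have f1: "f x = 1" if "x \<in> V" for x
    using that \<beta>(3)[of "\<phi> x"] by (auto simp: f_def V_def dist_norm norm_minus_commute)
  have "0 \<le> f x \<and> f x \<le> 1" for x using \<beta>(2)[of "\<phi> x"] by (simp add: f_def)
  then show ?thesis using fs C CU f0 V f1
    by (intro exI[of _ f] exI[of _ C] exI[of _ V] conjI) simp_all
qed

text \<open>The alternative on \<open>S\<close> expresses that the support of the
  \<open>n\<close>-th function lies in \<open>V n\<close>, in the form used for weighted sums: near
  any point a term either has its data defined on a whole neighbourhood or is identically 0
  there.\<close>

definition partition_of_unity ::
  "('a, 'e::euclidean_space) charted_space \<Rightarrow> (nat \<Rightarrow> 'a \<Rightarrow> real) \<Rightarrow> (nat \<Rightarrow> 'a set) \<Rightarrow> bool" where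
  "partition_of_unity M \<rho> V \<longleftrightarrow>
     (\<forall>n x. 0 \<le> \<rho> n x) \<and> (\<forall>n. \<forall>x\<in>topspace (space_of M). fsmooth M (\<rho> n) x) \<and>
     (\<forall>x\<in>topspace (space_of M). \<exists>S m. openin (space_of M) S \<and> x \<in> S \<and>
        (\<forall>n. S \<subseteq> V n \<or> (\<forall>y\<in>S. \<rho> n y = 0)) \<and>
        (\<forall>y\<in>S. (\<forall>n\<ge>m. \<rho> n y = 0) \<and> (\<Sum>n<m. \<rho> n y) = 1))"

text \<open>With \<open>f\<^sub>n\<close> countably many bump functions equal to \<open>1\<close> on the members of an open cover, the
  functions \<open>f\<^sub>n * (\<Prod>k<n. 1 - f\<^sub>k)\<close> are automatically locally finite, since the \<open>n\<close>-th one vanishes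
  wherever an earlier \<open>f\<^sub>k\<close> is \<open>1\<close>; their sums telescope.\<close>

lemma partition_of_unity_exists:
  fixes M :: "('a, 'e::euclidean_space) charted_space"
  assumes mf: "smooth_manifold M"
    and G: "\<And>p. p \<in> topspace (space_of M) \<Longrightarrow> openin (space_of M) (G p) \<and> p \<in> G p"
  obtains \<rho> c where "partition_of_unity M \<rho> (\<lambda>n. G (c n))"
    "topspace (space_of M) \<noteq> {} \<longrightarrow> range c \<subseteq> topspace (space_of M)"
proof (cases "topspace (space_of M) = {}")
  case True
  \<comment> \<open>Without points there are no admissible values for \<open>c\<close>, hence the
    implication in the second conclusion.\<close>
  then have "partition_of_unity M (\<lambda>n x. 0) (\<lambda>n. G (undefined n))"
    by (simp add: partition_of_unity_def)
  then show ?thesis using True by (intro that) auto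
next
  case False
  let ?X = "space_of M"
  have M: "smooth_atlas M" by (rule smooth_manifold_imp_smooth_atlas[OF mf])
  have "\<forall>p\<in>topspace ?X. \<exists>(f :: 'a \<Rightarrow> real) C V. (\<forall>x. 0 \<le> f x \<and> f x \<le> 1) \<and> (\<forall>x\<in>topspace ?X. fsmooth M f x) \<and>
      closedin ?X C \<and> C \<subseteq> G p \<and> (\<forall>x. x \<notin> C \<longrightarrow> f x = 0) \<and> openin ?X V \<and> p \<in> V \<and> (\<forall>x\<in>V. f x = 1)"
    by (intro ballI manifold_bump_function[OF mf]) (use G in auto)
  then obtain F :: "'a \<Rightarrow> 'a \<Rightarrow> real" and C V where
    F: "\<And>p. p \<in> topspace ?X \<Longrightarrow> (\<forall>x. 0 \<le> F p x \<and> F p x \<le> 1) \<and> (\<forall>x\<in>topspace ?X. fsmooth M (F p) x) \<and>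
      closedin ?X (C p) \<and> C p \<subseteq> G p \<and> (\<forall>x. x \<notin> C p \<longrightarrow> F p x = 0) \<and> openin ?X (V p) \<and> p \<in> V p \<and> (\<forall>x\<in>V p. F p x = 1)"
    unfolding bchoice_iff by metis
  have F01: "0 \<le> F p x" "F p x \<le> 1" and Fs: "x \<in> topspace ?X \<Longrightarrow> fsmooth M (F p) x"
    and FC: "closedin ?X (C p)" "C p \<subseteq> G p" and F0: "x \<notin> C p \<Longrightarrow> F p x = 0"
    and FV: "openin ?X (V p)" "p \<in> V p" and F1: "x \<in> V p \<Longrightarrow> F p x = 1" if "p \<in> topspace ?X" for p x
    using F[OF that] by simp_all
  have "second_countable ?X" using mf unfolding smooth_manifold_def by blast
  then have "Lindelof_space ?X" by (rule second_countable_imp_Lindelof_space)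
  moreover have "\<forall>U\<in>V ` topspace ?X. openin ?X U" using FV(1) by auto
  moreover have "\<Union>(V ` topspace ?X) = topspace ?X"
  proof
    show "\<Union>(V ` topspace ?X) \<subseteq> topspace ?X" using FV(1) openin_subset by blast
    show "topspace ?X \<subseteq> \<Union>(V ` topspace ?X)" using FV(2) by auto
  qed
  ultimately obtain \<V> where \<V>: "countable \<V>" "\<V> \<subseteq> V ` topspace ?X" "\<Union>\<V> = topspace ?X"
    unfolding Lindelof_space_def by meson
  then obtain D where D: "countable D" "D \<subseteq> topspace ?X" "\<V> = V ` D"
    by (meson countable_subset_image)
  have "D \<noteq> {}" using False \<V>(3) unfolding D(3) by blast
  \<comment> \<open>If \<open>D\<close> is finite the enumeration repeats entries; the telescoping
    formula holds for any sequence.\<close>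
  define c where "c = from_nat_into D"
  have c: "range c = D" unfolding c_def using \<open>D \<noteq> {}\<close> D(1) by (rule range_from_nat_into)
  then have cX: "c n \<in> topspace ?X" for n using D(2) by blast
  define \<rho> where "\<rho> n x = F (c n) x * (\<Prod>k<n. 1 - F (c k) x)" for n x
  have sum: "(\<Sum>n<m. \<rho> n x) = 1 - (\<Prod>k<m. 1 - F (c k) x)" for m x
    by (induction m) (simp_all add: \<rho>_def algebra_simps)
  have nn: "0 \<le> \<rho> n x" for n x
    unfolding \<rho>_def by (intro mult_nonneg_nonneg prod_nonneg) (simp_all add: F01[OF cX])
  have fp: "fsmooth M (\<lambda>x. \<Prod>k<n. 1 - F (c k) x) x" if x: "x \<in> topspace ?X" for n x
  proof (induction n)
    case 0
    then show ?case by (simp add: fsmooth_const[OF M x])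
  next
    case (Suc n)
    have "fsmooth M (F (c n)) x" by (rule Fs[OF cX x])
    then have "fsmooth M (\<lambda>x. 1 + (- F (c n) x)) x"
      by (intro fsmooth_add[OF M fsmooth_const[OF M x]]
          fsmooth_linear_comp[OF M bounded_linear_minus[OF bounded_linear_ident]])
    from fsmooth_bilinear[OF M bounded_bilinear_mult Suc this] show ?case by simp
  qed
  have fs: "fsmooth M (\<rho> n) x" if x: "x \<in> topspace ?X" for n x
  proof -
    have "fsmooth M (F (c n)) x" by (rule Fs[OF cX x])
    from fsmooth_bilinear[OF M bounded_bilinear_mult this fp[OF x]] show ?thesis
      unfolding \<rho>_def[abs_def] .
  qed
  have "\<exists>S m. openin ?X S \<and> x \<in> S \<and> (\<forall>n. S \<subseteq> G (c n) \<or> (\<forall>y\<in>S. \<rho> n y = 0)) \<and>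
        (\<forall>y\<in>S. (\<forall>n\<ge>m. \<rho> n y = 0) \<and> (\<Sum>n<m. \<rho> n y) = 1)" if x: "x \<in> topspace ?X" for x
  proof -
    have "x \<in> \<Union>(V ` D)" using x \<V>(3) D(3) by simp
    then obtain j where j: "x \<in> V (c j)" using c by auto
    \<comment> \<open>The successor makes the product over \<open>k < m\<close> contain the factor
      with index \<open>j\<close>, which is 0 on \<open>V (c j)\<close>.\<close>
    define m where "m = Suc j"
    \<comment> \<open>Each \<open>A n\<close> lies in \<open>G (c n)\<close> or misses the support
      \<open>C (c n)\<close>. Only indices below \<open>m\<close> need this, since the later
      functions vanish on \<open>V (c j)\<close>.\<close>
    define A where "A n = (if x \<in> G (c n) then G (c n) else topspace ?X - C (c n))" for n
    have A: "openin ?X (A n)" "x \<in> A n" for n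
    proof -
      have "closedin ?X (C (c n))" "C (c n) \<subseteq> G (c n)" "openin ?X (G (c n))"
        using FC[OF cX[of n]] G[OF cX[of n]] by auto
      then show "openin ?X (A n)" "x \<in> A n" using x by (auto simp: A_def)
    qed
    define S where "S = V (c j) \<inter> (\<Inter>n\<in>{..<m}. A n)"
    have S: "openin ?X S" "x \<in> S"
    proof -
      have "openin ?X (\<Inter>n\<in>{..<m}. A n)"
        by (rule openin_INT2) (auto simp: A m_def)
      then show "openin ?X S" unfolding S_def using FV(1)[OF cX[of j]] by (intro openin_Int)
      show "x \<in> S" using j A by (auto simp: S_def)
    qed
    have z: "(\<Prod>k<n. 1 - F (c k) y) = 0" if "y \<in> S" "n \<ge> m" for y n
    proof -
      have "F (c j) y = 1" using that F1[OF cX[of j]] by (auto simp: S_def)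
      then show ?thesis using that by (intro prod_zero) (auto simp: m_def)
    qed
    have "S \<subseteq> G (c n) \<or> (\<forall>y\<in>S. \<rho> n y = 0)" for n
    proof (cases "n < m")
      case True
      then have "S \<subseteq> A n" by (auto simp: S_def)
      then have "S \<subseteq> G (c n) \<or> S \<inter> C (c n) = {}" by (auto simp: A_def split: if_splits)
      moreover have "\<rho> n y = 0" if "y \<notin> C (c n)" for y by (simp add: \<rho>_def F0[OF cX that])
      ultimately show ?thesis by blast
    next
      case False
      then show ?thesis using z by (auto simp: \<rho>_def)
    qed
    moreover have "\<forall>y\<in>S. (\<forall>n\<ge>m. \<rho> n y = 0) \<and> (\<Sum>n<m. \<rho> n y) = 1"
      unfolding sum using z by (simp add: \<rho>_def)
    ultimately show ?thesis using S by blast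
  qed
  then have "partition_of_unity M \<rho> (\<lambda>n. G (c n))"
    unfolding partition_of_unity_def using nn fs by blast
  then show ?thesis using that cX by blast
qed

subsection \<open>Continuity at a point\<close>

lemma eventually_nhdsin_openin: "openin X S \<Longrightarrow> x \<in> S \<Longrightarrow> \<forall>\<^sub>F y in nhdsin X x. y \<in> S"
  unfolding eventually_nhdsin by blast

lemma continuous_map_filterlim:
  assumes "continuous_map X Y f" "x \<in> topspace X"
  shows "filterlim f (nhdsin Y (f x)) (nhdsin X x)"
  unfolding filterlim_iff
proof (intro allI impI)
  fix P assume "\<forall>\<^sub>F y in nhdsin Y (f x). P y"
  moreover have "f x \<in> topspace Y" using assms continuous_map_image_subset_topspace by blast
  ultimately obtain S where S: "openin Y S" "f x \<in> S" "\<forall>y\<in>S. P y"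
    unfolding eventually_nhdsin by blast
  have "openin X {y \<in> topspace X. f y \<in> S}" by (rule openin_continuous_map_preimage[OF assms(1) S(1)])
  then show "\<forall>\<^sub>F y in nhdsin X x. P (f y)"
    unfolding eventually_nhdsin using S assms(2)
    by (intro disjI2 exI[of _ "{y \<in> topspace X. f y \<in> S}"]) auto
qed

lemma tendsto_imp_continuous_map:
  assumes "\<And>x. x \<in> topspace X \<Longrightarrow> (f \<longlongrightarrow> f x) (nhdsin X x)"
  shows "continuous_map X euclidean f"
  unfolding continuous_map_atin
proof
  fix x assume "x \<in> topspace X"
  then have "(f \<longlongrightarrow> f x) (atin X x)"
    by (intro tendsto_mono[OF _ assms]) (simp_all add: atin_def)
  then show "limitin euclidean f (f x) (atin X x)" by simp
qed

subsection \<open>Uniform step size along a homotopy\<close>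

text \<open>Summing over the indices of nonzero weight gives a value that depends on the point
  alone; the cutoff \<open>m\<close> supplied by a partition of unity is only local.\<close>

definition weighted_sum :: "(nat \<Rightarrow> 'a \<Rightarrow> real) \<Rightarrow> (nat \<Rightarrow> 'v::real_vector) \<Rightarrow> 'a \<Rightarrow> 'v" where
  "weighted_sum \<rho> u x = (\<Sum>n\<in>{n. \<rho> n x \<noteq> 0}. \<rho> n x *\<^sub>R u n)"

lemma weighted_sum_eq:
  fixes m :: nat
  assumes "\<forall>n\<ge>m. \<rho> n x = 0"
  shows "weighted_sum \<rho> u x = (\<Sum>n<m. \<rho> n x *\<^sub>R u n)"
  unfolding weighted_sum_def
proof (rule sum.mono_neutral_left)
  show "{n. \<rho> n x \<noteq> 0} \<subseteq> {..<m}" using assms by (metis (mono_tags) lessThan_iff linorder_not_less mem_Collect_eq subsetI)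
qed auto

lemma partition_of_unityE:
  assumes "partition_of_unity M \<rho> V" "x \<in> topspace (space_of M)"
  obtains S and m :: nat where "openin (space_of M) S" "x \<in> S" "\<forall>n. S \<subseteq> V n \<or> (\<forall>y\<in>S. \<rho> n y = 0)"
    "\<forall>y\<in>S. \<forall>n\<ge>m. \<rho> n y = 0" "\<forall>y\<in>S. (\<Sum>n<m. \<rho> n y) = 1"
proof -
  obtain S and m :: nat where S: "openin (space_of M) S" "x \<in> S" "\<forall>n. S \<subseteq> V n \<or> (\<forall>y\<in>S. \<rho> n y = 0)"
    "\<forall>y\<in>S. (\<forall>n\<ge>m. \<rho> n y = 0) \<and> (\<Sum>n<m. \<rho> n y) = 1"
    using assms unfolding partition_of_unity_def by meson
  show thesis by (rule that[OF S(1-3)]) (use S(4) in auto)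
qed

lemma partition_of_unity_nonneg: "partition_of_unity M \<rho> V \<Longrightarrow> 0 \<le> \<rho> n x"
  unfolding partition_of_unity_def by blast

lemma partition_of_unity_fsmooth:
  "partition_of_unity M \<rho> V \<Longrightarrow> x \<in> topspace (space_of M) \<Longrightarrow> fsmooth M (\<rho> n) x"
  unfolding partition_of_unity_def by blast

text \<open>The tube lemma combined with a Lebesgue number. Finitely many boxes, each mapped by
  \<open>h\<close> into one member of the cover, contain the segment over \<open>p\<close>; the
  intersection of their bases is the neighbourhood. The Lebesgue number \<open>e\<close> is halved
  because the time difference is bounded by a weak inequality while the balls are open.\<close>

lemma homotopy_local_step_size:
  assumes h: "continuous_map (prod_topology (top_of_set {0..1::real}) X) X h"
    and cover: "\<And>y. y \<in> topspace X \<Longrightarrow> \<exists>W\<in>\<W>. openin X W \<and> y \<in> W"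
    and p: "p \<in> topspace X"
  shows "\<exists>B e. openin X B \<and> p \<in> B \<and> e > 0 \<and>
    (\<forall>x\<in>B. \<forall>s\<in>{0..1}. \<forall>t\<in>{0..1}. \<bar>s - t\<bar> \<le> e \<longrightarrow> (\<exists>W\<in>\<W>. h (s, x) \<in> W \<and> h (t, x) \<in> W))"
proof -
  have "\<forall>t\<in>{0..1}. \<exists>A B W. open A \<and> t \<in> A \<and> openin X B \<and> p \<in> B \<and> W \<in> \<W> \<and>
    (\<forall>s\<in>A \<inter> {0..1}. \<forall>x\<in>B. h (s, x) \<in> W)"
  proof
    fix t :: real assume t: "t \<in> {0..1}"
    have "h (t, p) \<in> topspace X"
      using continuous_map_image_subset_topspace[OF h] t p by auto
    then obtain W where W: "W \<in> \<W>" "openin X W" "h (t, p) \<in> W" using cover by blast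
    define P where "P = {z \<in> topspace (prod_topology (top_of_set {0..1::real}) X). h z \<in> W}"
    have "openin (prod_topology (top_of_set {0..1::real}) X) P"
      unfolding P_def by (rule openin_continuous_map_preimage[OF h W(2)])
    moreover have "(t, p) \<in> P" using t p W by (simp add: P_def)
    ultimately obtain A B where AB: "openin (top_of_set {0..1::real}) A" "openin X B" "t \<in> A" "p \<in> B" "A \<times> B \<subseteq> P"
      unfolding openin_prod_topology_alt by meson
    obtain A' where A': "open A'" "A = {0..1} \<inter> A'" using AB(1) by (auto simp: openin_open)
    have "h (s, x) \<in> W" if "s \<in> A' \<inter> {0..1}" "x \<in> B" for s x
    proof -
      have "(s, x) \<in> P" using that AB(5) A'(2) by blast
      then show ?thesis by (simp add: P_def)
    qed
    then show "\<exists>A B W. open A \<and> t \<in> A \<and> openin X B \<and> p \<in> B \<and> W \<in> \<W> \<and> (\<forall>s\<in>A \<inter> {0..1}. \<forall>x\<in>B. h (s, x) \<in> W)"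
      using A' AB W by (intro exI[of _ A'] exI[of _ B] exI[of _ W]) auto
  qed
  then obtain A B W where ABW: "\<forall>t\<in>{0..1::real}. open (A t) \<and> t \<in> A t \<and> openin X (B t) \<and> p \<in> B t \<and> W t \<in> \<W> \<and>
    (\<forall>s\<in>A t \<inter> {0..1}. \<forall>x\<in>B t. h (s, x) \<in> W t)"
    unfolding bchoice_iff by blast
  obtain D where D: "D \<subseteq> {0..1}" "finite D" "{0..1} \<subseteq> (\<Union>t\<in>D. A t)"
    by (rule compactE_image[OF compact_Icc, of "{0..1}" A]) (use ABW in auto)
  obtain e where e: "e > 0" "\<And>x. x \<in> {0..1} \<Longrightarrow> \<exists>G\<in>A ` D. ball x e \<subseteq> G"
    using Heine_Borel_lemma[OF compact_Icc, of 0 1 "A ` D"] D ABW by blast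
  have "D \<noteq> {}" using D(3) by force
  have "\<exists>W\<in>\<W>. h (s, x) \<in> W \<and> h (t, x) \<in> W"
    if x: "x \<in> (\<Inter>t\<in>D. B t)" and s: "s \<in> {0..1}" and t: "t \<in> {0..1}" and st: "\<bar>s - t\<bar> \<le> e / 2" for x s t
  proof -
    obtain d where d: "d \<in> D" "ball s e \<subseteq> A d" using e(2)[OF s] by blast
    have "s \<in> ball s e" "t \<in> ball s e" using st e(1) by (auto simp: dist_real_def)
    then have "s \<in> A d" "t \<in> A d" using d by blast+
    moreover have "x \<in> B d" "d \<in> {0..1}" using x d D by blast+
    ultimately have "h (s, x) \<in> W d" "h (t, x) \<in> W d" "W d \<in> \<W>" using ABW s t by blast+
    then show ?thesis by blast
  qed
  moreover have "openin X (\<Inter>t\<in>D. B t)"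
    by (rule openin_INT2) (use D ABW \<open>D \<noteq> {}\<close> in auto)
  moreover have "p \<in> (\<Inter>t\<in>D. B t)" using D ABW by blast
  ultimately show ?thesis using e(1)
    by (intro exI[of _ "\<Inter>t\<in>D. B t"] exI[of _ "e / 2"]) auto
qed

text \<open>Averaging the local step sizes makes the result continuous, as the maps
  \<open>G n\<close> built from it have to be. The average remains admissible at \<open>x\<close>
  because it is at most one of the averaged values whose neighbourhood contains \<open>x\<close>,
  and a smaller step inherits the property.\<close>

lemma homotopy_step_size:
  fixes M :: "('a, 'e::euclidean_space) charted_space"
  assumes mf: "smooth_manifold M"
    and h: "continuous_map (prod_topology (top_of_set {0..1::real}) (space_of M)) (space_of M) h"
    and cover: "\<And>y. y \<in> topspace (space_of M) \<Longrightarrow> \<exists>W\<in>\<W>. openin (space_of M) W \<and> y \<in> W"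
  obtains \<delta> :: "'a \<Rightarrow> real"
  where "\<forall>x\<in>topspace (space_of M). (\<delta> \<longlongrightarrow> \<delta> x) (nhdsin (space_of M) x) \<and> 0 < \<delta> x"
    "\<forall>x\<in>topspace (space_of M). \<forall>s\<in>{0..1}. \<forall>t\<in>{0..1}. \<bar>s - t\<bar> \<le> \<delta> x \<longrightarrow> (\<exists>W\<in>\<W>. h (s, x) \<in> W \<and> h (t, x) \<in> W)"
proof -
  let ?X = "space_of M"
  have M: "smooth_atlas M" by (rule smooth_manifold_imp_smooth_atlas[OF mf])
  have "\<forall>p\<in>topspace ?X. \<exists>B e. openin ?X B \<and> p \<in> B \<and> e > 0 \<and>
    (\<forall>x\<in>B. \<forall>s\<in>{0..1}. \<forall>t\<in>{0..1}. \<bar>s - t\<bar> \<le> e \<longrightarrow> (\<exists>W\<in>\<W>. h (s, x) \<in> W \<and> h (t, x) \<in> W))"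
    using homotopy_local_step_size[OF h cover] by blast
  then obtain B e where "\<forall>p\<in>topspace ?X. openin ?X (B p) \<and> p \<in> B p \<and> e p > 0 \<and>
    (\<forall>x\<in>B p. \<forall>s\<in>{0..1}. \<forall>t\<in>{0..1}. \<bar>s - t\<bar> \<le> e p \<longrightarrow> (\<exists>W\<in>\<W>. h (s, x) \<in> W \<and> h (t, x) \<in> W))"
    unfolding bchoice_iff by blast
  then have B: "openin ?X (B p) \<and> p \<in> B p" and e: "e p > 0"
    and st: "x \<in> B p \<Longrightarrow> s \<in> {0..1} \<Longrightarrow> t \<in> {0..1} \<Longrightarrow> \<bar>s - t\<bar> \<le> e p \<Longrightarrow> \<exists>W\<in>\<W>. h (s, x) \<in> W \<and> h (t, x) \<in> W"
    if "p \<in> topspace ?X" for p x s t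
    using that by blast+
  obtain \<rho> c where pou: "partition_of_unity M \<rho> (\<lambda>n. B (c n))"
    and c: "topspace ?X \<noteq> {} \<longrightarrow> range c \<subseteq> topspace ?X"
    by (rule partition_of_unity_exists[OF mf B])
  define \<delta> where "\<delta> = weighted_sum \<rho> (\<lambda>n. e (c n))"
  have "(\<delta> \<longlongrightarrow> \<delta> x) (nhdsin ?X x) \<and> 0 < \<delta> x" and
    "s \<in> {0..1} \<Longrightarrow> t \<in> {0..1} \<Longrightarrow> \<bar>s - t\<bar> \<le> \<delta> x \<Longrightarrow> \<exists>W\<in>\<W>. h (s, x) \<in> W \<and> h (t, x) \<in> W"
    if x: "x \<in> topspace ?X" for x s t
  proof -
    have cX: "c n \<in> topspace ?X" for n using c x by blast
    obtain S m where S: "openin ?X S" "x \<in> S" "\<forall>n. S \<subseteq> B (c n) \<or> (\<forall>y\<in>S. \<rho> n y = 0)"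
      "\<forall>y\<in>S. \<forall>n\<ge>m. \<rho> n y = 0" "\<forall>y\<in>S. (\<Sum>n<m. \<rho> n y) = 1"
      by (rule partition_of_unityE[OF pou x])
    have \<delta>: "\<delta> y = (\<Sum>n<m. \<rho> n y *\<^sub>R e (c n))" if "y \<in> S" for y
      unfolding \<delta>_def by (rule weighted_sum_eq) (use S(4) that in blast)
    have "((\<lambda>y. \<Sum>n<m. \<rho> n y *\<^sub>R e (c n)) \<longlongrightarrow> (\<Sum>n<m. \<rho> n x *\<^sub>R e (c n))) (nhdsin ?X x)"
      by (intro tendsto_sum tendsto_scaleR tendsto_const fsmooth_tendsto[OF M partition_of_unity_fsmooth[OF pou x]])
    moreover have "\<forall>\<^sub>F y in nhdsin ?X x. (\<Sum>n<m. \<rho> n y *\<^sub>R e (c n)) = \<delta> y"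
      using eventually_nhdsin_openin[OF S(1,2)] by eventually_elim (simp add: \<delta>)
    ultimately have lim: "(\<delta> \<longlongrightarrow> \<delta> x) (nhdsin ?X x)"
      unfolding \<delta>[OF S(2)] by (rule Lim_transform_eventually)
    have sum1: "(\<Sum>n<m. \<rho> n x) = 1" using S by blast
    note nn = partition_of_unity_nonneg[OF pou]
    have "\<exists>n<m. \<rho> n x \<noteq> 0"
      using sum1 by (metis lessThan_iff sum.neutral zero_neq_one)
    then obtain k where k: "k < m" "\<rho> k x \<noteq> 0" by blast
    have pos: "0 < \<delta> x"
      unfolding \<delta>[OF S(2)]
    proof (rule sum_pos2[of _ k])
      show "0 < \<rho> k x *\<^sub>R e (c k)" using k(2) nn[of k x] e[OF cX[of k]] by simp
      show "0 \<le> \<rho> n x *\<^sub>R e (c n)" for n using nn[of n x] e[OF cX[of n]] by simp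
    qed (use k in auto)
    show "(\<delta> \<longlongrightarrow> \<delta> x) (nhdsin ?X x) \<and> 0 < \<delta> x" using lim pos by blast
    text \<open>A convex combination does not exceed all of its members.\<close>
    have "\<exists>n<m. \<rho> n x \<noteq> 0 \<and> \<delta> x \<le> e (c n)"
    proof (rule ccontr)
      assume "\<not> (\<exists>n<m. \<rho> n x \<noteq> 0 \<and> \<delta> x \<le> e (c n))"
      then have less: "e (c n) < \<delta> x" if "n < m" "\<rho> n x \<noteq> 0" for n using that by force
      have "(\<Sum>n<m. \<rho> n x *\<^sub>R e (c n)) < (\<Sum>n<m. \<rho> n x *\<^sub>R \<delta> x)"
      proof (rule sum_strict_mono_ex1)
        show "\<forall>n\<in>{..<m}. \<rho> n x *\<^sub>R e (c n) \<le> \<rho> n x *\<^sub>R \<delta> x"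
        proof
          fix n assume "n \<in> {..<m}"
          then show "\<rho> n x *\<^sub>R e (c n) \<le> \<rho> n x *\<^sub>R \<delta> x"
            using less[of n] mult_left_mono[OF less_imp_le nn, of "e (c n)" "\<delta> x" n x]
            by (cases "\<rho> n x = 0") simp_all
        qed
        have "0 < \<rho> k x" using k nn[of k x] by simp
        then show "\<exists>n\<in>{..<m}. \<rho> n x *\<^sub>R e (c n) < \<rho> n x *\<^sub>R \<delta> x"
          using k(1) less[OF k] by (intro bexI[of _ k]) simp_all
      qed simp
      also have "\<dots> = \<delta> x" using sum1 by (simp flip: sum_distrib_right)
      finally show False unfolding \<delta>[OF S(2)] by simp
    qed
    then obtain n where n: "\<rho> n x \<noteq> 0" "\<delta> x \<le> e (c n)" by blast
    have xB: "x \<in> B (c n)" using n(1) S(2,3) by blast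
    show "\<exists>W\<in>\<W>. h (s, x) \<in> W \<and> h (t, x) \<in> W"
      if "s \<in> {0..1}" "t \<in> {0..1}" "\<bar>s - t\<bar> \<le> \<delta> x"
      by (rule st[OF cX xB that(1,2)]) (use that(3) n(2) in linarith)
  qed
  note \<delta> = this
  show thesis
  proof (rule that[of \<delta>])
    show "\<forall>x\<in>topspace ?X. (\<delta> \<longlongrightarrow> \<delta> x) (nhdsin ?X x) \<and> 0 < \<delta> x" using \<delta>(1) by (rule ballI)
    show "\<forall>x\<in>topspace ?X. \<forall>s\<in>{0..1}. \<forall>t\<in>{0..1}. \<bar>s - t\<bar> \<le> \<delta> x \<longrightarrow> (\<exists>W\<in>\<W>. h (s, x) \<in> W \<and> h (t, x) \<in> W)"
      by (intro ballI impI) (rule \<delta>(2))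
  qed
qed

subsection \<open>Trivialising cocycles of linear maps\<close>

text \<open>Trivialisations are indexed by points of the base, each point having its own, so
  \<open>U_mem\<close> selects one without a separate index set. The inverse of
  \<open>g i j x\<close> is \<open>g j i x\<close>, by \<open>g_trans\<close> and
  \<open>g_refl\<close>.\<close>

locale linear_cocycle =
  fixes M :: "('a, 'e::euclidean_space) charted_space"
    and U :: "'a \<Rightarrow> 'a set"
    and g :: "'a \<Rightarrow> 'a \<Rightarrow> 'a \<Rightarrow> ('f::euclidean_space \<Rightarrow>\<^sub>L 'f)"
    and F :: "'f set"
  assumes mf: "smooth_manifold M"
    and subF: "subspace F"
    and U_open: "openin (space_of M) (U i)"
    and U_mem: "p \<in> topspace (space_of M) \<Longrightarrow> p \<in> U p"
    and g_fsmooth: "x \<in> U i \<Longrightarrow> x \<in> U j \<Longrightarrow> fsmooth M (g i j) x"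
    and g_refl: "x \<in> U i \<Longrightarrow> g i i x = id_blinfun"
    and g_trans: "x \<in> U i \<Longrightarrow> x \<in> U j \<Longrightarrow> x \<in> U k \<Longrightarrow> g i j x o\<^sub>L g j k x = g i k x"
    and g_F: "x \<in> U i \<Longrightarrow> x \<in> U j \<Longrightarrow> v \<in> F \<Longrightarrow> g i j x v \<in> F"
begin

lemma M: "smooth_atlas M"
  by (rule smooth_manifold_imp_smooth_atlas[OF mf])

lemma U_topspace: "x \<in> U i \<Longrightarrow> x \<in> topspace (space_of M)"
  using U_open openin_subset by blast

lemma g_trans_apply: "x \<in> U i \<Longrightarrow> x \<in> U j \<Longrightarrow> x \<in> U k \<Longrightarrow> g i j x (g j k x v) = g i k x v"
  using g_trans by (metis blinfun_apply_blinfun_compose)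

lemma g_inj: "x \<in> U i \<Longrightarrow> x \<in> U j \<Longrightarrow> inj (blinfun_apply (g i j x))"
  by (rule injI) (metis g_trans_apply g_refl blinfun_apply_id_blinfun)

text \<open>\<open>\<Omega> i x\<close> is a coordinate expression, in the \<open>i\<close>-th trivialisation, of a linear isomorphism from
  the fibre over \<open>f x\<close> to a fixed vector space, so that the family trivialises the pullback along \<open>f\<close>.\<close>

definition trivialises :: "('a \<Rightarrow> 'a) \<Rightarrow> ('a \<Rightarrow> 'a \<Rightarrow> ('f \<Rightarrow>\<^sub>L 'f)) \<Rightarrow> bool" where
  "trivialises f \<Omega> \<longleftrightarrow>
     (\<forall>i. \<forall>x\<in>topspace (space_of M). f x \<in> U i \<longrightarrow>
        (\<Omega> i \<longlongrightarrow> \<Omega> i x) (nhdsin (space_of M) x) \<and> inj (blinfun_apply (\<Omega> i x)) \<and> (\<forall>v\<in>F. \<Omega> i x v \<in> F)) \<and>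
     (\<forall>i j. \<forall>x\<in>topspace (space_of M). f x \<in> U i \<longrightarrow> f x \<in> U j \<longrightarrow> \<Omega> j x o\<^sub>L g j i (f x) = \<Omega> i x)"

lemma trivialisesD:
  assumes "trivialises f \<Omega>" "x \<in> topspace (space_of M)" "f x \<in> U i"
  shows "(\<Omega> i \<longlongrightarrow> \<Omega> i x) (nhdsin (space_of M) x)" "inj (blinfun_apply (\<Omega> i x))" "v \<in> F \<Longrightarrow> \<Omega> i x v \<in> F"
    "f x \<in> U j \<Longrightarrow> \<Omega> j x o\<^sub>L g j i (f x) = \<Omega> i x"
  using assms unfolding trivialises_def by auto

section \<open>Transporting a trivialisation between nearby maps\<close>

context
  fixes \<rho> c
  assumes pou: "partition_of_unity M \<rho> (\<lambda>n. U (c n))"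
begin

text \<open>On a good set, transporting through any of the trivialisations used by \<open>\<rho>\<close> is close to the
  identity, so that convex combinations of these transports remain invertible.\<close>

definition good :: "'a set \<Rightarrow> bool" where
  "good W \<longleftrightarrow> (\<exists>m::nat. \<forall>y\<in>W. (\<forall>n\<ge>m. \<rho> n y = 0) \<and> (\<Sum>n<m. \<rho> n y) = 1) \<and>
     (\<forall>n. W \<subseteq> U (c n) \<or> (\<forall>y\<in>W. \<rho> n y = 0)) \<and>
     (\<exists>j. W \<subseteq> U j \<and> (\<forall>n. (\<forall>y\<in>W. \<rho> n y = 0) \<or>
        (\<forall>y\<in>W. \<forall>y'\<in>W. norm ((g j (c n) y o\<^sub>L g (c n) j y') - id_blinfun) \<le> 1 / 2)))"

text \<open>At \<open>x\<close> itself the product of the two transition maps is the identity by the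
  cocycle rule, so continuity gives the estimate nearby; any bound below 1 would serve. The two
  transition maps are evaluated at independent points because one will be \<open>f x\<close> and the
  other \<open>f' x\<close>. Only finitely many indices carry weight, so finitely many
  neighbourhoods are intersected.\<close>

lemma good_cover:
  assumes x: "x \<in> topspace (space_of M)"
  shows "\<exists>W. openin (space_of M) W \<and> x \<in> W \<and> good W"
proof -
  let ?X = "space_of M"
  obtain S and m :: nat where S: "openin ?X S" "x \<in> S" "\<forall>n. S \<subseteq> U (c n) \<or> (\<forall>y\<in>S. \<rho> n y = 0)"
    "\<forall>y\<in>S. \<forall>n\<ge>m. \<rho> n y = 0" "\<forall>y\<in>S. (\<Sum>n<m. \<rho> n y) = 1"
    by (rule partition_of_unityE[OF pou x])
  have xx: "x \<in> U x" by (rule U_mem[OF x])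
  have near: "\<exists>N. openin ?X N \<and> x \<in> N \<and>
      (\<forall>y\<in>N. \<forall>y'\<in>N. norm ((g x (c n) y o\<^sub>L g (c n) x y') - id_blinfun) \<le> 1 / 2)" if n: "x \<in> U (c n)" for n
  proof -
    \<comment> \<open>The product filter treats the two evaluation points as independent variables;
      \<open>eventually_prod_same\<close> then yields one neighbourhood for both.\<close>
    let ?N = "nhdsin ?X x"
    have l1: "((\<lambda>z. g x (c n) (fst z)) \<longlongrightarrow> g x (c n) x) (?N \<times>\<^sub>F ?N)"
      by (rule filterlim_compose[OF fsmooth_tendsto[OF M g_fsmooth[OF xx n]] filterlim_fst])
    have l2: "((\<lambda>z. g (c n) x (snd z)) \<longlongrightarrow> g (c n) x x) (?N \<times>\<^sub>F ?N)"
      by (rule filterlim_compose[OF fsmooth_tendsto[OF M g_fsmooth[OF n xx]] filterlim_snd])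
    have "((\<lambda>z. norm ((g x (c n) (fst z) o\<^sub>L g (c n) x (snd z)) - id_blinfun)) \<longlongrightarrow>
        norm ((g x (c n) x o\<^sub>L g (c n) x x) - id_blinfun)) (?N \<times>\<^sub>F ?N)"
      by (rule tendsto_norm[OF tendsto_diff[OF bounded_bilinear.tendsto[OF bounded_bilinear_blinfun_compose l1 l2] tendsto_const]])
    then have "((\<lambda>z. norm ((g x (c n) (fst z) o\<^sub>L g (c n) x (snd z)) - id_blinfun)) \<longlongrightarrow> 0) (?N \<times>\<^sub>F ?N)"
      by (simp add: g_trans[OF xx n xx] g_refl[OF xx])
    then have "\<forall>\<^sub>F z in ?N \<times>\<^sub>F ?N. norm ((g x (c n) (fst z) o\<^sub>L g (c n) x (snd z)) - id_blinfun) < 1 / 2"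
      by (rule order_tendstoD(2)) simp
    then obtain Q where Q: "eventually Q ?N"
      "\<forall>y y'. Q y \<longrightarrow> Q y' \<longrightarrow> norm ((g x (c n) y o\<^sub>L g (c n) x y') - id_blinfun) < 1 / 2"
      unfolding eventually_prod_same by auto
    then obtain N where "openin ?X N" "x \<in> N" "\<forall>y\<in>N. Q y"
      using x unfolding eventually_nhdsin by auto
    then show ?thesis using Q(2) by (intro exI[of _ N]) (auto intro: less_imp_le)
  qed
  have "\<forall>n. \<exists>N. openin ?X N \<and> x \<in> N \<and> (x \<in> U (c n) \<longrightarrow>
      (\<forall>y\<in>N. \<forall>y'\<in>N. norm ((g x (c n) y o\<^sub>L g (c n) x y') - id_blinfun) \<le> 1 / 2))"
    using near x openin_topspace by metis
  then obtain N where N: "\<forall>n. openin ?X (N n) \<and> x \<in> N n \<and> (x \<in> U (c n) \<longrightarrow>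
      (\<forall>y\<in>N n. \<forall>y'\<in>N n. norm ((g x (c n) y o\<^sub>L g (c n) x y') - id_blinfun) \<le> 1 / 2))"
    unfolding choice_iff by blast
  \<comment> \<open>The range includes \<open>m\<close> so that the intersection is over a nonempty
    index set even when \<open>m\<close> is 0.\<close>
  define W where "W = S \<inter> U x \<inter> (\<Inter>n\<in>{..m}. N n)"
  have "openin ?X (\<Inter>n\<in>{..m}. N n)" by (rule openin_INT2) (use N in auto)
  then have W: "openin ?X W" unfolding W_def using S(1) U_open by (intro openin_Int)
  have xW: "x \<in> W" using S(2) xx N by (auto simp: W_def)
  have WS: "W \<subseteq> S" "W \<subseteq> U x" by (auto simp: W_def)
  have cl: "(\<forall>y\<in>W. \<rho> n y = 0) \<or>
        (\<forall>y\<in>W. \<forall>y'\<in>W. norm ((g x (c n) y o\<^sub>L g (c n) x y') - id_blinfun) \<le> 1 / 2)" for n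
  proof (cases "n < m \<and> x \<in> U (c n)")
    case True
    then have "W \<subseteq> N n" by (auto simp: W_def)
    then show ?thesis using N True by (meson subsetD)
  next
    case False
    then have "\<forall>y\<in>S. \<rho> n y = 0" using S(2-4) by (meson linorder_not_less subsetD)
    then show ?thesis using WS by blast
  qed
  have "\<forall>y\<in>W. (\<forall>n\<ge>m. \<rho> n y = 0) \<and> (\<Sum>n<m. \<rho> n y) = 1" using S(4,5) WS(1) by blast
  moreover have "\<forall>n. W \<subseteq> U (c n) \<or> (\<forall>y\<in>W. \<rho> n y = 0)"
  proof
    fix n
    show "W \<subseteq> U (c n) \<or> (\<forall>y\<in>W. \<rho> n y = 0)" using spec[OF S(3), of n] WS(1) by blast
  qed
  ultimately have "good W" unfolding good_def using cl WS(2) by blast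
  then show ?thesis using W xW by blast
qed

text \<open>The \<open>n\<close>-th term sends a vector over \<open>f' x\<close> to the vector over
  \<open>f x\<close> with the same coordinates in the trivialisation \<open>c n\<close>, and then
  applies the given isomorphism over \<open>f x\<close>. The weights are those at
  \<open>f' x\<close>.\<close>

definition transported :: "('a \<Rightarrow> 'a) \<Rightarrow> ('a \<Rightarrow> 'a \<Rightarrow> ('f \<Rightarrow>\<^sub>L 'f)) \<Rightarrow> 'a \<Rightarrow> 'a \<Rightarrow> ('f \<Rightarrow>\<^sub>L 'f)" where
  "transported f' \<Omega> i x = weighted_sum \<rho> (\<lambda>n. \<Omega> (c n) x o\<^sub>L g (c n) i (f' x)) (f' x)"

context
  fixes f f' \<Omega>
  assumes f: "continuous_map (space_of M) (space_of M) f"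
    and f': "continuous_map (space_of M) (space_of M) f'"
    and near: "\<forall>x\<in>topspace (space_of M). \<exists>W. openin (space_of M) W \<and> good W \<and> f x \<in> W \<and> f' x \<in> W"
    and triv: "trivialises f \<Omega>"
begin

text \<open>Every summand of nonzero weight satisfies the relation by the cocycle rule at
  \<open>f' x\<close>, so the sum does.\<close>

lemma transported_compat:
  assumes x: "x \<in> topspace (space_of M)" and i: "f' x \<in> U i" and j: "f' x \<in> U j"
  shows "transported f' \<Omega> j x o\<^sub>L g j i (f' x) = transported f' \<Omega> i x"
proof -
  have "f' x \<in> topspace (space_of M)" using U_topspace[OF i] .
  then obtain S and m :: nat where S: "f' x \<in> S" "\<forall>n. S \<subseteq> U (c n) \<or> (\<forall>y\<in>S. \<rho> n y = 0)"
    "\<forall>y\<in>S. \<forall>n\<ge>m. \<rho> n y = 0"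
    using partition_of_unityE[OF pou] by metis
  have eq: "transported f' \<Omega> k x = (\<Sum>n<m. \<rho> n (f' x) *\<^sub>R (\<Omega> (c n) x o\<^sub>L g (c n) k (f' x)))" for k
    unfolding transported_def by (rule weighted_sum_eq) (use S in blast)
  show ?thesis
  proof (rule blinfun_eqI)
    fix v
    have "\<rho> n (f' x) *\<^sub>R \<Omega> (c n) x (g (c n) j (f' x) (g j i (f' x) v)) = \<rho> n (f' x) *\<^sub>R \<Omega> (c n) x (g (c n) i (f' x) v)" for n
    proof (cases "f' x \<in> U (c n)")
      case True
      then show ?thesis by (simp add: g_trans_apply[OF True j i])
    next
      case False
      then have "\<rho> n (f' x) = 0" using S by blast
      then show ?thesis by simp
    qed
    then have "(\<Sum>n<m. \<rho> n (f' x) *\<^sub>R \<Omega> (c n) x (g (c n) j (f' x) (g j i (f' x) v)))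
      = (\<Sum>n<m. \<rho> n (f' x) *\<^sub>R \<Omega> (c n) x (g (c n) i (f' x) v))" by (intro sum.cong refl)
    then show "(transported f' \<Omega> j x o\<^sub>L g j i (f' x)) v = transported f' \<Omega> i x v"
      unfolding eq by (simp add: blinfun.sum_left blinfun.scaleR_left)
  qed
qed

text \<open>The trivialisation \<open>j\<close> attached to a good set contains both points, so
  every \<open>\<Omega> (c n) x\<close> of nonzero weight can be rewritten through
  \<open>\<Omega> j x\<close>, which then factors out of the sum. What remains is a convex
  combination \<open>B\<close> of operators close to the identity.\<close>

lemma transported_eq:
  assumes x: "x \<in> topspace (space_of M)" and W: "good W" "f x \<in> W" "f' x \<in> W"
  obtains j where "f x \<in> U j" "f' x \<in> U j"
    "\<exists>B. transported f' \<Omega> j x = \<Omega> j x o\<^sub>L B \<and> (\<forall>v. norm (B v - v) \<le> norm v / 2)"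
proof -
  obtain m :: nat where m: "\<forall>y\<in>W. (\<forall>n\<ge>m. \<rho> n y = 0) \<and> (\<Sum>n<m. \<rho> n y) = 1"
    using W(1) unfolding good_def by blast
  have Wn: "W \<subseteq> U (c n) \<or> (\<forall>y\<in>W. \<rho> n y = 0)" for n using W(1) unfolding good_def by blast
  obtain j where j: "W \<subseteq> U j" "\<forall>n. (\<forall>y\<in>W. \<rho> n y = 0) \<or>
        (\<forall>y\<in>W. \<forall>y'\<in>W. norm ((g j (c n) y o\<^sub>L g (c n) j y') - id_blinfun) \<le> 1 / 2)"
    using W(1) unfolding good_def by blast
  have fj: "f x \<in> U j" "f' x \<in> U j" using j(1) W by blast+
  define B where "B = (\<Sum>n<m. \<rho> n (f' x) *\<^sub>R (g j (c n) (f x) o\<^sub>L g (c n) j (f' x)))"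
  have eq: "transported f' \<Omega> j x = (\<Sum>n<m. \<rho> n (f' x) *\<^sub>R (\<Omega> (c n) x o\<^sub>L g (c n) j (f' x)))"
    unfolding transported_def by (rule weighted_sum_eq) (use m W in blast)
  have "transported f' \<Omega> j x = \<Omega> j x o\<^sub>L B"
  proof (rule blinfun_eqI)
    fix v
    have "\<rho> n (f' x) *\<^sub>R \<Omega> (c n) x (g (c n) j (f' x) v)
      = \<rho> n (f' x) *\<^sub>R \<Omega> j x (g j (c n) (f x) (g (c n) j (f' x) v))" for n
    proof (cases "f x \<in> U (c n)")
      case True
      from trivialisesD(4)[OF triv x True fj(1)]
      have "\<Omega> j x (g j (c n) (f x) w) = \<Omega> (c n) x w" for w by (metis blinfun_apply_blinfun_compose)
      then show ?thesis by simp
    next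
      case False
      then have "\<rho> n (f' x) = 0" using Wn[of n] W by blast
      then show ?thesis by simp
    qed
    then have "(\<Sum>n<m. \<rho> n (f' x) *\<^sub>R \<Omega> (c n) x (g (c n) j (f' x) v))
      = (\<Sum>n<m. \<rho> n (f' x) *\<^sub>R \<Omega> j x (g j (c n) (f x) (g (c n) j (f' x) v)))" by (intro sum.cong refl)
    then show "transported f' \<Omega> j x v = (\<Omega> j x o\<^sub>L B) v"
      unfolding eq B_def by (simp add: blinfun.sum_left blinfun.scaleR_left blinfun.sum_right blinfun.scaleR_right)
  qed
  moreover have "norm (B v - v) \<le> norm v / 2" for v
  proof -
    let ?d = "\<lambda>n. (g j (c n) (f x) o\<^sub>L g (c n) j (f' x)) - id_blinfun"
    have s1: "(\<Sum>n<m. \<rho> n (f' x)) = 1" using m W by blast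
    have "B v - v = (\<Sum>n<m. \<rho> n (f' x) *\<^sub>R ((g j (c n) (f x) o\<^sub>L g (c n) j (f' x)) v)) - (\<Sum>n<m. \<rho> n (f' x)) *\<^sub>R v"
      by (simp add: s1 B_def blinfun.sum_left blinfun.scaleR_left)
    also have "\<dots> = (\<Sum>n<m. \<rho> n (f' x) *\<^sub>R ?d n v)"
      by (simp add: scaleR_sum_left sum_subtractf blinfun.diff_left scaleR_diff_right)
    also have "norm \<dots> \<le> (\<Sum>n<m. \<rho> n (f' x) * (norm v / 2))"
    proof (rule sum_norm_le)
      fix n
      show "norm (\<rho> n (f' x) *\<^sub>R ?d n v) \<le> \<rho> n (f' x) * (norm v / 2)"
      proof (cases "\<rho> n (f' x) = 0")
        case False
        then have "norm (?d n) \<le> 1 / 2" using j(2) W by blast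
        then have "norm (?d n v) \<le> norm v / 2"
          using norm_blinfun[of "?d n" v] mult_right_mono[of "norm (?d n)" "1 / 2" "norm v"] by simp
        then show ?thesis
          unfolding norm_scaleR abs_of_nonneg[OF partition_of_unity_nonneg[OF pou]]
          by (rule mult_left_mono[OF _ partition_of_unity_nonneg[OF pou]])
      qed simp
    qed
    also have "\<dots> = norm v / 2" by (simp only: s1 mult_1_left flip: sum_distrib_right)
    finally show ?thesis .
  qed
  ultimately show thesis using fj by (intro that[of j]) auto
qed

text \<open>The estimate is available only in the trivialisation \<open>j\<close> of the good set;
  compatibility and injectivity of the transition map carry the conclusion over to
  \<open>i\<close>.\<close>

lemma transported_inj:
  assumes x: "x \<in> topspace (space_of M)" and i: "f' x \<in> U i"
  shows "inj (blinfun_apply (transported f' \<Omega> i x))"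
proof -
  obtain W where W: "good W" "f x \<in> W" "f' x \<in> W" using near x by blast
  obtain j where j: "f x \<in> U j" "f' x \<in> U j"
    and "\<exists>B. transported f' \<Omega> j x = \<Omega> j x o\<^sub>L B \<and> (\<forall>v. norm (B v - v) \<le> norm v / 2)"
    by (rule transported_eq[OF x W])
  then obtain B where B: "transported f' \<Omega> j x = \<Omega> j x o\<^sub>L B" "\<forall>v. norm (B v - v) \<le> norm v / 2"
    by blast
  show ?thesis
  proof (rule blinfun_injI)
    fix v assume "transported f' \<Omega> i x v = 0"
    then have "\<Omega> j x (B (g j i (f' x) v)) = 0"
      unfolding transported_compat[OF x i j(2), symmetric] B(1) by simp
    then have "B (g j i (f' x) v) = 0" by (rule blinfun_injD[OF trivialisesD(2)[OF triv x j(1)]])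
    then have "norm (g j i (f' x) v) \<le> norm (g j i (f' x) v) / 2" using spec[OF B(2), of "g j i (f' x) v"] by simp
    then have "g j i (f' x) v = 0" by simp
    then show "v = 0" by (rule blinfun_injD[OF g_inj[OF j(2) i]])
  qed
qed

text \<open>Where the two maps agree all summands coincide by compatibility of
  \<open>\<Omega>\<close>, and the weights add up to 1. This freezes the construction at points
  where the identity has been reached.\<close>

lemma transported_stationary:
  assumes x: "x \<in> topspace (space_of M)" and i: "f x \<in> U i" and eq: "f' x = f x"
  shows "transported f' \<Omega> i x = \<Omega> i x"
proof -
  have "f x \<in> topspace (space_of M)" using U_topspace[OF i] .
  then obtain S and m :: nat where S: "f x \<in> S" "\<forall>n. S \<subseteq> U (c n) \<or> (\<forall>y\<in>S. \<rho> n y = 0)"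
    "\<forall>y\<in>S. \<forall>n\<ge>m. \<rho> n y = 0" "\<forall>y\<in>S. (\<Sum>n<m. \<rho> n y) = 1"
    using partition_of_unityE[OF pou] by metis
  have "transported f' \<Omega> i x = (\<Sum>n<m. \<rho> n (f x) *\<^sub>R (\<Omega> (c n) x o\<^sub>L g (c n) i (f x)))"
    unfolding transported_def eq by (rule weighted_sum_eq) (use S in blast)
  also have "\<dots> = (\<Sum>n<m. \<rho> n (f x) *\<^sub>R \<Omega> i x)"
  proof (rule sum.cong[OF refl])
    fix n
    show "\<rho> n (f x) *\<^sub>R (\<Omega> (c n) x o\<^sub>L g (c n) i (f x)) = \<rho> n (f x) *\<^sub>R \<Omega> i x"
    proof (cases "f x \<in> U (c n)")
      case True
      then show ?thesis by (simp add: trivialisesD(4)[OF triv x i True])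
    next
      case False
      then have "\<rho> n (f x) = 0" using S by blast
      then show ?thesis by simp
    qed
  qed
  also have "\<dots> = \<Omega> i x" using S by (simp flip: scaleR_sum_left)
  finally show ?thesis .
qed

lemma transported_tendsto:
  assumes x: "x \<in> topspace (space_of M)" and i: "f' x \<in> U i"
  shows "(transported f' \<Omega> i \<longlongrightarrow> transported f' \<Omega> i x) (nhdsin (space_of M) x)"
proof -
  let ?X = "space_of M" and ?N = "nhdsin (space_of M) x"
  obtain W where W: "openin ?X W" "good W" "f x \<in> W" "f' x \<in> W" using near x by blast
  obtain m :: nat where m: "\<forall>y\<in>W. \<forall>n\<ge>m. \<rho> n y = 0"
    using W(2) unfolding good_def by blast
  have Wn: "W \<subseteq> U (c n) \<or> (\<forall>y\<in>W. \<rho> n y = 0)" for n using W(2) unfolding good_def by blast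
  have l': "filterlim f' (nhdsin ?X (f' x)) ?N" by (rule continuous_map_filterlim[OF f' x])
  have ev: "\<forall>\<^sub>F y in ?N. f' y \<in> W"
    using l' eventually_nhdsin_openin[OF W(1,4)] by (auto simp: filterlim_iff)
  have eq: "transported f' \<Omega> i y = (\<Sum>n<m. \<rho> n (f' y) *\<^sub>R (\<Omega> (c n) y o\<^sub>L g (c n) i (f' y)))" if "f' y \<in> W" for y
    unfolding transported_def by (rule weighted_sum_eq) (use m that in blast)
  have fx': "f' x \<in> topspace ?X" by (rule U_topspace[OF i])
  have "((\<lambda>y. \<Sum>n<m. \<rho> n (f' y) *\<^sub>R (\<Omega> (c n) y o\<^sub>L g (c n) i (f' y))) \<longlongrightarrow>
      (\<Sum>n<m. \<rho> n (f' x) *\<^sub>R (\<Omega> (c n) x o\<^sub>L g (c n) i (f' x)))) ?N"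
  proof (rule tendsto_sum)
    fix n
    show "((\<lambda>y. \<rho> n (f' y) *\<^sub>R (\<Omega> (c n) y o\<^sub>L g (c n) i (f' y))) \<longlongrightarrow>
        \<rho> n (f' x) *\<^sub>R (\<Omega> (c n) x o\<^sub>L g (c n) i (f' x))) ?N"
    proof (cases "W \<subseteq> U (c n)")
      case True
      then have cn: "f x \<in> U (c n)" "f' x \<in> U (c n)" using W by blast+
      have t1: "((\<lambda>y. \<rho> n (f' y)) \<longlongrightarrow> \<rho> n (f' x)) ?N"
        by (rule filterlim_compose[OF fsmooth_tendsto[OF M partition_of_unity_fsmooth[OF pou fx']] l'])
      have t2: "((\<lambda>y. g (c n) i (f' y)) \<longlongrightarrow> g (c n) i (f' x)) ?N"
        by (rule filterlim_compose[OF fsmooth_tendsto[OF M g_fsmooth[OF cn(2) i]] l'])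
      show ?thesis
        by (rule tendsto_scaleR[OF t1 bounded_bilinear.tendsto[OF bounded_bilinear_blinfun_compose
              trivialisesD(1)[OF triv x cn(1)] t2]])
    next
      case False
      \<comment> \<open>Here \<open>\<Omega> (c n)\<close> need not be continuous at
        \<open>x\<close>, but the weight vanishes on the whole of \<open>W\<close>, so the term is 0
        near \<open>x\<close>.\<close>
      then have z: "\<forall>y\<in>W. \<rho> n y = 0" using Wn[of n] by blast
      have "\<forall>\<^sub>F y in ?N. 0 = \<rho> n (f' y) *\<^sub>R (\<Omega> (c n) y o\<^sub>L g (c n) i (f' y))"
        using ev by eventually_elim (simp add: z)
      from Lim_transform_eventually[OF tendsto_const this] show ?thesis using z W(4) by simp
    qed
  qed
  moreover have "\<forall>\<^sub>F y in ?N. (\<Sum>n<m. \<rho> n (f' y) *\<^sub>R (\<Omega> (c n) y o\<^sub>L g (c n) i (f' y))) = transported f' \<Omega> i y"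
    using ev by eventually_elim (simp add: eq)
  ultimately show ?thesis unfolding eq[OF W(4)] by (rule Lim_transform_eventually)
qed

lemma transported_F:
  assumes x: "x \<in> topspace (space_of M)" and i: "f' x \<in> U i" and v: "v \<in> F"
  shows "transported f' \<Omega> i x v \<in> F"
proof -
  obtain W where W: "good W" "f x \<in> W" "f' x \<in> W" using near x by blast
  obtain m :: nat where m: "\<forall>y\<in>W. \<forall>n\<ge>m. \<rho> n y = 0"
    using W(1) unfolding good_def by blast
  have Wn: "W \<subseteq> U (c n) \<or> (\<forall>y\<in>W. \<rho> n y = 0)" for n using W(1) unfolding good_def by blast
  have eq: "transported f' \<Omega> i x = (\<Sum>n<m. \<rho> n (f' x) *\<^sub>R (\<Omega> (c n) x o\<^sub>L g (c n) i (f' x)))"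
    unfolding transported_def by (rule weighted_sum_eq) (use m W in blast)
  have "\<rho> n (f' x) *\<^sub>R \<Omega> (c n) x (g (c n) i (f' x) v) \<in> F" for n
  proof (cases "W \<subseteq> U (c n)")
    case True
    then have cn: "f x \<in> U (c n)" "f' x \<in> U (c n)" using W by blast+
    show ?thesis
      by (rule subspace_scale[OF subF trivialisesD(3)[OF triv x cn(1) g_F[OF cn(2) i v]]])
  next
    case False
    then have "\<rho> n (f' x) = 0" using Wn[of n] W by blast
    then show ?thesis using subspace_0[OF subF] by simp
  qed
  then show ?thesis unfolding eq
    by (simp add: blinfun.sum_left blinfun.scaleR_left subspace_sum[OF subF])
qed

lemma trivialises_transported: "trivialises f' (transported f' \<Omega>)"
  unfolding trivialises_def
  using transported_compat transported_inj transported_tendsto transported_F by blast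

end

end

end

section \<open>Passing to the limit, and smoothing\<close>

context linear_cocycle
begin

lemma continuous_trivialisation:
  assumes "contractible_space (space_of M)"
  obtains \<Omega> where "trivialises (\<lambda>x. x) \<Omega>"
proof -
  let ?X = "space_of M"
  obtain \<rho> c where pou: "partition_of_unity M \<rho> (\<lambda>n. U (c n))"
    by (rule partition_of_unity_exists[OF mf, of U]) (simp_all add: U_open U_mem)
  obtain a h where h: "continuous_map (prod_topology (top_of_set {0..1::real}) ?X) ?X h"
    "\<forall>x. h (0, x) = x" "\<forall>x. h (1, x) = a"
    using assms unfolding contractible_space_def homotopic_with_def by auto
  have cover: "\<exists>W\<in>{W. openin ?X W \<and> good \<rho> c W}. openin ?X W \<and> y \<in> W" if "y \<in> topspace ?X" for y
    using good_cover[OF pou that] by blast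
  obtain \<delta> where \<delta>: "\<forall>x\<in>topspace ?X. (\<delta> \<longlongrightarrow> \<delta> x) (nhdsin ?X x) \<and> 0 < \<delta> x"
    "\<forall>x\<in>topspace ?X. \<forall>s\<in>{0..1}. \<forall>t\<in>{0..1}. \<bar>s - t\<bar> \<le> \<delta> x \<longrightarrow>
      (\<exists>W\<in>{W. openin ?X W \<and> good \<rho> c W}. h (s, x) \<in> W \<and> h (t, x) \<in> W)"
    by (rule homotopy_step_size[OF mf h(1) cover])
  \<comment> \<open>The homotopy is the identity at time 0 and constant at time 1, so time runs
    backwards from 1. Truncation stops it at 0, and each step moves it by at most
    \<open>\<delta> x\<close>.\<close>
  define \<tau> where "\<tau> n x = 1 - min 1 (real n * \<delta> x)" for n x
  define G where "G n x = h (\<tau> n x, x)" for n x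
  have \<tau>01: "\<tau> n x \<in> {0..1}" if "x \<in> topspace ?X" for n x
    using that \<delta>(1) by (auto simp: \<tau>_def min_def less_imp_le)
  have Gc: "continuous_map ?X ?X (G n)" for n
  proof -
    have "continuous_map ?X euclidean (\<tau> n)"
    proof (rule tendsto_imp_continuous_map)
      fix x assume "x \<in> topspace ?X"
      then have "(\<delta> \<longlongrightarrow> \<delta> x) (nhdsin ?X x)" using \<delta>(1) by blast
      then show "(\<tau> n \<longlongrightarrow> \<tau> n x) (nhdsin ?X x)"
        unfolding \<tau>_def[abs_def] by (intro tendsto_intros)
    qed
    then have "continuous_map ?X (top_of_set {0..1}) (\<tau> n)"
      using \<tau>01 by (auto simp: continuous_map_in_subtopology)
    then have "continuous_map ?X (prod_topology (top_of_set {0..1}) ?X) (\<lambda>x. (\<tau> n x, x))"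
      by (simp add: continuous_map_pairwise comp_def)
    from continuous_map_compose[OF this h(1)] show ?thesis by (simp add: G_def[abs_def] comp_def)
  qed
  have near: "\<forall>x\<in>topspace ?X. \<exists>W. openin ?X W \<and> good \<rho> c W \<and> G n x \<in> W \<and> G (Suc n) x \<in> W" for n
  proof
    fix x assume x: "x \<in> topspace ?X"
    have "0 < \<delta> x" using \<delta>(1) x by blast
    then have "\<bar>\<tau> n x - \<tau> (Suc n) x\<bar> \<le> \<delta> x" by (simp add: \<tau>_def min_def algebra_simps)
    then show "\<exists>W. openin ?X W \<and> good \<rho> c W \<and> G n x \<in> W \<and> G (Suc n) x \<in> W"
      using \<delta>(2) x \<tau>01[OF x] unfolding G_def by blast
  qed
  \<comment> \<open>Along the constant map \<open>a\<close> all fibres are the fibre over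
    \<open>a\<close>; the change from coordinates \<open>i\<close> to coordinates \<open>a\<close>
    at that point is a trivialisation that does not depend on \<open>x\<close>.\<close>
  define Om :: "nat \<Rightarrow> 'a \<Rightarrow> 'a \<Rightarrow> ('f \<Rightarrow>\<^sub>L 'f)" where
    "Om = rec_nat (\<lambda>i x. g a i a) (\<lambda>n om. transported \<rho> c (G (Suc n)) om)"
  have Om0: "Om 0 = (\<lambda>i x. g a i a)" and OmS: "Om (Suc n) = transported \<rho> c (G (Suc n)) (Om n)" for n
    by (simp_all add: Om_def)
  have G0: "G 0 x = a" for x using h(3) by (simp add: G_def \<tau>_def)
  have triv: "trivialises (G n) (Om n)" for n
  proof (induction n)
    case 0
    \<comment> \<open>If \<open>M\<close> is empty then \<open>a\<close> is not a point of it;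
      membership is only needed when \<open>a\<close> lies in some \<open>U i\<close>.\<close>
    have aa: "a \<in> U a" if "a \<in> U i" for i by (rule U_mem[OF U_topspace[OF that]])
    show ?case unfolding trivialises_def Om0 G0
      using g_inj g_F g_trans aa by (auto intro!: tendsto_const)
  next
    case (Suc n)
    show ?case unfolding OmS by (rule trivialises_transported[OF pou Gc Gc near Suc])
  qed
  have stat: "G n x = x" if x: "x \<in> topspace ?X" and n: "1 \<le> real n * \<delta> x" for n x
    using n h(2) by (simp add: G_def \<tau>_def)
  \<comment> \<open>The number of steps after which the point has certainly reached the
    identity.\<close>
  define N where "N x = nat \<lceil>1 / \<delta> x\<rceil>" for x
  have N: "1 \<le> real n * \<delta> x" if x: "x \<in> topspace ?X" and n: "N x \<le> n" for n x
  proof -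
    have "0 < \<delta> x" using \<delta>(1) x by blast
    moreover have "1 / \<delta> x \<le> real n" using n unfolding N_def by linarith
    ultimately show ?thesis by (simp add: field_simps)
  qed
  have const: "Om n i x = Om (N x) i x" if x: "x \<in> U i" and n: "N x \<le> n" for n i x
    using n
  proof (induction n rule: dec_induct)
    case (step n)
    note xX = U_topspace[OF x]
    have e: "G n x = x" "G (Suc n) x = x" using stat[OF xX N[OF xX]] step by auto
    have "Om (Suc n) i x = Om n i x"
      unfolding OmS
      by (rule transported_stationary[OF pou Gc Gc near triv xX]) (use e x in simp_all)
    then show ?case using step by simp
  qed simp
  define \<Omega> where "\<Omega> i x = Om (N x) i x" for i x
  have "trivialises (\<lambda>x. x) \<Omega>"
    unfolding trivialises_def
  proof (intro conjI allI ballI impI)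
    fix i x assume x: "x \<in> topspace ?X" and i: "x \<in> U i"
    have GN: "G (N x) x = x" by (rule stat[OF x N[OF x order_refl]])
    then have Gi: "G (N x) x \<in> U i" using i by simp
    note T = trivialisesD[OF triv[of "N x"] x Gi]
    show "inj (blinfun_apply (\<Omega> i x))" "v \<in> F \<Longrightarrow> \<Omega> i x v \<in> F" for v
      using T(2,3) by (simp_all add: \<Omega>_def)
    show "\<Omega> j x o\<^sub>L g j i x = \<Omega> i x" if "x \<in> U j" for j
      using T(4)[of j] that by (simp add: \<Omega>_def GN)
    text \<open>Near \<open>x\<close> the sequence \<open>Om\<close> becomes stationary at a common index.\<close>
    have pos: "0 < \<delta> x" and lim: "(\<delta> \<longlongrightarrow> \<delta> x) (nhdsin ?X x)" using \<delta>(1) x by blast+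
    \<comment> \<open>Neighbours \<open>y\<close> satisfy
      \<open>\<delta> y > \<delta> x / 2\<close>, so the numerator 2 makes this one index late
      enough for all of them.\<close>
    define m where "m = nat \<lceil>2 / \<delta> x\<rceil>"
    have "\<forall>\<^sub>F y in nhdsin ?X x. \<delta> x / 2 < \<delta> y"
      by (rule order_tendstoD(1)[OF lim]) (use pos in linarith)
    then have ev: "\<forall>\<^sub>F y in nhdsin ?X x. Om m i y = \<Omega> i y"
      using eventually_nhdsin_openin[OF U_open i]
    proof eventually_elim
      case (elim y)
      have "1 / \<delta> y \<le> 1 / (\<delta> x / 2)" by (rule frac_le) (use elim(1) pos in linarith)+
      then have "1 / \<delta> y \<le> 2 / \<delta> x" by simp
      then have "N y \<le> m" unfolding N_def m_def by (intro nat_mono ceiling_mono)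
      from const[OF elim(2) this] show ?case unfolding \<Omega>_def .
    qed
    have "1 / \<delta> x \<le> 2 / \<delta> x" using pos by (intro divide_right_mono) simp_all
    then have Nm: "N x \<le> m" unfolding N_def m_def by (intro nat_mono ceiling_mono)
    have "G m x \<in> U i" using stat[OF x N[OF x Nm]] i by simp
    from trivialisesD(1)[OF triv x this] have "(Om m i \<longlongrightarrow> Om m i x) (nhdsin ?X x)" .
    from Lim_transform_eventually[OF this ev] show "(\<Omega> i \<longlongrightarrow> \<Omega> i x) (nhdsin ?X x)"
      using const[OF i Nm] by (simp add: \<Omega>_def[abs_def])
  qed
  then show thesis by (rule that)
qed

lemma smooth_trivialisation:
  assumes "contractible_space (space_of M)"
  obtains \<Omega> where "\<forall>i. \<forall>x\<in>U i. fsmooth M (\<Omega> i) x \<and> inj (blinfun_apply (\<Omega> i x)) \<and> (\<forall>v\<in>F. \<Omega> i x v \<in> F)"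
    "\<forall>i j. \<forall>x\<in>U i \<inter> U j. \<Omega> j x o\<^sub>L g j i x = \<Omega> i x"
proof -
  let ?X = "space_of M"
  obtain \<Omega> where triv: "trivialises (\<lambda>x. x) \<Omega>"
    by (rule continuous_trivialisation[OF assms])
  note T = trivialisesD[OF triv U_topspace]
  have "\<forall>p\<in>topspace ?X. \<exists>B. openin ?X B \<and> p \<in> B \<and> B \<subseteq> U p \<and>
      (\<forall>x\<in>B. \<forall>v. norm (\<Omega> p p v - \<Omega> p x v) \<le> norm (\<Omega> p x v) / 2)"
  proof
    fix p assume p: "p \<in> topspace ?X"
    have pU: "p \<in> U p" by (rule U_mem[OF p])
    \<comment> \<open>With lower bound \<open>k\<close> at \<open>p\<close>, a perturbation of size
      \<open>k / 3\<close> leaves the lower bound \<open>2 * k / 3\<close> at \<open>x\<close>, of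
      which the perturbation is half.\<close>
    obtain k where k: "k > 0" "\<And>v. k * norm v \<le> norm (\<Omega> p p v)"
      using blinfun_inj_bounded_below[OF T(2)[OF pU pU]] by blast
    have "\<forall>\<^sub>F x in nhdsin ?X p. dist (\<Omega> p x) (\<Omega> p p) < k / 3"
      using T(1)[OF pU pU] k(1) by (intro tendstoD) simp_all
    with eventually_nhdsin_openin[OF U_open pU]
    have "\<forall>\<^sub>F x in nhdsin ?X p. x \<in> U p \<and> dist (\<Omega> p x) (\<Omega> p p) < k / 3"
      by (rule eventually_conj)
    then obtain B where B: "openin ?X B" "p \<in> B" "\<forall>x\<in>B. x \<in> U p \<and> dist (\<Omega> p x) (\<Omega> p p) < k / 3"
      using p unfolding eventually_nhdsin by blast
    have "norm (\<Omega> p p v - \<Omega> p x v) \<le> norm (\<Omega> p x v) / 2" if "x \<in> B" for x v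
    proof -
      have "dist (\<Omega> p p) (\<Omega> p x) < k / 3" unfolding dist_commute[of "\<Omega> p p"] using B(3) that by blast
      then have "norm (\<Omega> p p - \<Omega> p x) \<le> k / 3" unfolding dist_norm by (rule less_imp_le)
      then have "norm (\<Omega> p p - \<Omega> p x) * norm v \<le> k / 3 * norm v" by (intro mult_right_mono) simp_all
      then have d: "norm (\<Omega> p p v - \<Omega> p x v) \<le> k / 3 * norm v"
        using norm_blinfun[of "\<Omega> p p - \<Omega> p x" v] by (simp add: blinfun.diff_left)
      moreover have "norm (\<Omega> p p v) \<le> norm (\<Omega> p p v - \<Omega> p x v) + norm (\<Omega> p x v)"
        using norm_triangle_ineq[of "\<Omega> p p v - \<Omega> p x v" "\<Omega> p x v"] by simp
      ultimately show ?thesis using k(2)[of v] by linarith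
    qed
    then show "\<exists>B. openin ?X B \<and> p \<in> B \<and> B \<subseteq> U p \<and>
      (\<forall>x\<in>B. \<forall>v. norm (\<Omega> p p v - \<Omega> p x v) \<le> norm (\<Omega> p x v) / 2)"
      using B by (intro exI[of _ B]) blast
  qed
  then obtain B where B': "\<forall>p\<in>topspace ?X. openin ?X (B p) \<and> p \<in> B p \<and> B p \<subseteq> U p \<and>
      (\<forall>x\<in>B p. \<forall>v. norm (\<Omega> p p v - \<Omega> p x v) \<le> norm (\<Omega> p x v) / 2)"
    unfolding bchoice_iff by blast
  have B: "openin ?X (B p) \<and> p \<in> B p" and BU: "B p \<subseteq> U p"
    and close: "x \<in> B p \<Longrightarrow> norm (\<Omega> p p v - \<Omega> p x v) \<le> norm (\<Omega> p x v) / 2"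
    if "p \<in> topspace ?X" for p x v
    using bspec[OF B' that] by simp_all
  obtain \<sigma> q where pou: "partition_of_unity M \<sigma> (\<lambda>n. B (q n))"
    and q: "topspace ?X \<noteq> {} \<longrightarrow> range q \<subseteq> topspace ?X"
    by (rule partition_of_unity_exists[OF mf B])
  define \<Omega>' where "\<Omega>' i x = weighted_sum \<sigma> (\<lambda>n. \<Omega> (q n) (q n) o\<^sub>L g (q n) i x) x" for i x
  have main: "fsmooth M (\<Omega>' i) x \<and> inj (blinfun_apply (\<Omega>' i x)) \<and> (\<forall>v\<in>F. \<Omega>' i x v \<in> F)"
    and compat: "x \<in> U j \<Longrightarrow> \<Omega>' j x o\<^sub>L g j i x = \<Omega>' i x" if i: "x \<in> U i" for i j x
  proof -
    have x: "x \<in> topspace ?X" by (rule U_topspace[OF i])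
    then have qX: "q n \<in> topspace ?X" for n using q by blast
    obtain S and m :: nat where S: "openin ?X S" "x \<in> S" "\<forall>n. S \<subseteq> B (q n) \<or> (\<forall>y\<in>S. \<sigma> n y = 0)"
      "\<forall>y\<in>S. \<forall>n\<ge>m. \<sigma> n y = 0" "\<forall>y\<in>S. (\<Sum>n<m. \<sigma> n y) = 1"
      by (rule partition_of_unityE[OF pou x])
    have eq: "\<Omega>' k y = (\<Sum>n<m. \<sigma> n y *\<^sub>R (\<Omega> (q n) (q n) o\<^sub>L g (q n) k y))" if "y \<in> S" for k y
      unfolding \<Omega>'_def by (rule weighted_sum_eq) (use S(4) that in blast)
    have cases: "x \<in> B (q n) \<and> S \<subseteq> B (q n) \<and> x \<in> U (q n) \<or> (\<forall>y\<in>S. \<sigma> n y = 0)" for n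
      using spec[OF S(3), of n] S(2) BU[OF qX[of n]] by blast
    have "fsmooth M (\<lambda>y. \<sigma> n y *\<^sub>R (\<Omega> (q n) (q n) o\<^sub>L g (q n) i y)) x" for n
      using cases[of n]
    proof
      assume "x \<in> B (q n) \<and> S \<subseteq> B (q n) \<and> x \<in> U (q n)"
      then have xn: "x \<in> U (q n)" by blast
      show ?thesis
        by (rule fsmooth_bilinear[OF M bounded_bilinear_scaleR partition_of_unity_fsmooth[OF pou x]
              fsmooth_bilinear[OF M bounded_bilinear_blinfun_compose fsmooth_const[OF M x] g_fsmooth[OF xn i]]])
    next
      assume z: "\<forall>y\<in>S. \<sigma> n y = 0"
      show ?thesis
        by (rule fsmooth_cong[OF M fsmooth_const[OF M x, of 0] S(1,2)]) (simp add: z)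
    qed
    then have "fsmooth M (\<lambda>y. \<Sum>n<m. \<sigma> n y *\<^sub>R (\<Omega> (q n) (q n) o\<^sub>L g (q n) i y)) x"
      by (rule fsmooth_sum[OF M x])
    then have sm: "fsmooth M (\<Omega>' i) x"
      by (rule fsmooth_cong[OF M _ S(1,2)]) (simp add: eq)
    have inF: "\<Omega>' i x v \<in> F" if v: "v \<in> F" for v
    proof -
      have "\<sigma> n x *\<^sub>R \<Omega> (q n) (q n) (g (q n) i x v) \<in> F" for n
        using cases[of n]
      proof
        assume "x \<in> B (q n) \<and> S \<subseteq> B (q n) \<and> x \<in> U (q n)"
        then have xn: "x \<in> U (q n)" by blast
        have qq: "q n \<in> U (q n)" by (rule U_mem[OF qX])
        show ?thesis by (rule subspace_scale[OF subF T(3)[OF qq qq g_F[OF xn i v]]])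
      next
        assume "\<forall>y\<in>S. \<sigma> n y = 0"
        then show ?thesis using S(2) subspace_0[OF subF] by simp
      qed
      then show ?thesis unfolding eq[OF S(2)]
        by (simp add: blinfun.sum_left blinfun.scaleR_left subspace_sum[OF subF])
    qed
    have est: "norm (\<Omega>' i x v - \<Omega> i x v) \<le> norm (\<Omega> i x v) / 2" for v
    proof -
      have s1: "(\<Sum>n<m. \<sigma> n x) = 1" using S by blast
      have "\<Omega>' i x v - \<Omega> i x v = (\<Sum>n<m. \<sigma> n x *\<^sub>R \<Omega> (q n) (q n) (g (q n) i x v)) - (\<Sum>n<m. \<sigma> n x) *\<^sub>R \<Omega> i x v"
        by (simp add: s1 eq[OF S(2)] blinfun.sum_left blinfun.scaleR_left)
      also have "\<dots> = (\<Sum>n<m. \<sigma> n x *\<^sub>R (\<Omega> (q n) (q n) (g (q n) i x v) - \<Omega> i x v))"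
        by (simp add: scaleR_sum_left sum_subtractf scaleR_diff_right)
      also have "norm \<dots> \<le> (\<Sum>n<m. \<sigma> n x * (norm (\<Omega> i x v) / 2))"
      proof (rule sum_norm_le)
        fix n
        show "norm (\<sigma> n x *\<^sub>R (\<Omega> (q n) (q n) (g (q n) i x v) - \<Omega> i x v)) \<le> \<sigma> n x * (norm (\<Omega> i x v) / 2)"
          using cases[of n]
        proof
          assume "x \<in> B (q n) \<and> S \<subseteq> B (q n) \<and> x \<in> U (q n)"
          then have xn: "x \<in> U (q n)" "x \<in> B (q n)" by blast+
          have "\<Omega> (q n) x o\<^sub>L g (q n) i x = \<Omega> i x" by (rule T(4)[OF i i xn(1)])
          then have "\<Omega> (q n) x (g (q n) i x v) = \<Omega> i x v" by (metis blinfun_apply_blinfun_compose)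
          then have "norm (\<Omega> (q n) (q n) (g (q n) i x v) - \<Omega> i x v) \<le> norm (\<Omega> i x v) / 2"
            using close[OF qX xn(2), of "g (q n) i x v"] by simp
          then show ?thesis
            unfolding norm_scaleR abs_of_nonneg[OF partition_of_unity_nonneg[OF pou]]
            by (rule mult_left_mono[OF _ partition_of_unity_nonneg[OF pou]])
        next
          assume "\<forall>y\<in>S. \<sigma> n y = 0"
          then show ?thesis using S(2) by simp
        qed
      qed
      also have "\<dots> = norm (\<Omega> i x v) / 2" by (simp only: s1 mult_1_left flip: sum_distrib_right)
      finally show ?thesis .
    qed
    have inj: "inj (blinfun_apply (\<Omega>' i x))"
    proof (rule blinfun_injI)
      fix v assume "\<Omega>' i x v = 0"
      then have "norm (\<Omega> i x v) \<le> norm (\<Omega> i x v) / 2" using est[of v] by simp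
      then have "\<Omega> i x v = 0" by simp
      then show "v = 0" by (rule blinfun_injD[OF T(2)[OF i i]])
    qed
    show "fsmooth M (\<Omega>' i) x \<and> inj (blinfun_apply (\<Omega>' i x)) \<and> (\<forall>v\<in>F. \<Omega>' i x v \<in> F)"
      using sm inj inF by blast
    show "\<Omega>' j x o\<^sub>L g j i x = \<Omega>' i x" if j: "x \<in> U j"
    proof (rule blinfun_eqI)
      fix v
      have "\<sigma> n x *\<^sub>R \<Omega> (q n) (q n) (g (q n) j x (g j i x v)) = \<sigma> n x *\<^sub>R \<Omega> (q n) (q n) (g (q n) i x v)" for n
        using cases[of n]
      proof
        assume "x \<in> B (q n) \<and> S \<subseteq> B (q n) \<and> x \<in> U (q n)"
        then show ?thesis using g_trans_apply[OF _ j i] by simp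
      next
        assume "\<forall>y\<in>S. \<sigma> n y = 0"
        then show ?thesis using S(2) by simp
      qed
      then have "(\<Sum>n<m. \<sigma> n x *\<^sub>R \<Omega> (q n) (q n) (g (q n) j x (g j i x v)))
        = (\<Sum>n<m. \<sigma> n x *\<^sub>R \<Omega> (q n) (q n) (g (q n) i x v))" by (intro sum.cong refl)
      then show "(\<Omega>' j x o\<^sub>L g j i x) v = \<Omega>' i x v"
        unfolding eq[OF S(2)] by (simp add: blinfun.sum_left blinfun.scaleR_left)
    qed
  qed
  show thesis
  proof (rule that[of \<Omega>'])
    show "\<forall>i. \<forall>x\<in>U i. fsmooth M (\<Omega>' i) x \<and> inj (blinfun_apply (\<Omega>' i x)) \<and> (\<forall>v\<in>F. \<Omega>' i x v \<in> F)"
      by (intro allI ballI) (rule main)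
    show "\<forall>i j. \<forall>x\<in>U i \<inter> U j. \<Omega>' j x o\<^sub>L g j i x = \<Omega>' i x"
      by (intro allI ballI compat) simp_all
  qed
qed

end

subsection \<open>Vector bundles\<close>

text \<open>The preimage that \<open>restrict_bundle\<close> restricts to may contain points outside
  the total space, and then is not an open set of it. Replacing it by its open part changes nothing
  in the resulting charted space.\<close>

lemma open_submanifold_Int_topspace:
  assumes "smooth_atlas M"
  shows "open_submanifold M (topspace (space_of M) \<inter> A) = open_submanifold M A"
proof -
  have eq: "U \<inter> (topspace (space_of M) \<inter> A) = U \<inter> A" if "(U, \<phi>) \<in> atlas M" for U \<phi>
    using chart_subset[OF assms that] by blast
  have "{(U \<inter> (topspace (space_of M) \<inter> A), \<phi>) |U \<phi>. (U, \<phi>) \<in> atlas M} =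
      (\<lambda>(U, \<phi>). (U \<inter> (topspace (space_of M) \<inter> A), \<phi>)) ` atlas M" by auto
  also have "\<dots> = (\<lambda>(U, \<phi>). (U \<inter> A, \<phi>)) ` atlas M"
    by (rule image_cong[OF refl]) (clarify, simp only: eq)
  also have "\<dots> = {(U \<inter> A, \<phi>) |U \<phi>. (U, \<phi>) \<in> atlas M}" by auto
  finally have "{(U \<inter> (topspace (space_of M) \<inter> A), \<phi>) |U \<phi>. (U, \<phi>) \<in> atlas M} = {(U \<inter> A, \<phi>) |U \<phi>. (U, \<phi>) \<in> atlas M}" .
  moreover have "subtopology (space_of M) (topspace (space_of M) \<inter> A) = subtopology (space_of M) A"
    by (metis subtopology_restrict)
  ultimately show ?thesis by (simp add: open_submanifold_def)
qed

text \<open>An equality of structures, so that smoothness of the inverse of a local trivialisation,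
  stated over the restricted base, can be read in the product over all of \<open>M\<close>.\<close>

lemma product_manifold_open_submanifold:
  fixes F :: "'f::euclidean_space set"
  shows "product_manifold (open_submanifold M U) (linear_manifold F) =
    open_submanifold (product_manifold M (linear_manifold F)) (U \<times> F)"
  (is "?L = ?R")
proof (rule charted_space.equality)
  let ?C = "(\<lambda>(A, \<phi>). ((A \<inter> U) \<times> F, map_prod \<phi> (id :: 'f \<Rightarrow> 'f))) ` atlas M"
  show "space_of ?L = space_of ?R"
    by (simp add: subtopology_Times subtopology_subtopology)
  show "model ?L = model ?R"
    by (simp add: product_manifold_def open_submanifold_def)
  have "atlas ?L = ?C"
  proof (intro subset_antisym subsetI)
    fix z assume "z \<in> atlas ?L"
    then obtain A \<phi> where "(A, \<phi>) \<in> atlas M" "z = ((A \<inter> U) \<times> F, map_prod \<phi> id)"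
      unfolding atlas_product_manifold atlas_open_submanifold atlas_linear_manifold by auto
    then show "z \<in> ?C" by (intro rev_image_eqI[of "(A, \<phi>)"]) simp_all
  next
    fix z assume "z \<in> ?C"
    then show "z \<in> atlas ?L"
      unfolding atlas_product_manifold atlas_open_submanifold atlas_linear_manifold by auto
  qed
  moreover have "atlas ?R = ?C"
  proof (intro subset_antisym subsetI)
    fix z assume "z \<in> atlas ?R"
    then obtain A \<phi> where "(A, \<phi>) \<in> atlas M" "z = (A \<times> F \<inter> U \<times> F, map_prod \<phi> id)"
      unfolding atlas_product_manifold atlas_open_submanifold atlas_linear_manifold by auto
    then show "z \<in> ?C" by (intro rev_image_eqI[of "(A, \<phi>)"]) (simp_all add: Times_Int_Times)
  next
    fix z assume "z \<in> ?C"
    then obtain A \<phi> where A: "(A, \<phi>) \<in> atlas M" "z = (A \<times> F \<inter> U \<times> F, map_prod \<phi> id)"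
      by (auto simp: Times_Int_Times)
    then have "(A \<times> F, map_prod \<phi> id) \<in> atlas (product_manifold M (linear_manifold F))"
      unfolding atlas_product_manifold atlas_linear_manifold by auto
    then show "z \<in> atlas ?R" unfolding atlas_open_submanifold A(2) by blast
  qed
  ultimately show "atlas ?L = atlas ?R" by simp
qed simp

text \<open>The maps \<open>h\<close> and \<open>k\<close> are the fibre component of a local trivialisation and its inverse.\<close>

definition bundle_chart ::
  "('a, 'e::euclidean_space) charted_space \<Rightarrow> 'f::euclidean_space set \<Rightarrow>
   ('b, 'g::euclidean_space, 'a) bundle_data \<Rightarrow> 'a set \<Rightarrow> ('b \<Rightarrow> 'f) \<Rightarrow> ('a \<times> 'f \<Rightarrow> 'b) \<Rightarrow> bool" where
  "bundle_chart M F E V h k \<longleftrightarrow>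
    (\<forall>e\<in>topspace (space_of (total E)). proj E e \<in> V \<longrightarrow>
      h e \<in> F \<and> k (proj E e, h e) = e \<and> fsmooth (total E) h e) \<and>
    (\<forall>x\<in>V. \<forall>v\<in>F. k (x, v) \<in> topspace (space_of (total E)) \<and> proj E (k (x, v)) = x \<and> h (k (x, v)) = v \<and>
      smooth_at (product_manifold M (linear_manifold F)) (total E) k (x, v)) \<and>
    (\<forall>x\<in>V. \<forall>e\<in>fibre E x. (\<forall>e'\<in>fibre E x. h (vadd E e e') = h e + h e') \<and>
      (\<forall>c. h (vscale E c e) = c *\<^sub>R h e))"

text \<open>Converts a local trivialisation between restricted objects into pointwise statements on
  \<open>M\<close> and \<open>total E\<close>, after which restricted manifolds no longer
  occur.\<close>

lemma vector_bundle_chart: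
  assumes M: "smooth_atlas M" and E: "smooth_atlas (total E)"
    and proj: "continuous_map (space_of (total E)) (space_of M) (proj E)"
    and U: "openin (space_of M) U"
    and iso: "bundle_isomorphism (open_submanifold M U) (restrict_bundle E U)
      (product_bundle (open_submanifold M U) F) \<Phi>"
  shows "\<exists>h k. bundle_chart M F E U h k"
proof -
  let ?Y = "space_of (total E)"
  define A where "A = topspace ?Y \<inter> proj E -` U"
  have "A = {e \<in> topspace ?Y. proj E e \<in> U}" by (auto simp: A_def)
  then have A: "openin ?Y A" using openin_continuous_map_preimage[OF proj U] by simp
  define EU where "EU = open_submanifold (total E) A"
  define MU where "MU = open_submanifold M U"
  define N where "N = product_manifold MU (linear_manifold F)"
  have EU: "smooth_atlas EU" unfolding EU_def by (rule smooth_atlas_open_submanifold[OF E A])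
  have MU: "smooth_atlas MU" unfolding MU_def by (rule smooth_atlas_open_submanifold[OF M U])
  have L: "smooth_atlas (linear_manifold F)" by (rule smooth_atlas_linear_manifold)
  have N: "smooth_atlas N" unfolding N_def by (rule smooth_atlas_product_manifold[OF MU L])
  have tot: "total (restrict_bundle E U) = EU"
    unfolding EU_def A_def restrict_bundle_def by (simp add: open_submanifold_Int_topspace[OF E])
  have totN: "total (product_bundle MU F) = N" by (simp add: product_bundle_def N_def)
  have UX: "U \<subseteq> topspace (space_of M)" using U openin_subset by blast
  have topEU: "topspace (space_of EU) = A" using A openin_subset by (auto simp: EU_def)
  have topMU: "topspace (space_of MU) = U" using UX by (auto simp: MU_def)
  have topN: "topspace (space_of N) = U \<times> F" using topMU by (simp add: N_def)
  have diff: "diffeomorphism EU N \<Phi>"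
    and pr: "\<forall>e\<in>A. fst (\<Phi> e) = proj E e"
    and lin: "\<forall>p\<in>U. (\<forall>e\<in>fibre (restrict_bundle E U) p. \<forall>e'\<in>fibre (restrict_bundle E U) p.
          \<Phi> (vadd E e e') = vadd (product_bundle MU F) (\<Phi> e) (\<Phi> e')) \<and>
        (\<forall>c. \<forall>e\<in>fibre (restrict_bundle E U) p. \<Phi> (vscale E c e) = vscale (product_bundle MU F) c (\<Phi> e))"
    using iso unfolding bundle_isomorphism_def tot totN[unfolded MU_def, folded MU_def] MU_def[symmetric] topEU topMU
    by (simp_all add: totN) (simp_all add: restrict_bundle_def product_bundle_def)
  obtain k where k: "homeomorphic_maps (space_of EU) (space_of N) \<Phi> k" "smooth_map EU N \<Phi>" "smooth_map N EU k"
    using diff unfolding diffeomorphism_def by blast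
  have \<Phi>A: "\<Phi> e \<in> U \<times> F" "k (\<Phi> e) = e" if "e \<in> A" for e
    using k(1) that unfolding homeomorphic_maps_def continuous_map_def topEU topN by auto
  have kN: "k z \<in> A" "\<Phi> (k z) = z" if "z \<in> U \<times> F" for z
    using k(1) that unfolding homeomorphic_maps_def continuous_map_def topEU topN by auto
  define h where "h e = snd (\<Phi> e)" for e
  have \<Phi>h: "\<Phi> e = (proj E e, h e)" if "e \<in> A" for e
    using pr that by (simp add: h_def prod_eq_iff)
  have fib: "fibre E x \<subseteq> A \<and> fibre E x = fibre (restrict_bundle E U) x" if "x \<in> U" for x
    using that unfolding fibre_def tot topEU by (auto simp: A_def restrict_bundle_def)
  have h: "h e \<in> F" "k (proj E e, h e) = e" "fsmooth (total E) h e"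
    if "e \<in> topspace ?Y" "proj E e \<in> U" for e
  proof -
    have e: "e \<in> A" using that by (simp add: A_def)
    show "h e \<in> F" "k (proj E e, h e) = e" using \<Phi>A[OF e] \<Phi>h[OF e] by auto
    have "smooth_at EU N \<Phi> e"
      by (rule smooth_map_imp_smooth_at[OF EU N k(2)]) (simp add: topEU e)
    moreover have "fsmooth N snd (\<Phi> e)"
    proof -
      have "fsmooth (linear_manifold F) (\<lambda>v. v) (h e)"
        by (rule smooth_at_linear_manifoldD[OF smooth_at_id[OF L]]) (use \<open>h e \<in> F\<close> in simp)
      from fsmooth_fst_snd(2)[OF MU L _ _ this, of "proj E e"] that \<open>h e \<in> F\<close>
      show ?thesis unfolding N_def \<Phi>h[OF e] by (simp add: topMU)
    qed
    ultimately have "fsmooth EU h e"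
      unfolding h_def[abs_def] by (rule fsmooth_compose[OF EU N])
    then show "fsmooth (total E) h e"
      unfolding EU_def fsmooth_open_submanifold[OF E A] by blast
  qed
  have kk: "k (x, v) \<in> topspace ?Y \<and> proj E (k (x, v)) = x \<and> h (k (x, v)) = v \<and>
      smooth_at (product_manifold M (linear_manifold F)) (total E) k (x, v)"
    if "x \<in> U" "v \<in> F" for x v
  proof -
    have z: "(x, v) \<in> U \<times> F" using that by simp
    have "k (x, v) \<in> topspace ?Y" using kN(1)[OF z] by (simp add: A_def)
    moreover have "proj E (k (x, v)) = x" "h (k (x, v)) = v"
      using \<Phi>h[OF kN(1)[OF z]] kN(2)[OF z] by simp_all
    moreover have "smooth_at N EU k (x, v)"
      by (rule smooth_map_imp_smooth_at[OF N EU k(3)]) (simp add: topN that)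
    then have "smooth_at N (total E) k (x, v)"
      unfolding EU_def by (rule smooth_at_open_submanifold_target)
    then have "smooth_at (product_manifold M (linear_manifold F)) (total E) k (x, v)"
      unfolding N_def MU_def product_manifold_open_submanifold
      by (subst (asm) smooth_at_open_submanifold_source)
         (auto intro!: smooth_atlas_product_manifold M L simp: openin_prod_Times_iff U)
    ultimately show ?thesis by blast
  qed
  have hl: "h (vadd E e e') = h e + h e'" "h (vscale E c e) = c *\<^sub>R h e"
    if x: "x \<in> U" and e: "e \<in> fibre E x" and e': "e' \<in> fibre E x" for x e e' c
  proof -
    have f: "e \<in> fibre (restrict_bundle E U) x" "e' \<in> fibre (restrict_bundle E U) x" "e \<in> A" "e' \<in> A"
      using fib[OF x] e e' by auto
    have "\<Phi> (vadd E e e') = vadd (product_bundle MU F) (\<Phi> e) (\<Phi> e')"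
      "\<Phi> (vscale E c e) = vscale (product_bundle MU F) c (\<Phi> e)"
      using lin x f(1,2) by blast+
    then show "h (vadd E e e') = h e + h e'" "h (vscale E c e) = c *\<^sub>R h e"
      unfolding h_def by (simp_all add: product_bundle_def split: prod.splits)
  qed
  have "bundle_chart M F E U h k"
    unfolding bundle_chart_def
  proof (intro conjI ballI allI impI)
    fix x e e' c assume "x \<in> U" "e \<in> fibre E x"
    then show "h (vscale E c e) = c *\<^sub>R h e" using hl(2) by blast
  qed (simp_all add: h kk hl(1))
  then show ?thesis by blast
qed

locale bundle_charts =
  fixes M :: "('a, 'e::euclidean_space) charted_space"
    and F :: "'f::euclidean_space set"
    and E :: "('b, 'g::euclidean_space, 'a) bundle_data"
    and U :: "'a \<Rightarrow> 'a set"
    and h :: "'a \<Rightarrow> 'b \<Rightarrow> 'f"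
    and k :: "'a \<Rightarrow> 'a \<times> 'f \<Rightarrow> 'b"
  assumes vb: "smooth_vector_bundle M F E"
    and U_open: "openin (space_of M) (U i)"
    and U_mem: "p \<in> topspace (space_of M) \<Longrightarrow> p \<in> U p"
    and chart: "bundle_chart M F E (U i) (h i) (k i)"

lemma smooth_vector_bundle_charts:
  fixes M :: "('a, 'e::euclidean_space) charted_space"
    and F :: "'f::euclidean_space set"
    and E :: "('b, 'g::euclidean_space, 'a) bundle_data"
  assumes vb: "smooth_vector_bundle M F E"
  obtains U h k where "bundle_charts M F E U h k"
proof -
  let ?X = "space_of M" and ?Y = "space_of (total E)"
  have M: "smooth_atlas M" and E: "smooth_atlas (total E)"
    using vb smooth_manifold_imp_smooth_atlas unfolding smooth_vector_bundle_def by blast+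
  have pr: "continuous_map ?Y ?X (proj E)"
    using vb unfolding smooth_vector_bundle_def smooth_map_def by blast
  have "\<forall>p. \<exists>V h k. openin ?X V \<and> (p \<in> topspace ?X \<longrightarrow> p \<in> V) \<and> bundle_chart M F E V h k"
  proof
    fix p
    show "\<exists>V h k. openin ?X V \<and> (p \<in> topspace ?X \<longrightarrow> p \<in> V) \<and> bundle_chart M F E V h k"
    proof (cases "p \<in> topspace ?X")
      case True
      then obtain V \<Phi> where V: "openin ?X V" "p \<in> V"
        and iso: "bundle_isomorphism (open_submanifold M V) (restrict_bundle E V)
          (product_bundle (open_submanifold M V) F) \<Phi>"
        using vb unfolding smooth_vector_bundle_def by meson
      from vector_bundle_chart[OF M E pr V(1) iso] V show ?thesis by blast
    next
      case False
      \<comment> \<open>Indices outside \<open>M\<close> receive the empty domain, on which all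
        chart conditions are vacuous; this makes the family total.\<close>
      have "topspace ?Y \<inter> proj E -` {} = {}" by simp
      then have "bundle_chart M F E {} (\<lambda>_. 0) (\<lambda>_. undefined)" unfolding bundle_chart_def by simp
      then show ?thesis using False openin_empty by blast
    qed
  qed
  then obtain U h k where "\<forall>p. openin ?X (U p) \<and> (p \<in> topspace ?X \<longrightarrow> p \<in> U p) \<and> bundle_chart M F E (U p) (h p) (k p)"
    unfolding choice_iff by (elim exE)
  then have U: "openin ?X (U p)" "p \<in> topspace ?X \<longrightarrow> p \<in> U p" and P: "bundle_chart M F E (U p) (h p) (k p)" for p
    by simp_all
  have "bundle_charts M F E U h k"
    by unfold_locales (use P U vb in auto)
  then show thesis by (rule that)
qed

lemma linear_projection_exists:
  fixes F :: "'f::euclidean_space set"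
  assumes "subspace F"
  obtains P :: "'f \<Rightarrow> 'f" where "linear P" "range P \<subseteq> F" "\<forall>v\<in>F. P v = v"
proof -
  have "\<exists>P. range P \<subseteq> F \<and> linear P \<and> (\<forall>v\<in>F. P v = v)"
    by (rule linear_exists_left_inverse_on[OF linear_ident assms]) simp
  then show thesis using that by blast
qed

text \<open>Reduces smoothness of an operator-valued function to smoothness of its values at the
  finitely many basis vectors, which is all that \<open>transition_fsmooth\<close> provides.\<close>

lemma blinfun_Basis_expansion:
  fixes A :: "'f::euclidean_space \<Rightarrow>\<^sub>L 'v::real_normed_vector"
  shows "A = (\<Sum>b\<in>Basis. blinfun_scaleR_left (A b) o\<^sub>L blinfun_inner_left b)"
proof (rule blinfun_eqI)
  fix v
  have "A v = A (\<Sum>b\<in>Basis. (v \<bullet> b) *\<^sub>R b)" by (simp only: euclidean_representation)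
  also have "\<dots> = (\<Sum>b\<in>Basis. (v \<bullet> b) *\<^sub>R A b)" by (simp only: blinfun.sum_right blinfun.scaleR_right)
  also have "\<dots> = (\<Sum>b\<in>Basis. blinfun_scaleR_left (A b) o\<^sub>L blinfun_inner_left b) v"
    by (simp add: blinfun.sum_left)
  finally show "A v = (\<Sum>b\<in>Basis. blinfun_scaleR_left (A b) o\<^sub>L blinfun_inner_left b) v" .
qed

text \<open>An injective map of \<open>F\<close> into itself is onto \<open>F\<close> by comparison
  of dimensions, so the inverse cannot leave \<open>F\<close>.\<close>

lemma blinfun_inverse_preserves_subspace:
  fixes A B :: "'f::euclidean_space \<Rightarrow>\<^sub>L 'f"
  assumes "subspace F" "\<And>v. v \<in> F \<Longrightarrow> A v \<in> F" "B o\<^sub>L A = id_blinfun" "v \<in> F"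
  shows "B v \<in> F"
proof -
  have BA: "B (A v) = v" for v
    using assms(3) by (metis blinfun_apply_blinfun_compose blinfun_apply_id_blinfun)
  have lin: "linear (blinfun_apply A)" by (simp add: blinfun.bounded_linear_right bounded_linear.linear)
  have "inj_on (blinfun_apply A) (span F)" by (rule inj_on_inverseI[of _ B]) (rule BA)
  then have "dim (blinfun_apply A ` F) = dim F" by (rule dim_image_eq[OF lin])
  moreover have "subspace (blinfun_apply A ` F)" by (rule linear_subspace_image[OF lin assms(1)])
  ultimately have "blinfun_apply A ` F = F"
    using subspace_dim_equal[of "blinfun_apply A ` F" F] assms(1,2) by (simp add: image_subset_iff)
  then obtain w where "w \<in> F" "v = A w" using assms(4) by blast
  then show ?thesis by (simp add: BA)
qed

section \<open>Transition cocycle of a bundle, and the isomorphism obtained from its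
  trivialisation\<close>

context bundle_charts
begin

lemma M: "smooth_atlas M" and E: "smooth_atlas (total E)" and mf: "smooth_manifold M" and subF: "subspace F"
  using vb smooth_manifold_imp_smooth_atlas unfolding smooth_vector_bundle_def by blast+

lemma proj_smooth: "e \<in> topspace (space_of (total E)) \<Longrightarrow> smooth_at (total E) M (proj E) e"
  using vb unfolding smooth_vector_bundle_def by (intro smooth_map_imp_smooth_at[OF E M]) auto

lemma proj_continuous: "continuous_map (space_of (total E)) (space_of M) (proj E)"
  using vb unfolding smooth_vector_bundle_def smooth_map_def by blast

lemma proj_topspace: "e \<in> topspace (space_of (total E)) \<Longrightarrow> proj E e \<in> topspace (space_of M)"
  using proj_continuous continuous_map_image_subset_topspace by blast

lemma U_topspace: "x \<in> U i \<Longrightarrow> x \<in> topspace (space_of M)"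
  using U_open openin_subset by blast

lemma h_facts:
  assumes "e \<in> topspace (space_of (total E))" "proj E e \<in> U i"
  shows h_F: "h i e \<in> F" and k_h: "k i (proj E e, h i e) = e" and h_fsmooth: "fsmooth (total E) (h i) e"
  using chart[of i] assms unfolding bundle_chart_def by auto

lemma k_facts:
  assumes "x \<in> U i" "v \<in> F"
  shows k_mem: "k i (x, v) \<in> topspace (space_of (total E))" and proj_k: "proj E (k i (x, v)) = x"
    and h_k: "h i (k i (x, v)) = v"
    and k_smooth: "smooth_at (product_manifold M (linear_manifold F)) (total E) (k i) (x, v)"
  using chart[of i] assms unfolding bundle_chart_def by auto

lemma h_linear:
  assumes "x \<in> U i" "e \<in> fibre E x"
  shows h_add: "e' \<in> fibre E x \<Longrightarrow> h i (vadd E e e') = h i e + h i e'"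
    and h_scale: "h i (vscale E c e) = c *\<^sub>R h i e"
  using chart[of i] assms unfolding bundle_chart_def by auto

lemma k_fibre: "x \<in> U i \<Longrightarrow> v \<in> F \<Longrightarrow> k i (x, v) \<in> fibre E x"
  unfolding fibre_def by (simp add: k_mem proj_k)

lemma fibre_closed:
  assumes "x \<in> topspace (space_of M)" "e \<in> fibre E x"
  shows "e' \<in> fibre E x \<Longrightarrow> vadd E e e' \<in> fibre E x" "vscale E c e \<in> fibre E x"
proof -
  have "real_vector_space_on (fibre E x) (vadd E) (vzero E x) (vscale E)"
    using vb assms(1) unfolding smooth_vector_bundle_def by blast
  then have "\<forall>e\<in>fibre E x. \<forall>e'\<in>fibre E x. vadd E e e' \<in> fibre E x" "\<forall>c. \<forall>e\<in>fibre E x. vscale E c e \<in> fibre E x"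
    unfolding real_vector_space_on_def by simp_all
  then show "e' \<in> fibre E x \<Longrightarrow> vadd E e e' \<in> fibre E x" "vscale E c e \<in> fibre E x"
    using assms(2) by blast+
qed

definition transition :: "'a \<Rightarrow> 'a \<Rightarrow> 'a \<Rightarrow> 'f \<Rightarrow> 'f" where
  "transition i j x v = h i (k j (x, v))"

context
  fixes i j x
  assumes i: "x \<in> U i" and j: "x \<in> U j"
begin

lemma transition_F: "v \<in> F \<Longrightarrow> transition i j x v \<in> F"
  unfolding transition_def using i j by (intro h_F) (simp_all add: k_mem proj_k)

text \<open>On a fibre \<open>k j\<close> inverts the additive map \<open>h j\<close>, hence is
  additive with respect to \<open>vadd E\<close>; applying the additive \<open>h i\<close> gives the
  claim.\<close>

lemma transition_add:
  assumes "v \<in> F" "w \<in> F"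
  shows "transition i j x (v + w) = transition i j x v + transition i j x w"
proof -
  let ?e = "vadd E (k j (x, v)) (k j (x, w))"
  note f = k_fibre[OF j assms(1)] k_fibre[OF j assms(2)]
  have e: "?e \<in> fibre E x" by (rule fibre_closed(1)[OF U_topspace[OF i] f])
  have "h j ?e = v + w" unfolding h_add[OF j f] using assms j by (simp add: h_k)
  moreover have "k j (x, h j ?e) = ?e" using e k_h[of ?e j] j by (simp add: fibre_def)
  ultimately have "k j (x, v + w) = ?e" by simp
  then show ?thesis unfolding transition_def by (simp add: h_add[OF i f])
qed

lemma transition_scale:
  assumes "v \<in> F"
  shows "transition i j x (c *\<^sub>R v) = c *\<^sub>R transition i j x v"
proof -
  let ?e = "vscale E c (k j (x, v))"
  note f = k_fibre[OF j assms(1)]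
  have e: "?e \<in> fibre E x" by (rule fibre_closed(2)[OF U_topspace[OF i] f])
  have "h j ?e = c *\<^sub>R v" unfolding h_scale[OF j f] using assms j by (simp add: h_k)
  moreover have "k j (x, h j ?e) = ?e" using e k_h[of ?e j] j by (simp add: fibre_def)
  ultimately have "k j (x, c *\<^sub>R v) = ?e" by simp
  then show ?thesis unfolding transition_def by (simp add: h_scale[OF i f])
qed

lemma transition_trans:
  "x \<in> U l \<Longrightarrow> v \<in> F \<Longrightarrow> transition i j x (transition j l x v) = transition i l x v"
  unfolding transition_def using k_h[of "k l (x, v)" j] j by (simp add: k_mem proj_k)

end

lemma transition_refl: "x \<in> U i \<Longrightarrow> v \<in> F \<Longrightarrow> transition i i x v = v"
  unfolding transition_def by (rule h_k)

lemma transition_fsmooth: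
  assumes i: "x \<in> U i" and j: "x \<in> U j" and v: "v \<in> F"
  shows "fsmooth M (\<lambda>y. transition i j y v) x"
proof -
  let ?N = "product_manifold M (linear_manifold F)"
  note x = U_topspace[OF i]
  have N: "smooth_atlas ?N" by (rule smooth_atlas_product_manifold[OF M smooth_atlas_linear_manifold])
  have "smooth_at M ?N (\<lambda>y. (y, v)) x"
    by (rule smooth_at_Pair[OF M smooth_at_id[OF M x]
          smooth_at_linear_manifoldI[OF fsmooth_const[OF M x] openin_topspace x]]) (use v in auto)
  from smooth_at_compose[OF M N this k_smooth[OF j v]]
  have s: "smooth_at M (total E) (\<lambda>y. k j (y, v)) x" .
  have "fsmooth (total E) (h i) (k j (x, v))"
    by (rule h_fsmooth) (use i j v in \<open>simp_all add: k_mem proj_k\<close>)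
  from fsmooth_compose[OF M E s this] show ?thesis unfolding transition_def .
qed

text \<open>Transition functions are only defined on \<open>F\<close>; along a projection \<open>P\<close> onto \<open>F\<close> they are extended
  by the identity on the kernel, so that they become automorphisms of the whole ambient space.\<close>

definition cocycle :: "('f \<Rightarrow> 'f) \<Rightarrow> 'a \<Rightarrow> 'a \<Rightarrow> 'a \<Rightarrow> ('f \<Rightarrow>\<^sub>L 'f)" where
  "cocycle P i j x = Blinfun (\<lambda>v. transition i j x (P v) + (v - P v))"

context
  fixes P :: "'f \<Rightarrow> 'f"
  assumes P: "linear P" "range P \<subseteq> F" "\<forall>v\<in>F. P v = v"
begin

lemma P_F: "P v \<in> F" using P(2) by auto

lemma P_P: "P (P v) = P v" using P(3) P_F by blast

lemma cocycle_apply: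
  assumes i: "x \<in> U i" and j: "x \<in> U j"
  shows "cocycle P i j x v = transition i j x (P v) + (v - P v)"
proof -
  have "linear (\<lambda>v. transition i j x (P v) + (v - P v))"
    by (rule linearI)
       (simp_all add: linear_add[OF P(1)] linear_scale[OF P(1)] transition_add[OF i j P_F P_F]
         transition_scale[OF i j P_F] algebra_simps)
  then show ?thesis unfolding cocycle_def
    by (simp add: bounded_linear_Blinfun_apply linear_conv_bounded_linear)
qed

lemma cocycle_fsmooth:
  assumes i: "x \<in> U i" and j: "x \<in> U j"
  shows "fsmooth M (cocycle P i j) x"
proof -
  note x = U_topspace[OF i]
  have "fsmooth M (\<lambda>y. cocycle P i j y b) x" for b
  proof (rule fsmooth_cong[OF M])
    show "fsmooth M (\<lambda>y. transition i j y (P b) + (b - P b)) x"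
      by (rule fsmooth_add[OF M transition_fsmooth[OF i j P_F] fsmooth_const[OF M x]])
    show "openin (space_of M) (U i \<inter> U j)" using U_open by (intro openin_Int)
  qed (use i j in \<open>auto simp: cocycle_apply\<close>)
  then have "fsmooth M (\<lambda>y. \<Sum>b\<in>Basis. blinfun_scaleR_left (cocycle P i j y b) o\<^sub>L blinfun_inner_left b) x"
    by (intro fsmooth_sum[OF M x] fsmooth_bilinear[OF M bounded_bilinear_blinfun_compose _ fsmooth_const[OF M x]]
          fsmooth_linear_comp[OF M bounded_linear_blinfun_scaleR_left])
  then show ?thesis unfolding blinfun_Basis_expansion[symmetric] .
qed

text \<open>With respect to \<open>F\<close> and the kernel of \<open>P\<close> the extended maps
  are block diagonal, with the identity on the kernel. The cocycle rules therefore reduce to those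
  for \<open>transition\<close> on \<open>F\<close>.\<close>

lemma linear_cocycle: "linear_cocycle M U (cocycle P) F"
proof
  show "smooth_manifold M" "subspace F" by (rule mf, rule subF)
  show "openin (space_of M) (U i)" for i by (rule U_open)
  show "p \<in> topspace (space_of M) \<Longrightarrow> p \<in> U p" for p by (rule U_mem)
  show "fsmooth M (cocycle P i j) x" if "x \<in> U i" "x \<in> U j" for x i j
    using that by (rule cocycle_fsmooth)
  show "cocycle P i i x = id_blinfun" if "x \<in> U i" for x i
    by (rule blinfun_eqI) (simp add: cocycle_apply[OF that that] transition_refl[OF that P_F])
  show "cocycle P i j x o\<^sub>L cocycle P j l x = cocycle P i l x" if "x \<in> U i" "x \<in> U j" "x \<in> U l" for x i j l
  proof (rule blinfun_eqI)
    fix v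
    let ?t = "transition j l x (P v)"
    have t: "?t \<in> F" by (rule transition_F[OF that(2,3) P_F])
    have "P (?t + (v - P v)) = ?t"
      using P(3) t by (simp add: linear_add[OF P(1)] linear_diff[OF P(1)] P_P)
    then show "(cocycle P i j x o\<^sub>L cocycle P j l x) v = cocycle P i l x v"
      using transition_trans[OF that(1,2,3) P_F[of v]]
      by (simp add: cocycle_apply that)
  qed
  show "cocycle P i j x v \<in> F" if "x \<in> U i" "x \<in> U j" "v \<in> F" for x i j v
    using that P(3) transition_F[OF that] by (simp add: cocycle_apply)
qed

end

text \<open>At \<open>e\<close> the map \<open>\<psi>\<close> uses the trivialisation indexed by the
  base point of \<open>e\<close>, so it is globally defined, but its index varies with
  \<open>e\<close>. Compatibility shows that any fixed index \<open>i\<close> gives the same value,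
  and near a given point this fixed expression is smooth. The inverse \<open>\<Gamma>\<close> is
  treated in the same way, its smoothness resting on that of operator inversion.\<close>

lemma bundle_isomorphism_of_trivialisation:
  fixes P :: "'f \<Rightarrow> 'f" and \<Omega> :: "'a \<Rightarrow> 'a \<Rightarrow> ('f \<Rightarrow>\<^sub>L 'f)"
  assumes P: "linear P" "range P \<subseteq> F" "\<forall>v\<in>F. P v = v"
    and \<Omega>: "\<forall>i. \<forall>x\<in>U i. fsmooth M (\<Omega> i) x \<and> inj (blinfun_apply (\<Omega> i x)) \<and> (\<forall>v\<in>F. \<Omega> i x v \<in> F)"
    and compat: "\<forall>i j. \<forall>x\<in>U i \<inter> U j. \<Omega> j x o\<^sub>L cocycle P j i x = \<Omega> i x"
  shows "\<exists>\<Psi>. bundle_isomorphism M E (product_bundle M F) \<Psi>"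
proof -
  let ?X = "space_of M" and ?Y = "space_of (total E)"
  define N where "N = product_manifold M (linear_manifold F)"
  have L: "smooth_atlas (linear_manifold F)" by (rule smooth_atlas_linear_manifold)
  have N: "smooth_atlas N" unfolding N_def by (rule smooth_atlas_product_manifold[OF M L])
  have topN: "topspace (space_of N) = topspace ?X \<times> F" by (simp add: N_def)
  define B where "B i x = (SOME C. \<Omega> i x o\<^sub>L C = id_blinfun \<and> C o\<^sub>L \<Omega> i x = id_blinfun)" for i x
  have B: "\<Omega> i x o\<^sub>L B i x = id_blinfun" "B i x o\<^sub>L \<Omega> i x = id_blinfun" if "x \<in> U i" for i x
  proof -
    have "inj (blinfun_apply (\<Omega> i x))" using \<Omega> that by blast
    then have "\<exists>C. \<Omega> i x o\<^sub>L C = id_blinfun \<and> C o\<^sub>L \<Omega> i x = id_blinfun"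
      by (rule blinfun_inj_inverse) blast
    from someI_ex[OF this] show "\<Omega> i x o\<^sub>L B i x = id_blinfun" "B i x o\<^sub>L \<Omega> i x = id_blinfun"
      unfolding B_def by (rule conjunct1, rule conjunct2)
  qed
  have \<Omega>B: "\<Omega> i x (B i x v) = v" and B\<Omega>: "B i x (\<Omega> i x v) = v" if "x \<in> U i" for i x v
    using B[OF that] by (metis blinfun_apply_blinfun_compose blinfun_apply_id_blinfun)+
  have \<Omega>F: "\<Omega> i x v \<in> F" if "x \<in> U i" "v \<in> F" for i x v using \<Omega> that by blast
  have BF: "B i x v \<in> F" if "x \<in> U i" "v \<in> F" for i x v
    by (rule blinfun_inverse_preserves_subspace[OF subF \<Omega>F[OF that(1)] B(2)[OF that(1)] that(2)])
  define \<psi> where "\<psi> e = \<Omega> (proj E e) (proj E e) (h (proj E e) e)" for e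
  define \<Gamma> where "\<Gamma> z = k (fst z) (fst z, B (fst z) (fst z) (snd z))" for z
  define \<Psi> where "\<Psi> e = (proj E e, \<psi> e)" for e
  have \<psi>: "\<psi> e = \<Omega> i (proj E e) (h i e)" if e: "e \<in> topspace ?Y" and i: "proj E e \<in> U i" for e i
  proof -
    let ?x = "proj E e"
    have x: "?x \<in> U ?x" by (rule U_mem[OF proj_topspace[OF e]])
    note hF = h_F[OF e x]
    have "cocycle P i ?x ?x (h ?x e) = transition i ?x ?x (h ?x e)"
      using P(3) hF by (simp add: cocycle_apply[OF P i x])
    also have "\<dots> = h i e" unfolding transition_def k_h[OF e x] ..
    finally have "\<Omega> i ?x (h i e) = (\<Omega> i ?x o\<^sub>L cocycle P i ?x ?x) (h ?x e)" by simp
    also have "\<dots> = \<psi> e" using compat i x by (simp add: \<psi>_def)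
    finally show ?thesis by simp
  qed
  have \<psi>F: "\<psi> e \<in> F" if e: "e \<in> topspace ?Y" for e
    unfolding \<psi>_def using U_mem[OF proj_topspace[OF e]] by (intro \<Omega>F h_F[OF e])
  have \<Gamma>\<Psi>: "\<Gamma> (\<Psi> e) = e" if e: "e \<in> topspace ?Y" for e
    using U_mem[OF proj_topspace[OF e]] by (simp add: \<Gamma>_def \<Psi>_def \<psi>_def B\<Omega> k_h[OF e])
  have \<Gamma>: "\<Gamma> (x, v) \<in> topspace ?Y" "\<Psi> (\<Gamma> (x, v)) = (x, v)"
    "x \<in> U i \<Longrightarrow> \<Gamma> (x, v) = k i (x, B i x v)"
    if x: "x \<in> topspace ?X" and v: "v \<in> F" for x v i
  proof -
    have xx: "x \<in> U x" by (rule U_mem[OF x])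
    have G: "\<Gamma> (x, v) = k x (x, B x x v)" by (simp add: \<Gamma>_def)
    note bF = BF[OF xx v]
    show mem: "\<Gamma> (x, v) \<in> topspace ?Y" unfolding G by (rule k_mem[OF xx bF])
    have pr: "proj E (\<Gamma> (x, v)) = x" unfolding G by (rule proj_k[OF xx bF])
    have ps: "\<psi> (\<Gamma> (x, v)) = v"
      unfolding \<psi>_def pr unfolding G h_k[OF xx bF] by (rule \<Omega>B[OF xx])
    show "\<Psi> (\<Gamma> (x, v)) = (x, v)" by (simp add: \<Psi>_def pr ps)
    \<comment> \<open>Comparing \<open>\<psi>\<close> at the point \<open>\<Gamma> (x, v)\<close> in
      the trivialisations \<open>x\<close> and \<open>i\<close> shows that its coordinate in
      \<open>i\<close> is \<open>B i x v\<close>; this frees \<open>\<Gamma>\<close> from the moving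
      index.\<close>
    show "\<Gamma> (x, v) = k i (x, B i x v)" if i: "x \<in> U i"
    proof -
      have "v = \<Omega> i x (h i (\<Gamma> (x, v)))" using \<psi>[OF mem, of i] i pr ps by simp
      then have "B i x v = h i (\<Gamma> (x, v))" using B\<Omega>[OF i] by metis
      then show ?thesis using k_h[OF mem, of i] i pr by simp
    qed
  qed
  have "smooth_at (total E) N \<Psi> e" if e: "e \<in> topspace ?Y" for e
  proof -
    let ?i = "proj E e"
    have i: "?i \<in> U ?i" by (rule U_mem[OF proj_topspace[OF e]])
    let ?A = "{e' \<in> topspace ?Y. proj E e' \<in> U ?i}"
    have A: "openin ?Y ?A" by (rule openin_continuous_map_preimage[OF proj_continuous U_open])
    have "fsmooth M (\<Omega> ?i) ?i" using \<Omega> i by blast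
    from fsmooth_bilinear[OF E bounded_bilinear_blinfun_apply fsmooth_compose[OF E M proj_smooth[OF e] this] h_fsmooth[OF e i]]
    have "fsmooth (total E) \<psi> e"
    proof (rule fsmooth_cong[OF E _ A])
      show "\<Omega> ?i (proj E y) (h ?i y) = \<psi> y" if "y \<in> ?A" for y
        by (rule \<psi>[symmetric]) (use that in auto)
    qed (use e i in simp)
    then have "smooth_at (total E) (linear_manifold F) \<psi> e"
      by (rule smooth_at_linear_manifoldI[OF _ openin_topspace e]) (use \<psi>F in auto)
    then show ?thesis unfolding N_def \<Psi>_def by (rule smooth_at_Pair[OF E proj_smooth[OF e]])
  qed
  then have s\<Psi>: "smooth_map (total E) N \<Psi>" by (rule smooth_at_imp_smooth_map[OF E N])
  have "smooth_at N (total E) \<Gamma> z" if z: "z \<in> topspace (space_of N)" for z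
  proof -
    obtain x v where zx: "z = (x, v)" and x: "x \<in> topspace ?X" and v: "v \<in> F" using z topN by auto
    have xx: "x \<in> U x" by (rule U_mem[OF x])
    have A: "openin (space_of N) (U x \<times> F)" "z \<in> U x \<times> F"
      using U_open xx v by (simp_all add: N_def zx openin_prod_Times_iff)
    have "fsmooth M (\<Omega> x) x" using \<Omega> xx by blast
    then have "fsmooth M (B x) x"
      by (rule fsmooth_blinfun_inverse[OF M _ U_open xx B]) simp_all
    from fsmooth_fst_snd(1)[OF M L x _ this, of v] v have "fsmooth N (\<lambda>p. B x (fst p)) z"
      unfolding N_def zx by simp
    moreover have "fsmooth N (\<lambda>p. snd p) z"
      using fsmooth_fst_snd(2)[OF M L x _ smooth_at_linear_manifoldD[OF smooth_at_id[OF L]]] v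
      unfolding N_def zx by simp
    ultimately have "fsmooth N (\<lambda>p. B x (fst p) (snd p)) z"
      by (rule fsmooth_bilinear[OF N bounded_bilinear_blinfun_apply])
    then have "smooth_at N (linear_manifold F) (\<lambda>p. B x (fst p) (snd p)) z"
      by (rule smooth_at_linear_manifoldI[OF _ A]) (use BF in auto)
    moreover have "smooth_at N M (\<lambda>p. fst p) z"
      unfolding N_def zx by (rule smooth_at_fst[OF M L x]) (simp add: v)
    \<comment> \<open>Near \<open>z\<close> the index \<open>x\<close> is held fixed, so
      \<open>\<Gamma>\<close> is this smooth self-map of the product followed by the smooth map
      \<open>k x\<close>.\<close>
    ultimately have s1: "smooth_at N N (\<lambda>p. (fst p, B x (fst p) (snd p))) z"
      unfolding N_def[symmetric] by (subst (2) N_def) (rule smooth_at_Pair[OF N])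
    have "smooth_at N (total E) (k x) (x, B x x v)"
      unfolding N_def by (rule k_smooth[OF xx BF[OF xx v]])
    then have "smooth_at N (total E) (\<lambda>p. k x (fst p, B x (fst p) (snd p))) z"
      by (intro smooth_at_compose[OF N N s1]) (simp add: zx)
    then show ?thesis
      by (rule smooth_at_cong[OF N _ A]) (auto simp: \<Gamma>(3)[OF U_topspace])
  qed
  then have s\<Gamma>: "smooth_map N (total E) \<Gamma>" by (rule smooth_at_imp_smooth_map[OF N E])
  have "homeomorphic_maps ?Y (space_of N) \<Psi> \<Gamma>"
    unfolding homeomorphic_maps_def
    using s\<Psi> s\<Gamma> \<Gamma>\<Psi> \<Gamma>(2) unfolding smooth_map_def topN by auto
  then have "diffeomorphism (total E) N \<Psi>"
    unfolding diffeomorphism_def using s\<Psi> s\<Gamma> by blast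
  moreover have "\<Psi> (vadd E e e') = vadd (product_bundle M F) (\<Psi> e) (\<Psi> e')"
    "\<Psi> (vscale E c e) = vscale (product_bundle M F) c (\<Psi> e)"
    if p: "p \<in> topspace ?X" and e: "e \<in> fibre E p" and e': "e' \<in> fibre E p" for p e e' c
  proof -
    have pp: "p \<in> U p" by (rule U_mem[OF p])
    have pr: "proj E e = p" "proj E e' = p" "proj E (vadd E e e') = p" "proj E (vscale E c e) = p"
      using e e' fibre_closed[OF p e] unfolding fibre_def by auto
    show "\<Psi> (vadd E e e') = vadd (product_bundle M F) (\<Psi> e) (\<Psi> e')"
      by (simp add: \<Psi>_def \<psi>_def pr product_bundle_def h_add[OF pp e e'] blinfun.add_right)
    show "\<Psi> (vscale E c e) = vscale (product_bundle M F) c (\<Psi> e)"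
      by (simp add: \<Psi>_def \<psi>_def pr product_bundle_def h_scale[OF pp e] blinfun.scaleR_right)
  qed
  moreover have "total (product_bundle M F) = N" "proj (product_bundle M F) (\<Psi> e) = proj E e" for e
    by (simp_all add: product_bundle_def N_def \<Psi>_def)
  ultimately have "bundle_isomorphism M E (product_bundle M F) \<Psi>"
    unfolding bundle_isomorphism_def by simp
  then show ?thesis by blast
qed

end

theorem mainTheorem4:
  fixes M :: "('a, 'e::euclidean_space) charted_space"
    and F :: "'f::euclidean_space set"
    and E :: "('b, 'g::euclidean_space, 'a) bundle_data"
  assumes "smooth_manifold M"
    and "contractible_space (space_of M)"
    and "smooth_vector_bundle M F E"
  shows "\<exists>V :: 'f set. subspace V \<and> (\<exists>\<Psi>. bundle_isomorphism M E (product_bundle M V) \<Psi>)"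
proof (intro exI[of _ F] conjI)
  show subF: "subspace F" using assms(3) unfolding smooth_vector_bundle_def by blast
  obtain U h k where "bundle_charts M F E U h k"
    by (rule smooth_vector_bundle_charts[OF assms(3)])
  then interpret bundle_charts M F E U h k .
  obtain P :: "'f \<Rightarrow> 'f" where P: "linear P" "range P \<subseteq> F" "\<forall>v\<in>F. P v = v"
    by (rule linear_projection_exists[OF subF])
  interpret linear_cocycle M U "cocycle P" F by (rule linear_cocycle[OF P])
  obtain \<Omega> where
    "\<forall>i. \<forall>x\<in>U i. fsmooth M (\<Omega> i) x \<and> inj (blinfun_apply (\<Omega> i x)) \<and> (\<forall>v\<in>F. \<Omega> i x v \<in> F)"
    "\<forall>i j. \<forall>x\<in>U i \<inter> U j. \<Omega> j x o\<^sub>L cocycle P j i x = \<Omega> i x"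
    by (rule smooth_trivialisation[OF assms(2)])
  from bundle_isomorphism_of_trivialisation[OF P this]
  show "\<exists>\<Psi>. bundle_isomorphism M E (product_bundle M F) \<Psi>" .
qed


end
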